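(* Let $k,n$ be positive integers with $k+2\le n$. The realizable amplituhedron chambers $\mathcal A^\sigma_{n,k,2}$ are exactly the $w$-chambers $\hat\Delta^\circ_w$ where $w\in D_{k+1,n}$. That is: for every $\sigma\in\{+,-\}^{\binom n2}$ (modulo global sign) such that $\mathcal A^\sigma_{n,k,2}(Z)\ne\emptyset$ for some $Z\in\mathrm{Mat}^{>0}_{n,k+2}$, there is $w\in D_{k+1,n}$ with $\mathcal A^\sigma_{n,k,2}(Z)=\hat\Delta_w^\circ(Z)$ for all $Z\in\mathrm{Mat}^{>0}_{n,k+2}$; and conversely, for every $w\in D_{k+1,n}$ the $w$-chamber $\hat\Delta_w^\circ$ is of the form $\mathcal A^\sigma_{n,k,2}$ for a realizable $\sigma$.
   Context: $\mathrm{Gr}_{k,n}$ is the Grassmannian of $k$-planes in $\mathbb R^n$ (row spans of full-rank $k\times n$ matrices); $\mathrm{Gr}^{\ge0}_{k,n}$ is the set of points having a representative with all maximal minors $\ge0$. $\mathrm{Mat}^{>0}_{n,k+2}$ is the set of real $n\times(k+2)$ matrices with all maximal minors positive; $Z$ has rows $Z_1,\dots,Z_n$ and induces $\tilde Z:\mathrm{Gr}^{\ge0}_{k,n}\to\mathrm{Gr}_{k,k+2}$, $C\mapsto CZ$, with image the amplituhedron $\mathcal A_{n,k,2}(Z)$. For $Y\in\mathrm{Gr}_{k,k+2}$ with representative rows $y_1,\dots,y_k$, $\langle Yij\rangle=\det(y_1,\dots,y_k,Z_i,Z_j)$ (up to a common nonzero scalar), and $\langle Yi\hat j\rangle:=(-1)^{k+1}\langle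 Yij\rangle$. Chambers: for a sign vector $\sigma=(\sigma_{ij})_{1\le i<j\le n}\in\{+,-\}^{\binom n2}$, considered modulo multiplication by $\pm1$, $\mathcal A^\sigma_{n,k,2}(Z):=\{Y\in\mathcal A_{n,k,2}(Z): \mathrm{sign}\langle Yij\rangle=\sigma_{ij}\ \forall i<j\}$ (for some matrix representative of $Y$) is an open amplituhedron chamber. $\sigma$ (or $\mathcal A^\sigma_{n,k,2}$) is realizable if $\mathcal A^\sigma_{n,k,2}(Z)\neq\emptyset$ for some $Z\in\mathrm{Mat}^{>0}_{n,k+2}$. For $v\in\mathbb R^n$, $\mathrm{Flip}(v)\subseteq[n]$ is the set of $i$ such that $v_i,v_{i+1}\ne0$ have different signs (indices mod $n$). For $w\in S_n$, a letter $i$ is a cyclic left descent of $w$ if either $i\ge2$ and $i$ occurs to the left of $i-1$ in the one-line notation of $w$, or $i=1$ and $1$ occurs to the left of $n$. $\mathrm{cDes}_L(w)$ is the set of cyclic left descents. $D_{k+1,n}$ is the set of $w\in S_n$ with $w_n=n$ and exactly $k+1$ cyclic left descents. $w^{(a)}$ denotes the cyclic rotation of the word $w$ ending at $a$, and $I_r:=\mathrm{cDes}_L(w^{(r-1)})$ for $r=1,\dots,n$ (with $w^{(0)}=w^{(n)}=w$). The open $w$-chamber $\hat\Delta_w^\circ(Z)$ is the set of $Y\in\mathcal A_{n,k,2}(Z)$ such that $\langle Yij\rangle\ne0$ for all $i\ne j$ and, for $a=1,\dots,n$, $\mathrm{Flip}(\langle Ya\hat1\rangle,\dots,\langle Ya\,\widehat{a-1}\rangle,\langle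 Yaa\rangle,\langle Ya\,a{+}1\rangle,\dots,\langle Yan\rangle)=I_a\setminus\{a\}$. Equivalently it is the set of $Y\in\mathcal A_{n,k,2}(Z)$ with (for some representative) $\mathrm{sgn}\langle Yaj\rangle=(-1)^{|I_a\cap[a,j-1]|-1}$ for $j>a$ and $\mathrm{sgn}\langle Ya\hat j\rangle=(-1)^{|I_a\cap[a,j-1]|-1}$ for $j<a$, where $[a,b]$ denotes a cyclic interval in $[n]$ (and $[a,0]=[a,n]$). *)

theory Defs
  imports
    "Jordan_Normal_Form.DL_Rank"
    "Jordan_Normal_Form.DL_Submatrix"
    "HOL-Combinatorics.Multiset_Permutations"
begin

subsection \<open>Grassmannians and the amplituhedron\<close>

definition full_row_rank :: "nat \<Rightarrow> nat \<Rightarrow> real mat \<Rightarrow> bool" where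
  "full_row_rank k n M \<longleftrightarrow> M \<in> carrier_mat k n \<and> vec_space.rank k M = k"

abbreviation row_span :: "nat \<Rightarrow> real mat \<Rightarrow> real vec set" where
  "row_span n M \<equiv> vec_space.row_space n M"

definition Gr :: "nat \<Rightarrow> nat \<Rightarrow> real vec set set" where
  "Gr k n = {row_span n M | M. full_row_rank k n M}"

definition represents :: "nat \<Rightarrow> nat \<Rightarrow> real mat \<Rightarrow> real vec set \<Rightarrow> bool" where
  "represents k n M V \<longleftrightarrow> full_row_rank k n M \<and> row_span n M = V"

definition Gr_nonneg :: "nat \<Rightarrow> nat \<Rightarrow> real vec set set" where
  "Gr_nonneg k n = {V \<in> Gr k n. \<exists>C. represents k n C V \<and>
     (\<forall>J. J \<subseteq> {..<n} \<and> card J = k \<longrightarrow> det (submatrix C UNIV J) \<ge> 0)}"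

definition Mat_pos :: "nat \<Rightarrow> nat \<Rightarrow> real mat set" where
  "Mat_pos n m = {Z \<in> carrier_mat n m.
     \<forall>I. I \<subseteq> {..<n} \<and> card I = m \<longrightarrow> det (submatrix Z I UNIV) > 0}"

text \<open>On subspaces, the map \<open>C \<mapsto> CZ\<close> is the image under \<open>v \<mapsto> vZ\<close>, see \<open>Z_map_row_span\<close> below.\<close>

definition Z_map :: "real mat \<Rightarrow> real vec set \<Rightarrow> real vec set" where
  "Z_map Z V = (\<lambda>v. Z\<^sup>T *\<^sub>v v) ` V"

lemma Z_map_row_span:
  assumes C: "C \<in> carrier_mat k n" and Z: "Z \<in> carrier_mat n m"
  shows "Z_map Z (row_span n C) = row_span m (C * Z)"
proof -
  interpret A: vec_space "TYPE(real)" n .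
  interpret B: vec_space "TYPE(real)" m .
  have CZ: "C * Z \<in> carrier_mat k m" using C Z by simp
  have *: "(C * Z)\<^sup>T *\<^sub>v y = Z\<^sup>T *\<^sub>v (C\<^sup>T *\<^sub>v y)" if "y \<in> carrier_vec k" for y
    unfolding transpose_mult[OF C Z]
    by (rule assoc_mult_mat_vec[of _ m n _ k]) (use C Z that in auto)
  have dims: "dim_row C = k" "dim_col C = n" "dim_row (C * Z) = k" "dim_col (C * Z) = m"
    using C CZ by auto
  have 1: "row_span n C = (\<lambda>y. C\<^sup>T *\<^sub>v y) ` carrier_vec k"
    unfolding A.row_space_eq[OF C] dims using C by (auto simp: image_iff)
  have 2: "row_span m (C * Z) = (\<lambda>y. (C * Z)\<^sup>T *\<^sub>v y) ` carrier_vec k"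
    unfolding B.row_space_eq[OF CZ] dims using CZ by (auto simp: image_iff)
  show ?thesis
    unfolding 1 2 Z_map_def image_image by (intro image_cong refl) (simp add: *)
qed

definition amplituhedron :: "nat \<Rightarrow> nat \<Rightarrow> real mat \<Rightarrow> real vec set set" where
  "amplituhedron n k Z = Z_map Z ` Gr_nonneg k n"

subsection \<open>Twistor coordinates and sign chambers\<close>

text \<open>Throughout, indices \<open>i\<close>, \<open>j\<close>, \<open>a\<close> range over \<open>{1..n}\<close>, whereas the
  rows of a matrix are numbered from \<open>0\<close>; hence the shift in \<open>Z\<^sub>i = row Z (i - 1)\<close>.
  The bracket depends on the representative \<open>y\<close> of a point of the Grassmannian.\<close>

definition twistor :: "real mat \<Rightarrow> real mat \<Rightarrow> nat \<Rightarrow> nat \<Rightarrow> real" where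
  "twistor Z y i j =
     det (mat_of_rows (dim_col Z) (rows y @ [row Z (i - 1), row Z (j - 1)]))"

definition twistor_hat :: "nat \<Rightarrow> real mat \<Rightarrow> real mat \<Rightarrow> nat \<Rightarrow> nat \<Rightarrow> real" where
  "twistor_hat k Z y i j = (-1) ^ (k + 1) * twistor Z y i j"

text \<open>Sign vectors have entries \<open>1\<close> and \<open>-1\<close>; the values \<open>\<sigma> i j\<close> outside
  \<open>1 \<le> i < j \<le> n\<close> are never inspected. As the representative \<open>y\<close> is existentially
  quantified, for \<open>k \<ge> 1\<close> a chamber only depends on \<open>\<sigma>\<close> up to a global sign.\<close>

definition sign_vector :: "nat \<Rightarrow> (nat \<Rightarrow> nat \<Rightarrow> real) \<Rightarrow> bool" where
  "sign_vector n \<sigma> \<longleftrightarrow> (\<forall>i j. 1 \<le> i \<and> i < j \<and> j \<le> n \<longrightarrow> \<sigma> i j \<in> {1, -1})"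

definition chamber ::
  "nat \<Rightarrow> nat \<Rightarrow> (nat \<Rightarrow> nat \<Rightarrow> real) \<Rightarrow> real mat \<Rightarrow> real vec set set" where
  "chamber n k \<sigma> Z = {Y \<in> amplituhedron n k Z. \<exists>y. represents k (k + 2) y Y \<and>
     (\<forall>i j. 1 \<le> i \<and> i < j \<and> j \<le> n \<longrightarrow> sgn (twistor Z y i j) = \<sigma> i j)}"

definition realizable :: "nat \<Rightarrow> nat \<Rightarrow> (nat \<Rightarrow> nat \<Rightarrow> real) \<Rightarrow> bool" where
  "realizable n k \<sigma> \<longleftrightarrow> (\<exists>Z \<in> Mat_pos n (k + 2). chamber n k \<sigma> Z \<noteq> {})"

subsection \<open>Cyclic descents and w-chambers\<close>

text \<open>A vector is given by its entries \<open>v 1, \<dots>, v n\<close>; the index after \<open>n\<close> is \<open>1\<close>.\<close>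

definition Flip :: "nat \<Rightarrow> (nat \<Rightarrow> real) \<Rightarrow> nat set" where
  "Flip n v = {i \<in> {1..n}. let i' = (if i = n then 1 else i + 1) in
     v i \<noteq> 0 \<and> v i' \<noteq> 0 \<and> sgn (v i) \<noteq> sgn (v i')}"

text \<open>Permutations are words: lists in one-line notation.\<close>

definition left_of :: "nat list \<Rightarrow> nat \<Rightarrow> nat \<Rightarrow> bool" where
  "left_of w x y \<longleftrightarrow> (\<exists>p q. p < q \<and> q < length w \<and> w ! p = x \<and> w ! q = y)"

definition cDes_L :: "nat \<Rightarrow> nat list \<Rightarrow> nat set" where
  "cDes_L n w = {i \<in> {1..n}. (i \<ge> 2 \<and> left_of w i (i - 1)) \<or> (i = 1 \<and> left_of w 1 n)}"

definition D :: "nat \<Rightarrow> nat \<Rightarrow> nat list set" where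
  "D r n = {w \<in> permutations_of_set {1..n}. last w = n \<and> card (cDes_L n w) = r}"

text \<open>If \<open>w = u @ a # v\<close> with \<open>a \<notin> set u\<close>, then \<open>rot_end w a = v @ u @ [a]\<close>.\<close>

definition rot_end :: "nat list \<Rightarrow> nat \<Rightarrow> nat list" where
  "rot_end w a = tl (dropWhile (\<lambda>x. x \<noteq> a) w) @ takeWhile (\<lambda>x. x \<noteq> a) w @ [a]"

text \<open>For \<open>r = 1\<close> the rotation ends at \<open>0\<close>, to be read as \<open>n\<close>.\<close>

definition I_set :: "nat \<Rightarrow> nat list \<Rightarrow> nat \<Rightarrow> nat set" where
  "I_set n w r = cDes_L n (rot_end w (if r = 1 then n else r - 1))"

definition w_chamber :: "nat \<Rightarrow> nat \<Rightarrow> nat list \<Rightarrow> real mat \<Rightarrow> real vec set set" where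
  "w_chamber n k w Z = {Y \<in> amplituhedron n k Z. \<exists>y. represents k (k + 2) y Y \<and>
     (\<forall>i\<in>{1..n}. \<forall>j\<in>{1..n}. i \<noteq> j \<longrightarrow> twistor Z y i j \<noteq> 0) \<and>
     (\<forall>a\<in>{1..n}.
        Flip n (\<lambda>j. if j < a then twistor_hat k Z y a j else twistor Z y a j)
          = I_set n w a - {a})}"

end

theory Submission
  imports Defs
begin

text \<open>
  Fix a representative of \<open>Y\<close> and project \<open>\<real>\<^sup>k\<^sup>+\<^sup>2\<close> along \<open>Y\<close> onto a plane. The rows of \<open>Z\<close> become plane vectors
  \<open>z\<^sub>1, \<dots>, z\<^sub>n\<close>, and \<open>\<langle>Yij\<rangle>\<close> is a fixed multiple of \<open>det (z\<^sub>i, z\<^sub>j)\<close>. The hats amount to continuing this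
  sequence by \<open>z\<^sub>n\<^sub>+\<^sub>j = (-1)\<^sup>k\<^sup>+\<^sup>1 z\<^sub>j\<close>. Suppose that no two of the \<open>z\<^sub>i\<close> are parallel.
  The main point is that, up to orientation, the configurations from points of the amplituhedron turn
  counterclockwise by less than half a turn in each step from \<open>z\<^sub>i\<close> to \<open>z\<^sub>i\<^sub>+\<^sub>1\<close>, and by exactly \<open>k + 1\<close> half
  turns from \<open>z\<^sub>1\<close> to \<open>z\<^sub>n\<^sub>+\<^sub>1\<close>.

  The signs of such a configuration record just the cyclic order of the lines spanned by the \<open>z\<^sub>j\<close>, that is,
  a cyclic word. The letter \<open>j - 1\<close> (the letter \<open>n\<close> if \<open>j = 1\<close>) stands for the line of \<open>z\<^sub>j\<close>, and the word ends
  with the line of \<open>z\<^sub>1\<close>. The step from \<open>z\<^sub>j\<close> to \<open>z\<^sub>j\<^sub>+\<^sub>1\<close> leaves or crosses the line of \<open>z\<^sub>1\<close> exactly if the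
  letter \<open>j\<close> is a cyclic left descent, so there are \<open>k + 1\<close> of these. Rotating the word so that it
  ends with \<open>a - 1\<close> means to read the lines from that of \<open>z\<^sub>a\<close> onwards; hence its descents other than
  \<open>a\<close> are the flips of the row \<open>\<langle>Ya\<cdot>\<rangle>\<close> (lemma \<open>Flip_word_sign\<close>).

  The turning number comes from variation diminution. For a vector \<open>u\<close> the sequence \<open>det (u, z\<^sub>j)\<close> lies in
  the column space of \<open>Z\<close>, which forces at most \<open>k + 1\<close> sign changes (\<open>changes_lincomb_less\<close>). If \<open>Y = CZ\<close>
  it is also annihilated by \<open>C\<close>, which forces at least \<open>k\<close> sign changes (\<open>changes_kernel_ge\<close>), at first if
  the maximal minors of \<open>C\<close> are strictly positive and then, as nonzero brackets keep their signs under
  small changes of \<open>C\<close>, for all \<open>C\<close> that occur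
  (\<open>perturb_to_positive\<close>). Letting \<open>u\<close> pass through \<open>z\<^sub>a\<close> changes the sign of the \<open>a\<close>-th entry alone, and both counts must stay in \<open>{k, k + 1}\<close>: this makes the signs on the two sides of
  the entry \<open>a\<close> opposite, and for \<open>a = 1\<close> it determines the number of changes in the row (\<open>coords_signs_positive\<close>).

  For the converse one point per word suffices. Write \<open>(X + i)\<^sup>k\<^sup>+\<^sup>1 = F + iG\<close>. As \<open>x\<close> runs through the real
  line, the argument of \<open>F(x) + iG(x)\<close> sweeps out \<open>k + 1\<close> half turns, so that every
  configuration as above has the form \<open>z\<^sub>j = (G(x\<^sub>j), F(x\<^sub>j))\<close>, up to positive factors and a rotation, with
  \<open>x\<^sub>1 < \<dots> < x\<^sub>n\<close>. The matrix \<open>Z\<close> with rows \<open>(1, x\<^sub>j, \<dots>, x\<^sub>j\<^sup>k\<^sup>-\<^sup>1, G(x\<^sub>j), F(x\<^sub>j))\<close>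
  has positive maximal minors, and projecting along the span \<open>Y\<close> of the first \<open>k\<close> unit vectors gives the \<open>z\<^sub>j\<close>. This \<open>Y\<close>
  is in the amplituhedron: if \<open>\<langle>Y1\<cdot>\<rangle>\<close> changes sign between \<open>i\<close> and \<open>i + 1\<close>, the linear relation among \<open>z\<^sub>1\<close>,
  \<open>z\<^sub>i\<close>, \<open>z\<^sub>i\<^sub>+\<^sub>1\<close> is a row vector that \<open>Z\<close> maps into \<open>Y\<close>, and the \<open>k\<close> rows obtained in this way form a matrix
  with nonnegative maximal minors (\<open>polynomial_configuration_in_amplituhedron\<close>).
\<close>

section \<open>Maximal minors along increasing selections of columns\<close>

text \<open>
  Row and column indices start from \<open>0\<close> in matrices and in the functions that stand for them. A maximal
  minor of an \<open>m \<times> n\<close> matrix is named by an increasing function rather than by a set of columns, so that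
  columns can be exchanged by function update.
\<close>
definition selections :: "nat \<Rightarrow> nat \<Rightarrow> (nat \<Rightarrow> nat) set" where
  "selections m n = {f. strict_mono_on {..<m} f \<and> f ` {..<m} \<subseteq> {..<n}}"

definition max_minor :: "nat \<Rightarrow> (nat \<Rightarrow> nat \<Rightarrow> real) \<Rightarrow> (nat \<Rightarrow> nat) \<Rightarrow> real" where
  "max_minor m A f = det (mat m m (\<lambda>(r, c). A r (f c)))"

lemma selectionsD:
  assumes "f \<in> selections m n"
  shows "\<And>c. c < m \<Longrightarrow> f c < n" and "\<And>c d. c < d \<Longrightarrow> d < m \<Longrightarrow> f c < f d"
  using assms by (auto simp: selections_def strict_mono_on_def)

lemma selectionsI:
  assumes "\<And>c. c < m \<Longrightarrow> f c < n" and "\<And>c d. c < d \<Longrightarrow> d < m \<Longrightarrow> f c < f d"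
  shows "f \<in> selections m n"
  using assms by (auto simp: selections_def strict_mono_on_def)

lemma selections_inj:
  assumes "f \<in> selections m n" shows "inj_on f {..<m}"
  using assms strict_mono_on_imp_inj_on by (auto simp: selections_def)

lemma pick_selection:
  assumes f: "f \<in> selections m n" and c: "c < m"
  shows "pick (f ` {..<m}) c = f c"
proof -
  have "{a \<in> f ` {..<m}. a < f c} = f ` {..<c}" (is "?A = ?B")
  proof
    show "?A \<subseteq> ?B" using selectionsD(2)[OF f] c
      by (smt (verit) image_iff lessThan_iff linorder_neqE_nat mem_Collect_eq order_less_asym subsetI)
    show "?B \<subseteq> ?A" using selectionsD(2)[OF f] c by auto
  qed
  moreover have "card (f ` {..<c}) = c"
    using selections_inj[OF f] c by (subst card_image) (auto intro: inj_on_subset)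
  ultimately show ?thesis using pick_card_in_set[of "f c" "f ` {..<m}"] c by simp
qed

lemma selection_pick:
  assumes "J \<subseteq> {..<n}" "card J = m"
  shows "pick J \<in> selections m n"
  using assms pick_in_set_le[of _ J] pick_mono_le[of _ J] by (intro selectionsI) auto

lemma selection_image:
  assumes f: "f \<in> selections m n"
  shows "f ` {..<m} \<subseteq> {..<n}" "card (f ` {..<m}) = m"
  using assms selections_inj[OF f] by (auto simp: card_image selections_def)

lemma det_submatrix_cols:
  assumes "C \<in> carrier_mat k n" "J \<subseteq> {..<n}" "card J = k"
  shows "det (submatrix C UNIV J) = max_minor k (\<lambda>r c. C $$ (r, c)) (pick J)"
proof -
  have "{j. j < n \<and> j \<in> J} = J" using assms by auto
  hence "submatrix C UNIV J = mat k k (\<lambda>(r, c). C $$ (r, pick J c))"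
    using assms by (intro eq_matI) (auto simp: submatrix_def pick_UNIV)
  thus ?thesis by (simp add: max_minor_def)
qed

lemma det_submatrix_rows:
  assumes "Z \<in> carrier_mat n m" "I \<subseteq> {..<n}" "card I = m"
  shows "det (submatrix Z I UNIV) = max_minor m (\<lambda>r c. Z $$ (c, r)) (pick I)"
proof -
  have "{j. j < n \<and> j \<in> I} = I" using assms by auto
  hence s: "submatrix Z I UNIV = mat m m (\<lambda>(r, c). Z $$ (pick I r, c))"
    using assms by (intro eq_matI) (auto simp: submatrix_def pick_UNIV)
  have "det (submatrix Z I UNIV) = det (transpose_mat (submatrix Z I UNIV))"
    by (rule det_transpose[symmetric, of _ m]) (simp add: s)
  also have "transpose_mat (submatrix Z I UNIV) = mat m m (\<lambda>(r, c). Z $$ (pick I c, r))"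
    unfolding s by (intro eq_matI) auto
  finally show ?thesis by (simp add: max_minor_def)
qed

lemma max_minor_pick:
  assumes "f \<in> selections m n"
  shows "max_minor m A (pick (f ` {..<m})) = max_minor m A f"
  unfolding max_minor_def
  by (rule arg_cong[of _ _ det], rule eq_matI) (auto simp: pick_selection[OF assms])

lemma Mat_pos_iff:
  assumes "Z \<in> carrier_mat n m"
  shows "Z \<in> Mat_pos n m \<longleftrightarrow> (\<forall>f \<in> selections m n. max_minor m (\<lambda>r c. Z $$ (c, r)) f > 0)"
proof
  assume Z: "Z \<in> Mat_pos n m"
  show "\<forall>f \<in> selections m n. max_minor m (\<lambda>r c. Z $$ (c, r)) f > 0"
  proof
    fix f assume f: "f \<in> selections m n"
    have "det (submatrix Z (f ` {..<m}) UNIV) > 0"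
      using Z selection_image[OF f] by (auto simp: Mat_pos_def)
    thus "max_minor m (\<lambda>r c. Z $$ (c, r)) f > 0"
      using det_submatrix_rows[OF assms selection_image[OF f]] max_minor_pick[OF f] by simp
  qed
next
  assume "\<forall>f \<in> selections m n. max_minor m (\<lambda>r c. Z $$ (c, r)) f > 0"
  thus "Z \<in> Mat_pos n m"
    using assms det_submatrix_rows[OF assms] selection_pick by (auto simp: Mat_pos_def)
qed

lemma nonneg_minors_iff:
  assumes "C \<in> carrier_mat k n"
  shows "(\<forall>J. J \<subseteq> {..<n} \<and> card J = k \<longrightarrow> det (submatrix C UNIV J) \<ge> 0) \<longleftrightarrow>
         (\<forall>f \<in> selections k n. max_minor k (\<lambda>r c. C $$ (r, c)) f \<ge> 0)"
proof
  assume *: "\<forall>J. J \<subseteq> {..<n} \<and> card J = k \<longrightarrow> det (submatrix C UNIV J) \<ge> 0"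
  show "\<forall>f \<in> selections k n. max_minor k (\<lambda>r c. C $$ (r, c)) f \<ge> 0"
  proof
    fix f assume f: "f \<in> selections k n"
    have "det (submatrix C UNIV (f ` {..<k})) \<ge> 0"
      using * selection_image[OF f] by auto
    thus "max_minor k (\<lambda>r c. C $$ (r, c)) f \<ge> 0"
      using det_submatrix_cols[OF assms selection_image[OF f]] max_minor_pick[OF f] by simp
  qed
next
  assume "\<forall>f \<in> selections k n. max_minor k (\<lambda>r c. C $$ (r, c)) f \<ge> 0"
  thus "\<forall>J. J \<subseteq> {..<n} \<and> card J = k \<longrightarrow> det (submatrix C UNIV J) \<ge> 0"
    using assms det_submatrix_cols[OF assms] selection_pick by auto
qed

lemma full_row_rank_nonzero_minor:
  assumes C: "full_row_rank k n C"
  obtains f where "f \<in> selections k n" "max_minor k (\<lambda>r c. C $$ (r, c)) f \<noteq> 0"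
proof -
  interpret V: vec_space "TYPE(real)" k .
  have Cc: "C \<in> carrier_mat k n" and rk: "V.rank C = k" using C by (auto simp: full_row_rank_def)
  obtain U where U: "maximal U (\<lambda>T. T \<subseteq> set (cols C) \<and> V.lin_indpt T)"
    using maximal_exists_superset[of "set (cols C)" "\<lambda>T. T \<subseteq> set (cols C) \<and> V.lin_indpt T" "{}"]
    by (auto simp: V.finite_lin_indpt2)
  have cU: "card U = k" using V.rank_card_indpt[OF Cc U] rk by simp
  have Us: "U \<subseteq> set (cols C)" "V.lin_indpt U" using U by (auto simp: maximal_def)
  have "\<forall>u\<in>U. \<exists>j<n. col C j = u"
    using Us(1) Cc by (fastforce simp: cols_def)
  then obtain g where g: "\<And>u. u \<in> U \<Longrightarrow> g u < n \<and> col C (g u) = u" by metis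
  define J where "J = g ` U"
  have Jn: "J \<subseteq> {..<n}" using g by (auto simp: J_def)
  have "inj_on g U" using g by (intro inj_onI) metis
  hence cJ: "card J = k" by (simp add: J_def card_image cU)
  have colJ: "inj_on (col C) J" "col C ` J = U"
    using g by (auto simp: J_def inj_on_def image_iff)
  define M where "M = mat k k (\<lambda>(r, c). C $$ (r, pick J c))"
  have M: "M \<in> carrier_mat k k" by (simp add: M_def)
  have pJ: "pick J c \<in> J" if "c < k" for c using pick_in_set_le[of c J] cJ that by simp
  have colM: "col M c = col C (pick J c)" if "c < k" for c
    using that pJ[OF that] Jn Cc by (intro eq_vecI) (auto simp: M_def)
  have inj: "inj_on (pick J) {..<k}"
    using selections_inj[OF selection_pick[OF Jn cJ]] .
  have dist: "distinct (cols M)"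
    unfolding distinct_conv_nth
  proof (intro allI impI)
    fix i j assume "i < length (cols M)" "j < length (cols M)" "i \<noteq> j"
    hence ij: "i < k" "j < k" "i \<noteq> j" using M by auto
    have "pick J i \<noteq> pick J j" using inj ij by (auto simp: inj_on_def)
    thus "cols M ! i \<noteq> cols M ! j" using ij colM pJ colJ M by (auto simp: inj_on_def)
  qed
  have "set (cols M) \<subseteq> U"
    using M colM pJ colJ by (auto simp: cols_def)
  hence "V.lin_indpt (set (cols M))" using Us(2) V.supset_ld_is_ld by blast
  hence "V.rank M = k" using V.lin_indpt_full_rank[OF M dist] by simp
  hence "det M \<noteq> 0" using V.det_rank_iff[OF M] by simp
  thus ?thesis using that[OF selection_pick[OF Jn cJ]] by (simp add: max_minor_def M_def)
qed

section \<open>The bracket as an alternating form\<close>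

text \<open>With the rows of \<open>W\<close> spanning \<open>Y\<close> this is \<open>det (y\<^sub>1, \<dots>, y\<^sub>k, a, b)\<close>: the area form of the plane
  \<open>\<real>\<^sup>k\<^sup>+\<^sup>2 / Y\<close>, pulled back to \<open>\<real>\<^sup>k\<^sup>+\<^sup>2\<close>.\<close>
definition bracket :: "nat \<Rightarrow> (nat \<Rightarrow> nat \<Rightarrow> real) \<Rightarrow> (nat \<Rightarrow> real) \<Rightarrow> (nat \<Rightarrow> real) \<Rightarrow> real" where
  "bracket k W a b =
     det (mat (k + 2) (k + 2) (\<lambda>(r, c). if r < k then W r c else if r = k then a c else b c))"

lemma bracket_swap: "bracket k W b a = - bracket k W a b"
proof -
  let ?M = "\<lambda>a b. mat (k + 2) (k + 2) (\<lambda>(r, c). if r < k then W r c else if r = k then a c else b c)"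
  have "?M b a = swaprows k (k + 1) (?M a b)"
    by (intro eq_matI) auto
  moreover have "det (swaprows k (k + 1) (?M a b)) = - det (?M a b)"
    by (subst det_swaprows[of _ "k+2"]) auto
  ultimately show ?thesis by (simp add: bracket_def)
qed

lemma bracket_self: "bracket k W a a = 0"
  using bracket_swap[of k W a a] by simp

lemma bracket_row:
  assumes "r < k" shows "bracket k W a (W r) = 0"
  unfolding bracket_def
  by (rule det_identical_rows[of _ "k+2" r "k+1"]) (use assms in \<open>auto intro!: eq_vecI\<close>)

lemma bracket_functional:
  obtains l where "\<And>b. bracket k W a b = (\<Sum>c<k+2. l c * b c)"
proof -
  let ?M = "\<lambda>b. mat (k + 2) (k + 2) (\<lambda>(r, c). if r < k then W r c else if r = k then a c else b c)"
  have "bracket k W a b = (\<Sum>c<k+2. cofactor (?M (\<lambda>_. 0)) (k+1) c * b c)" for b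
  proof -
    have "mat_delete (?M b) (k+1) c = mat_delete (?M (\<lambda>_. 0)) (k+1) c" if "c < k + 2" for c
      using that by (intro eq_matI) (auto simp: mat_delete_def)
    hence cf: "cofactor (?M b) (k+1) c = cofactor (?M (\<lambda>_. 0)) (k+1) c" if "c < k + 2" for c
      using that by (simp add: cofactor_def)
    have "bracket k W a b = (\<Sum>c<k+2. ?M b $$ (k+1,c) * cofactor (?M b) (k+1) c)"
      unfolding bracket_def by (rule laplace_expansion_row) auto
    also have "\<dots> = (\<Sum>c<k+2. cofactor (?M (\<lambda>_. 0)) (k+1) c * b c)"
      by (intro sum.cong refl) (simp add: cf[simplified] mult.commute)
    finally show ?thesis .
  qed
  thus ?thesis using that by blast
qed

lemma bracket_lincomb_right:
  "bracket k W a (\<lambda>c. s * b c + t * d c) = s * bracket k W a b + t * bracket k W a d"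
proof -
  obtain l where l: "\<And>b. bracket k W a b = (\<Sum>c<k+2. l c * b c)" using bracket_functional by blast
  show ?thesis unfolding l sum_distrib_left sum.distrib[symmetric]
    by (intro sum.cong refl) (simp add: algebra_simps)
qed

lemma bracket_lincomb_left:
  "bracket k W (\<lambda>c. s * b c + t * d c) a = s * bracket k W b a + t * bracket k W d a"
  using bracket_lincomb_right[of k W a s b t d] bracket_swap[of k W a] by (simp add: algebra_simps)

text \<open>A nonzero bracket says that \<open>W\<close>, \<open>a\<close>, \<open>b\<close> form a basis of \<open>\<real>\<^sup>k\<^sup>+\<^sup>2\<close>, and a linear form that
  vanishes on a basis is zero.\<close>
lemma bracket_nonzero_spanning:
  assumes "bracket k W a b \<noteq> 0"
    and "\<And>r. r < k \<Longrightarrow> (\<Sum>c<k+2. l c * W r c) = 0"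
    and "(\<Sum>c<k+2. l c * a c) = 0" "(\<Sum>c<k+2. l c * b c) = 0"
    and c: "c < k + 2"
  shows "l c = 0"
proof (rule ccontr)
  assume lc: "l c \<noteq> 0"
  let ?M = "mat (k + 2) (k + 2) (\<lambda>(r, c). if r < k then W r c else if r = k then a c else b c)"
  have "?M *\<^sub>v vec (k+2) l = 0\<^sub>v (k+2)"
  proof (intro eq_vecI)
    fix i assume "i < dim_vec (0\<^sub>v (k+2) :: real vec)"
    hence i: "i < k + 2" by simp
    have "(?M *\<^sub>v vec (k+2) l) $ i = (\<Sum>c<k+2. l c * ?M $$ (i, c))"
      using i by (simp add: scalar_prod_def lessThan_atLeast0 mult.commute)
    also have "\<dots> = 0"
      using assms(2)[of i] assms(3,4) i by (cases "i < k"; cases "i = k") auto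
    finally show "(?M *\<^sub>v vec (k+2) l) $ i = 0\<^sub>v (k+2) $ i" using i by simp
  qed auto
  moreover have "vec (k+2) l \<noteq> 0\<^sub>v (k+2)" using lc c by (metis index_vec index_zero_vec(1))
  ultimately have "det ?M = 0"
    by (subst det_0_iff_vec_prod_zero[of _ "k+2"]) (auto intro!: exI[of _ "vec (k+2) l"])
  thus False using assms(1) by (simp add: bracket_def)
qed

text \<open>The left-hand side is linear in \<open>t\<close> and vanishes for \<open>t\<close> in the basis \<open>W\<close>, \<open>u\<close>, \<open>v\<close>. This three-term
  relation is the way in which the proof uses that the brackets come from a plane.\<close>
lemma bracket_Pluecker:
  assumes uv: "bracket k W u v \<noteq> 0"
  shows "bracket k W u v * bracket k W x t - bracket k W u t * bracket k W x v
         + bracket k W v t * bracket k W x u = 0"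
proof -
  obtain lx where lx: "\<And>b. bracket k W x b = (\<Sum>c<k+2. lx c * b c)" using bracket_functional by blast
  obtain lu where lu: "\<And>b. bracket k W u b = (\<Sum>c<k+2. lu c * b c)" using bracket_functional by blast
  obtain lv where lv: "\<And>b. bracket k W v b = (\<Sum>c<k+2. lv c * b c)" using bracket_functional by blast
  define l where "l c = bracket k W u v * lx c - bracket k W x v * lu c + bracket k W x u * lv c" for c
  have phi: "(\<Sum>c<k+2. l c * b c) =
      bracket k W u v * bracket k W x b - bracket k W u b * bracket k W x v
         + bracket k W v b * bracket k W x u" for b
  proof -
    have "(\<Sum>c<k+2. l c * b c) = bracket k W u v * (\<Sum>c<k+2. lx c * b c)
        - bracket k W x v * (\<Sum>c<k+2. lu c * b c) + bracket k W x u * (\<Sum>c<k+2. lv c * b c)"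
      unfolding l_def sum_distrib_left sum.distrib[symmetric] sum_subtractf[symmetric]
      by (intro sum.cong refl) (simp add: algebra_simps)
    thus ?thesis unfolding lx[symmetric] lu[symmetric] lv[symmetric] by (simp add: mult.commute)
  qed
  have "l c = 0" if "c < k + 2" for c
  proof (rule bracket_nonzero_spanning[OF uv _ _ _ that])
    show "(\<Sum>c<k+2. l c * W r c) = 0" if "r < k" for r
      unfolding phi using bracket_row[OF that] by simp
    show "(\<Sum>c<k+2. l c * u c) = 0" unfolding phi
      using bracket_swap[of k W v u] by (simp add: bracket_self)
    show "(\<Sum>c<k+2. l c * v c) = 0" unfolding phi by (simp add: bracket_self)
  qed
  hence "(\<Sum>c<k+2. l c * t c) = 0" by simp
  thus ?thesis unfolding phi .
qed

lemma bracket_change_basis: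
  assumes "\<And>r c. r < k \<Longrightarrow> c < k + 2 \<Longrightarrow> W' r c = (\<Sum>s<k. A r s * W s c)"
  shows "bracket k W' a b = det (mat k k (\<lambda>(r, s). A r s)) * bracket k W a b"
proof -
  let ?M = "\<lambda>W. mat (k + 2) (k + 2) (\<lambda>(r, c). if r < k then W r c else if r = k then a c else b c)"
  define E where "E = four_block_mat (mat k k (\<lambda>(r, s). A r s)) (0\<^sub>m k 2) (0\<^sub>m 2 k) (1\<^sub>m 2)"
  have E: "E \<in> carrier_mat (k+2) (k+2)"
    unfolding E_def by (rule four_block_carrier_mat) auto
  have dE: "det E = det (mat k k (\<lambda>(r, s). A r s))"
    unfolding E_def by (subst det_four_block_mat_upper_right_zero[of _ k _ 2]) auto
  have "?M W' = E * ?M W"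
  proof (rule eq_matI)
    fix r c assume "r < dim_row (E * ?M W)" "c < dim_col (E * ?M W)"
    hence r: "r < k + 2" and c: "c < k + 2" using E by auto
    have "(E * ?M W) $$ (r, c) = (\<Sum>s<k+2. E $$ (r, s) * ?M W $$ (s, c))"
      using r c E by (simp add: scalar_prod_def lessThan_atLeast0)
    also have "\<dots> = (\<Sum>s<k. E $$ (r, s) * ?M W $$ (s, c)) + E $$ (r, k) * ?M W $$ (k, c)
         + E $$ (r, k+1) * ?M W $$ (k+1, c)" by simp
    also have "\<dots> = ?M W' $$ (r, c)"
    proof -
      have Ers: "E $$ (r, s) = (if r < k then (if s < k then A r s else 0) else if r = s then 1 else 0)"
        if "s < k + 2" for s
        using r that unfolding E_def by auto
      have "(\<Sum>s<k. E $$ (r, s) * ?M W $$ (s, c)) = (if r < k then W' r c else 0)"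
        using r c by (auto simp: Ers assms intro!: sum.neutral)
      thus ?thesis using r c by (auto simp: Ers)
    qed
    finally show "?M W' $$ (r, c) = (E * ?M W) $$ (r, c)" by simp
  qed (use E in auto)
  hence "det (?M W') = det E * det (?M W)"
    using det_mult[OF E, of "?M W"] by simp
  thus ?thesis unfolding bracket_def dE .
qed

section \<open>Sign changes and variation diminution\<close>

definition changes :: "(nat \<Rightarrow> real) \<Rightarrow> nat \<Rightarrow> nat" where
  "changes v i = card {d. d < i \<and> v d * v (Suc d) < 0}"

lemma changes_0 [simp]: "changes v 0 = 0"
  by (simp add: changes_def)

lemma changes_Suc: "changes v (Suc i) = changes v i + (if v i * v (Suc i) < 0 then 1 else 0)"
proof -
  have "{d. d < Suc i \<and> v d * v (Suc d) < 0} =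
    (if v i * v (Suc i) < 0 then insert i {d. d < i \<and> v d * v (Suc d) < 0}
     else {d. d < i \<and> v d * v (Suc d) < 0})"
    by (auto simp: less_Suc_eq)
  thus ?thesis by (simp add: changes_def)
qed

lemma changes_mono: "i \<le> j \<Longrightarrow> changes v i \<le> changes v j"
  unfolding changes_def by (intro card_mono) auto

lemma sgn_eq_changes:
  assumes "\<And>j. j \<le> i \<Longrightarrow> v j \<noteq> 0"
  shows "sgn (v i) = (-1) ^ changes v i * sgn (v 0)"
  using assms
proof (induction i)
  case (Suc i)
  hence IH: "sgn (v i) = (-1) ^ changes v i * sgn (v 0)" and nz: "v i \<noteq> 0" "v (Suc i) \<noteq> 0" by auto
  have "sgn (v (Suc i)) = (if v i * v (Suc i) < 0 then - sgn (v i) else sgn (v i))"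
    using nz by (auto simp: sgn_if mult_less_0_iff)
  thus ?case unfolding changes_Suc IH by simp
qed simp

lemma changes_attains:
  assumes "s \<le> changes v i"
  obtains j where "j \<le> i" "changes v j = s"
  using assms
proof (induction i arbitrary: thesis)
  case (Suc i)
  show ?case
  proof (cases "s \<le> changes v i")
    case True thus ?thesis using Suc.IH Suc.prems(1) by (metis le_Suc_eq)
  next
    case False
    hence "s = changes v (Suc i)" using Suc.prems(2) by (simp add: changes_Suc split: if_splits)
    thus ?thesis using Suc.prems(1) by blast
  qed
qed simp

text \<open>With \<open>m\<close> sign changes there would be \<open>m + 1\<close> positions of alternating sign. Bordering the columns of
  \<open>A\<close> there by the values of \<open>v\<close> gives a singular matrix, because \<open>v\<close> depends linearly on the rows of
  \<open>A\<close>. But the signs in the Laplace expansion along the border cancel those of \<open>v\<close>, so all terms have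
  the same strict sign.\<close>
lemma changes_lincomb_less:
  assumes pos: "\<And>f. f \<in> selections m n \<Longrightarrow> max_minor m A f > 0"
    and n: "n \<ge> 1"
    and v: "\<And>j. j < n \<Longrightarrow> v j = (\<Sum>r<m. l r * A r j)"
    and nz: "\<And>j. j < n \<Longrightarrow> v j \<noteq> 0"
  shows "changes v (n - 1) < m"
proof (rule ccontr)
  assume "\<not> changes v (n - 1) < m"
  hence "\<And>s. s \<le> m \<Longrightarrow> \<exists>i\<le>n-1. changes v i = s"
    by (metis changes_attains le_trans not_less)
  then obtain g where g: "\<And>s. s \<le> m \<Longrightarrow> g s \<le> n - 1 \<and> changes v (g s) = s" by metis
  have gn: "g s < n" if "s \<le> m" for s using g[OF that] n by linarith
  have gmono: "g s < g s'" if "s < s'" "s' \<le> m" for s s'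
  proof (rule ccontr)
    assume "\<not> g s < g s'"
    hence "changes v (g s') \<le> changes v (g s)" by (intro changes_mono) simp
    thus False using g that by auto
  qed
  have sg: "v (g s) = (-1) ^ s * (sgn (v 0) * \<bar>v (g s)\<bar>)" if "s \<le> m" for s
  proof -
    have "sgn (v (g s)) = (-1) ^ s * sgn (v 0)"
      using sgn_eq_changes[of "g s" v] g[OF that] nz n by auto
    moreover have "v (g s) = sgn (v (g s)) * \<bar>v (g s)\<bar>" by (simp add: sgn_mult_abs)
    ultimately show ?thesis by simp
  qed
  define M where "M = mat (m+1) (m+1) (\<lambda>(r, c). if r = 0 then v (g c) else A (r - 1) (g c))"
  have M: "M \<in> carrier_mat (m+1) (m+1)" by (simp add: M_def)
  have "det M = 0"
  proof -
    define x where "x = vec (m+1) (\<lambda>r. if r = 0 then 1 else - l (r - 1))"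
    have "M\<^sup>T *\<^sub>v x = 0\<^sub>v (m+1)"
    proof (intro eq_vecI)
      fix c assume "c < dim_vec (0\<^sub>v (m+1) :: real vec)"
      hence c: "c < m + 1" by simp
      have "(M\<^sup>T *\<^sub>v x) $ c = (\<Sum>r<m+1. M $$ (r, c) * x $ r)"
        using c by (simp add: scalar_prod_def lessThan_atLeast0 M_def x_def)
      also have "\<dots> = M $$ (0, c) * x $ 0 + (\<Sum>r<m. M $$ (Suc r, c) * x $ (Suc r))"
        by (simp add: sum.lessThan_Suc_shift del: sum.lessThan_Suc)
      also have "\<dots> = v (g c) - (\<Sum>r<m. l r * A r (g c))"
        using c by (simp add: M_def x_def sum_negf mult.commute)
      also have "\<dots> = 0" using v[OF gn[of c]] c by simp
      finally show "(M\<^sup>T *\<^sub>v x) $ c = 0\<^sub>v (m+1) $ c" using c by simp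
    qed (use M in auto)
    moreover have "x \<noteq> 0\<^sub>v (m+1)" by (auto simp: x_def dest!: arg_cong[of _ _ "\<lambda>x. x $ 0"])
    moreover have "x \<in> carrier_vec (m+1)" by (simp add: x_def)
    ultimately have "det M\<^sup>T = 0"
      using M det_0_iff_vec_prod_zero[of "M\<^sup>T" "m+1"] by auto
    thus ?thesis using det_transpose[OF M] by simp
  qed
  have "det M = (\<Sum>c<m+1. M $$ (0, c) * cofactor M 0 c)"
    by (rule laplace_expansion_row[OF M]) simp
  also have "\<dots> = (\<Sum>c<m+1. sgn (v 0) * (\<bar>v (g c)\<bar> * det (mat_delete M 0 c)))"
  proof (intro sum.cong refl)
    fix c assume "c \<in> {..<m+1}"
    hence c: "c \<le> m" by simp
    have "M $$ (0, c) * cofactor M 0 c = v (g c) * (-1) ^ c * det (mat_delete M 0 c)"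
      using c by (simp add: M_def cofactor_def)
    also have "\<dots> = ((-1) ^ c * (-1) ^ c) * (sgn (v 0) * (\<bar>v (g c)\<bar> * det (mat_delete M 0 c)))"
      by (subst sg[OF c]) (simp add: mult_ac)
    also have "((-1) ^ c * (-1) ^ c :: real) = 1" by (simp flip: power_add)
    finally show "M $$ (0, c) * cofactor M 0 c = sgn (v 0) * (\<bar>v (g c)\<bar> * det (mat_delete M 0 c))"
      by simp
  qed
  also have "\<dots> = sgn (v 0) * (\<Sum>c<m+1. \<bar>v (g c)\<bar> * det (mat_delete M 0 c))"
    by (simp only: sum_distrib_left)
  finally have eq: "det M = sgn (v 0) * (\<Sum>c<m+1. \<bar>v (g c)\<bar> * det (mat_delete M 0 c))" .
  have "(\<Sum>c<m+1. \<bar>v (g c)\<bar> * det (mat_delete M 0 c)) > 0"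
  proof (intro sum_pos)
    fix c assume "c \<in> {..<m+1}"
    hence c: "c \<le> m" by simp
    define h where "h c' = g (if c' < c then c' else Suc c')" for c'
    have "mat_delete M 0 c = mat m m (\<lambda>(r, c'). A r (h c'))"
      by (intro eq_matI) (auto simp: mat_delete_def M_def h_def)
    hence "det (mat_delete M 0 c) = max_minor m A h" by (simp add: max_minor_def)
    moreover have "h \<in> selections m n"
      by (intro selectionsI) (auto simp: h_def intro!: gn gmono)
    ultimately have "det (mat_delete M 0 c) > 0" using pos by simp
    thus "\<bar>v (g c)\<bar> * det (mat_delete M 0 c) > 0" using nz[OF gn[OF c]] by simp
  qed auto
  moreover have "sgn (v 0) \<noteq> 0" using nz[of 0] n by (simp add: sgn_if)
  ultimately show False using eq \<open>det M = 0\<close> by auto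
qed

text \<open>With fewer than \<open>k\<close> sign changes, the indices split into exactly \<open>k\<close> consecutive nonempty blocks on each
  of which \<open>v\<close> has constant sign. Adding up the columns of a block with weights \<open>\<bar>v\<^sub>j\<bar>\<close> gives \<open>k\<close> vectors,
  which are dependent as \<open>v\<close> is in the kernel. By multilinearity, their determinant is a positive
  combination of maximal minors that take one column from each block, hence positive.\<close>
lemma changes_kernel_ge:
  assumes pos: "\<And>f. f \<in> selections k n \<Longrightarrow> max_minor k C f > 0"
    and k: "1 \<le> k" "k \<le> n"
    and ker: "\<And>r. r < k \<Longrightarrow> (\<Sum>j<n. C r j * v j) = 0"
    and nz: "\<And>j. j < n \<Longrightarrow> v j \<noteq> 0"
  shows "k \<le> changes v (n - 1)"
proof (rule ccontr)
  assume "\<not> k \<le> changes v (n - 1)"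
  hence few: "changes v (n - 1) < k" by simp
  \<comment> \<open>\<open>\<beta> i\<close> is the block of \<open>i\<close>. The blocks of constant sign may be too few; the second argument of the
    maximum splits off single indices at the end until there are \<open>k\<close> of them.\<close>
  define \<beta> where "\<beta> i = max (changes v i) (i + k - n)" for i
  have \<beta>0: "\<beta> 0 = 0" using k by (simp add: \<beta>_def)
  have \<beta>mono: "\<beta> i \<le> \<beta> j" if "i \<le> j" for i j
    using changes_mono[OF that, of v] that by (auto simp: \<beta>_def)
  have \<beta>last: "\<beta> (n - 1) = k - 1" using few k by (auto simp: \<beta>_def)
  have \<beta>less: "\<beta> i < k" if "i < n" for i
    using \<beta>mono[of i "n-1"] \<beta>last that k by linarith
  have \<beta>step: "\<beta> (Suc i) \<le> Suc (\<beta> i)" for i by (auto simp: \<beta>_def changes_Suc)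
  have \<beta>surj: "\<exists>j\<le>i. \<beta> j = s" if "s \<le> \<beta> i" for s i
    using that
  proof (induction i)
    case (Suc i)
    show ?case
    proof (cases "s \<le> \<beta> i")
      case True thus ?thesis using Suc.IH by (meson le_Suc_eq)
    next
      case False thus ?thesis using Suc.prems \<beta>step[of i] by (intro exI[of _ "Suc i"]) simp
    qed
  qed (simp add: \<beta>0)
  define B where "B b = {j. j < n \<and> \<beta> j = b}" for b
  have Bfin: "finite (B b)" for b by (simp add: B_def)
  have Bne: "B b \<noteq> {}" if "b < k" for b
  proof -
    have "b \<le> \<beta> (n - 1)" using that \<beta>last by simp
    from \<beta>surj[OF this] obtain j where "j \<le> n - 1" "\<beta> j = b" by auto
    hence "j \<in> B b" using k by (auto simp: B_def)
    thus ?thesis by auto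
  qed
  have sgn_le: "sgn (v i) = sgn (v j)" if "i \<le> j" "j < n" "\<beta> i = \<beta> j" for i j
  proof -
    have "changes v i = changes v j"
    proof (rule ccontr)
      assume "changes v i \<noteq> changes v j"
      hence lt: "changes v i < changes v j" using changes_mono[OF that(1), of v] by simp
      hence "changes v i < \<beta> i" using that(3) by (auto simp: \<beta>_def)
      hence "\<beta> i = i + k - n" "0 < i + k - n" by (auto simp: \<beta>_def)
      moreover have "i \<noteq> j" using lt by auto
      ultimately show False using that by (auto simp: \<beta>_def)
    qed
    thus ?thesis using sgn_eq_changes[of i v] sgn_eq_changes[of j v] nz that by auto
  qed
  have sgnB: "sgn (v i) = sgn (v j)" if "i \<in> B b" "j \<in> B b" for i j b
  proof (cases "i \<le> j")
    case True
    show ?thesis by (rule sgn_le[OF True]) (use that in \<open>auto simp: B_def\<close>)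
  next
    case False
    show ?thesis by (rule sgn_le[OF less_imp_le, symmetric]) (use that False in \<open>auto simp: B_def\<close>)
  qed
  define e where "e b = sgn (v (SOME j. j \<in> B b))" for b
  have e: "e b * \<bar>v j\<bar> = v j" if "j \<in> B b" for j b
  proof -
    have "(SOME j. j \<in> B b) \<in> B b" using that by (rule someI)
    hence "e b = sgn (v j)" unfolding e_def by (rule sgnB[OF _ that])
    thus ?thesis by (simp add: sgn_mult_abs)
  qed
  define M where "M = mat k k (\<lambda>(r, b). \<Sum>j\<in>B b. \<bar>v j\<bar> * C r j)"
  have M: "M \<in> carrier_mat k k" by (simp add: M_def)
  have "det M = 0"
  proof -
    have "M *\<^sub>v vec k e = 0\<^sub>v k"
    proof (intro eq_vecI)
      fix r assume "r < dim_vec (0\<^sub>v k :: real vec)"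
      hence r: "r < k" by simp
      have "(M *\<^sub>v vec k e) $ r = (\<Sum>b<k. M $$ (r, b) * e b)"
        using r M by (simp add: scalar_prod_def lessThan_atLeast0)
      also have "\<dots> = (\<Sum>b<k. \<Sum>j\<in>B b. C r j * v j)"
      proof (intro sum.cong refl)
        fix b assume "b \<in> {..<k}"
        hence "M $$ (r, b) * e b = (\<Sum>j\<in>B b. C r j * (e b * \<bar>v j\<bar>))"
          using r by (simp add: M_def sum_distrib_left mult_ac)
        also have "\<dots> = (\<Sum>j\<in>B b. C r j * v j)"
          by (intro sum.cong refl arg_cong2[of _ _ _ _ "(*)"] e)
        finally show "M $$ (r, b) * e b = (\<Sum>j\<in>B b. C r j * v j)" .
      qed
      also have "\<dots> = (\<Sum>j\<in>(\<Union>b<k. B b). C r j * v j)"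
        by (rule sum.UNION_disjoint[symmetric]) (auto simp: Bfin, auto simp: B_def)
      also have "(\<Union>b<k. B b) = {..<n}" using \<beta>less by (auto simp: B_def)
      finally show "(M *\<^sub>v vec k e) $ r = 0\<^sub>v k $ r" using ker[OF r] r by simp
    qed (use M in auto)
    moreover have "vec k e \<noteq> 0\<^sub>v k"
    proof
      assume "vec k e = 0\<^sub>v k"
      hence "vec k e $ 0 = 0\<^sub>v k $ 0" by simp
      hence "e 0 = 0" using k by simp
      moreover obtain j where "j \<in> B 0" using Bne[of 0] k by auto
      ultimately show False using e[of j 0] nz[of j] by (auto simp: B_def)
    qed
    ultimately show ?thesis
      unfolding det_0_iff_vec_prod_zero[OF M] by (intro exI[of _ "vec k e"]) auto
  qed
  moreover have "det M > 0"
  proof -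
    have "det M = (\<Sum>p | p permutes {0..<k}. signof p * (\<Prod>i=0..<k. \<Sum>j\<in>B i. \<bar>v j\<bar> * C (p i) j))"
      unfolding mat_det_left_def[OF M]
      by (intro sum.cong refl arg_cong2[of _ _ _ _ "(*)"] prod.cong)
         (use M in \<open>auto simp: M_def permutes_in_image\<close>)
    also have "\<dots> = (\<Sum>p | p permutes {0..<k}. \<Sum>f\<in>PiE {0..<k} B.
                      signof p * (\<Prod>i=0..<k. \<bar>v (f i)\<bar> * C (p i) (f i)))"
      by (intro sum.cong refl) (simp add: prod_sum_PiE Bfin sum_distrib_left)
    also have "\<dots> = (\<Sum>f\<in>PiE {0..<k} B. \<Sum>p | p permutes {0..<k}.
                      signof p * (\<Prod>i=0..<k. \<bar>v (f i)\<bar> * C (p i) (f i)))"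
      by (rule sum.swap)
    also have "\<dots> = (\<Sum>f\<in>PiE {0..<k} B. (\<Prod>i=0..<k. \<bar>v (f i)\<bar>) * max_minor k C f)"
    proof (intro sum.cong refl)
      fix f assume "f \<in> PiE {0..<k} B"
      have "max_minor k C f = (\<Sum>p | p permutes {0..<k}. signof p * (\<Prod>i=0..<k. C (p i) (f i)))"
        unfolding max_minor_def
        by (subst mat_det_left_def[of _ k])
           (auto intro!: sum.cong prod.cong arg_cong2[of _ _ _ _ "(*)"] simp: permutes_in_image)
      thus "(\<Sum>p | p permutes {0..<k}. signof p * (\<Prod>i=0..<k. \<bar>v (f i)\<bar> * C (p i) (f i))) =
            (\<Prod>i=0..<k. \<bar>v (f i)\<bar>) * max_minor k C f"
        by (simp add: prod.distrib sum_distrib_left mult_ac)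
    qed
    also have "\<dots> > 0"
    proof (intro sum_pos)
      show "finite (PiE {0..<k} B)" by (intro finite_PiE) (auto simp: Bfin)
      show "PiE {0..<k} B \<noteq> {}" using Bne by (auto simp: PiE_eq_empty_iff)
      fix f assume f: "f \<in> PiE {0..<k} B"
      have fB: "f i < n \<and> \<beta> (f i) = i" if "i < k" for i using f that by (auto simp: B_def PiE_def Pi_def)
      have "f \<in> selections k n"
      proof (rule selectionsI)
        fix c d assume "c < d" "d < k"
        thus "f c < f d" using fB[of c] fB[of d] \<beta>mono[of "f d" "f c"] by (metis leD le_less_linear less_trans)
      qed (use fB in auto)
      hence "max_minor k C f > 0" by (rule pos)
      moreover have "(\<Prod>i=0..<k. \<bar>v (f i)\<bar>) > 0" using fB nz by (intro prod_pos) auto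
      ultimately show "(\<Prod>i=0..<k. \<bar>v (f i)\<bar>) * max_minor k C f > 0" by simp
    qed
    finally show ?thesis .
  qed
  ultimately show False by simp
qed

section \<open>From nonnegative to positive maximal minors\<close>

lemma max_minor_cong:
  assumes "\<And>r c. r < k \<Longrightarrow> c < k \<Longrightarrow> A r (f c) = B r (g c)"
  shows "max_minor k A f = max_minor k B g"
  unfolding max_minor_def by (rule arg_cong[of _ _ det], rule eq_matI) (use assms in auto)

text \<open>Adding a positive multiple of an adjacent column preserves nonnegativity of the maximal minors, can
  turn zero minors into positive ones, and is arbitrarily close to doing nothing.\<close>
definition column_add :: "nat \<Rightarrow> nat \<Rightarrow> real \<Rightarrow> (nat \<Rightarrow> nat \<Rightarrow> real) \<Rightarrow> nat \<Rightarrow> nat \<Rightarrow> real" where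
  "column_add i i' t C r j = (if j = i then C r i + t * C r i' else C r j)"

lemma max_minor_column_add_unaffected:
  assumes "\<And>c. c < k \<Longrightarrow> f c \<noteq> i"
  shows "max_minor k (column_add i i' t C) f = max_minor k C f"
  by (rule max_minor_cong) (use assms in \<open>auto simp: column_add_def\<close>)

lemma max_minor_column_add:
  assumes f: "f \<in> selections k n" and p: "p < k" "f p = i"
  shows "max_minor k (column_add i i' t C) f = max_minor k C f + t * max_minor k C (f(p := i'))"
proof -
  let ?M = "\<lambda>C f. mat k k (\<lambda>(r, c). C r (f c) :: real)"
  have neq: "f c \<noteq> i" if "c < k" "c \<noteq> p" for c
    using selections_inj[OF f] p that by (auto simp: inj_on_def)
  have ex: "max_minor k B g = (\<Sum>r<k. B r (g p) * cofactor (?M B g) r p)" for B g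
    unfolding max_minor_def
    by (subst laplace_expansion_column[of _ k p]) (use p in auto)
  have del: "mat_delete (?M (column_add i i' t C) f) r p = mat_delete (?M C f) r p"
            "mat_delete (?M C (f(p := i'))) r p = mat_delete (?M C f) r p" if "r < k" for r
    using that p neq by (intro eq_matI; auto simp: mat_delete_def column_add_def)+
  have cof: "cofactor (?M (column_add i i' t C) f) r p = cofactor (?M C f) r p"
            "cofactor (?M C (f(p := i'))) r p = cofactor (?M C f) r p" if "r < k" for r
    using del[OF that] by (simp_all add: cofactor_def)
  show ?thesis
    unfolding ex sum_distrib_left sum.distrib[symmetric]
  proof (intro sum.cong refl)
    fix r assume "r \<in> {..<k}"
    hence r: "r < k" by simp
    show "column_add i i' t C r (f p) * cofactor (?M (column_add i i' t C) f) r p =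
      C r (f p) * cofactor (?M C f) r p
      + t * (C r ((f(p := i')) p) * cofactor (?M C (f(p := i'))) r p)"
      unfolding cof[OF r] by (simp add: p column_add_def algebra_simps)
  qed
qed

lemma max_minor_repeated:
  assumes "c < k" "d < k" "c \<noteq> d" "f c = f d"
  shows "max_minor k C f = 0"
  unfolding max_minor_def
  by (rule det_identical_columns[of _ k c d]) (use assms in \<open>auto intro!: eq_vecI\<close>)

lemma selection_shift:
  assumes f: "f \<in> selections k n" and p: "p < k"
    and i': "i' < n" "i' = Suc (f p) \<or> f p = Suc i'"
    and free: "\<And>c. c < k \<Longrightarrow> f c \<noteq> i'"
  shows "f(p := i') \<in> selections k n"
proof (rule selectionsI)
  fix c assume "c < k" thus "(f(p := i')) c < n" using selectionsD(1)[OF f] i' by auto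
next
  fix c d assume cd: "c < d" "d < k"
  show "(f(p := i')) c < (f(p := i')) d"
    using selectionsD(2)[OF f, of c d] free[of c] free[of d] cd i' by auto
qed

text \<open>Replacing the column \<open>i\<close> of a selection by its neighbour \<open>i'\<close> leaves the selection increasing or creates
  a repetition; so the additional term is a nonnegative minor or zero.\<close>
lemma max_minor_column_add_ge:
  assumes nn: "\<And>f. f \<in> selections k n \<Longrightarrow> max_minor k C f \<ge> 0"
    and adj: "i' = Suc i \<or> i = Suc i'" "i' < n" and t: "t \<ge> 0"
    and f: "f \<in> selections k n"
  shows "max_minor k (column_add i i' t C) f \<ge> max_minor k C f"
proof (cases "\<exists>p<k. f p = i")
  case False
  thus ?thesis using max_minor_column_add_unaffected[of k f i] by auto
next
  case True
  then obtain p where p: "p < k" "f p = i" by auto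
  have "max_minor k C (f(p := i')) \<ge> 0"
  proof (cases "\<exists>c<k. f c = i'")
    case True
    then obtain c where c: "c < k" "f c = i'" by auto
    hence "c \<noteq> p" using p adj by auto
    thus ?thesis using max_minor_repeated[of c k p "f(p := i')"] c p by simp
  next
    case False
    thus ?thesis using nn selection_shift[OF f p(1), of i'] adj p by auto
  qed
  thus ?thesis using max_minor_column_add[OF f p] t by simp
qed

text \<open>Any increasing selection can be moved to any other one by steps that shift one index by one. On the
  way from a positive minor to a vanishing one, some step goes from positive to zero.\<close>
lemma adjacent_zero_minor:
  assumes nn: "\<And>f. f \<in> selections k n \<Longrightarrow> max_minor k C f \<ge> 0"
    and z: "g \<in> selections k n" "max_minor k C g = 0"
    and f: "f \<in> selections k n" "max_minor k C f > 0"
  shows "\<exists>h p i'. h \<in> selections k n \<and> max_minor k C h = 0 \<and> p < k \<and> i' < n \<and>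
           (i' = Suc (h p) \<or> h p = Suc i') \<and> max_minor k C (h(p := i')) > 0"
  using f
proof (induction "\<Sum>p<k. nat \<bar>int (f p) - int (g p)\<bar>" arbitrary: f rule: less_induct)
  case less
  note gD = selectionsD[OF z(1)] and fD = selectionsD[OF less.prems(1)]
  have "\<exists>p<k. f p \<noteq> g p"
  proof (rule ccontr)
    assume "\<not> ?thesis"
    hence "max_minor k C f = max_minor k C g" by (intro max_minor_cong) auto
    thus False using z less.prems by simp
  qed
  \<comment> \<open>Move the last index that is too small or, if there is none, the first one that is too large.
    This choice ensures that the place to move to is free.\<close>
  then obtain p x where p: "p < k" and x: "x < n" "x = Suc (f p) \<and> f p < g p \<or> f p = Suc x \<and> g p < f p"
    and free: "\<And>c. c < k \<Longrightarrow> f c \<noteq> x"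
  proof (cases "\<exists>p<k. f p < g p")
    case True
    define p where "p = Max {p. p < k \<and> f p < g p}"
    have S: "finite {p. p < k \<and> f p < g p}" "{p. p < k \<and> f p < g p} \<noteq> {}" using True by auto
    have p: "p < k" "f p < g p" using Max_in[OF S] by (auto simp: p_def)
    have mx: "c \<le> p" if "c < k" "f c < g c" for c using Max_ge[OF S(1), of c] that by (simp add: p_def)
    show ?thesis
    proof (rule that[of p "Suc (f p)"])
      show "Suc (f p) < n" using p gD(1)[of p] by linarith
      fix c assume c: "c < k"
      show "f c \<noteq> Suc (f p)"
      proof
        assume eq: "f c = Suc (f p)"
        have "p < c"
        proof (rule ccontr)
          assume "\<not> p < c"
          hence "f c \<le> f p" using fD(2)[of c p] p by (cases "c = p") auto
          thus False using eq by simp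
        qed
        hence "g p < g c" "\<not> f c < g c" using gD(2)[of p c] c mx[of c] by auto
        thus False using eq p by linarith
      qed
    qed (use p in auto)
  next
    case False
    hence ge: "\<And>p. p < k \<Longrightarrow> g p \<le> f p" by auto
    define p where "p = Min {p. p < k \<and> f p \<noteq> g p}"
    have S: "finite {p. p < k \<and> f p \<noteq> g p}" "{p. p < k \<and> f p \<noteq> g p} \<noteq> {}"
      using \<open>\<exists>p<k. f p \<noteq> g p\<close> by auto
    have "p < k" "f p \<noteq> g p" using Min_in[OF S] by (auto simp: p_def)
    hence p: "p < k" "g p < f p" using ge[of p] by auto
    have mn: "p \<le> c" if "c < k" "f c \<noteq> g c" for c using Min_le[OF S(1), of c] that by (simp add: p_def)
    show ?thesis
    proof (rule that[of p "f p - 1"])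
      show "f p - 1 < n" using fD(1)[of p] p by linarith
      fix c assume c: "c < k"
      show "f c \<noteq> f p - 1"
      proof
        assume eq: "f c = f p - 1"
        have "c < p"
        proof (rule ccontr)
          assume "\<not> c < p"
          hence "f p \<le> f c" using fD(2)[of p c] c by (cases "c = p") auto
          thus False using eq p by simp
        qed
        hence "g c < g p" "f c = g c" using gD(2)[of c p] p mn[of c] c by auto
        thus False using eq p by linarith
      qed
    qed (use p in auto)
  qed
  define f' where "f' = f(p := x)"
  have f': "f' \<in> selections k n" unfolding f'_def
    by (rule selection_shift[OF less.prems(1) p x(1) _ free]) (use x in auto)
  show ?case
  proof (cases "max_minor k C f' = 0")
    case True
    have "f'(p := f p) = f" by (simp add: f'_def)
    thus ?thesis using f' True p x less.prems fD(1)[OF p]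
      by (intro exI[of _ f'] exI[of _ p] exI[of _ "f p"]) (auto simp: f'_def)
  next
    case False
    hence "max_minor k C f' > 0" using nn[OF f'] by simp
    moreover have "(\<Sum>p<k. nat \<bar>int (f' p) - int (g p)\<bar>) < (\<Sum>p<k. nat \<bar>int (f p) - int (g p)\<bar>)"
      by (rule sum_strict_mono_ex1) (use p x in \<open>auto simp: f'_def\<close>)
    ultimately show ?thesis using less.hyps[OF _ f'] by blast
  qed
qed

text \<open>Each step of \<open>adjacent_zero_minor\<close> allows for a column addition that makes at least one more minor positive, so
  finitely many small ones suffice; \<open>Q\<close> is an open condition that has to survive them.\<close>
lemma perturb_to_positive:
  fixes Q :: "(nat \<Rightarrow> nat \<Rightarrow> real) \<Rightarrow> bool"
  assumes stable: "\<And>C i i'. Q C \<Longrightarrow> i' < n \<Longrightarrow> \<forall>\<^sub>F t in at_right 0. Q (column_add i i' t C)"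
    and "Q C"
    and "\<And>f. f \<in> selections k n \<Longrightarrow> max_minor k C f \<ge> 0"
    and "f \<in> selections k n" "max_minor k C f > 0"
  shows "\<exists>C'. Q C' \<and> (\<forall>f \<in> selections k n. max_minor k C' f > 0)"
  using assms(2-)
proof (induction "card {J. J \<subseteq> {..<n} \<and> card J = k \<and> max_minor k C (pick J) = 0}"
       arbitrary: C rule: less_induct)
  case less
  note nn = less.prems(2)
  show ?case
  proof (cases "\<forall>f \<in> selections k n. max_minor k C f > 0")
    case True thus ?thesis using less.prems(1) by blast
  next
    case False
    then obtain g where "g \<in> selections k n" "max_minor k C g = 0" using nn by force
    from adjacent_zero_minor[OF nn this less.prems(3,4)]
    obtain h p i' where h: "h \<in> selections k n" "max_minor k C h = 0" "p < k" "i' < n"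
      "i' = Suc (h p) \<or> h p = Suc i'" "max_minor k C (h(p := i')) > 0" by auto
    have "\<forall>\<^sub>F t in at_right 0. Q (column_add (h p) i' t C) \<and> (t::real) > 0"
      using stable[OF less.prems(1) h(4)] by (intro eventually_conj eventually_at_right_less)
    then obtain t :: real where t: "Q (column_add (h p) i' t C)" "t > 0"
      using eventually_happens'[OF trivial_limit_at_right_real] by blast
    define C' where "C' = column_add (h p) i' t C"
    have inc: "max_minor k C' f \<ge> max_minor k C f" if "f \<in> selections k n" for f
      unfolding C'_def by (rule max_minor_column_add_ge[OF nn h(5,4) less_imp_le[OF t(2)] that])
    have h': "max_minor k C' h > 0"
      unfolding C'_def using max_minor_column_add[OF h(1,3) refl] h t by simp
    have "{J. J \<subseteq> {..<n} \<and> card J = k \<and> max_minor k C' (pick J) = 0} \<subset>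
          {J. J \<subseteq> {..<n} \<and> card J = k \<and> max_minor k C (pick J) = 0}" (is "?S' \<subset> ?S")
    proof
      show "?S' \<subseteq> ?S"
      proof
        fix J assume J: "J \<in> ?S'"
        hence "pick J \<in> selections k n" using selection_pick by auto
        thus "J \<in> ?S" using J inc[of "pick J"] nn[of "pick J"] by auto
      qed
      have "h ` {..<k} \<in> ?S" "h ` {..<k} \<notin> ?S'"
        using selection_image[OF h(1)] max_minor_pick[OF h(1)] h(2) h' by auto
      thus "?S' \<noteq> ?S" by blast
    qed
    hence "card ?S' < card ?S" by (rule psubset_card_mono[rotated]) auto
    from less.hyps[OF this] show ?thesis
      using t(1) inc nn less.prems(3,4) unfolding C'_def[symmetric] by (meson order_trans less_le_trans)
  qed
qed

lemma tendsto_bracket: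
  assumes "\<And>r c. r < k \<Longrightarrow> c < k + 2 \<Longrightarrow> ((\<lambda>t. W t r c) \<longlongrightarrow> W0 r c) F"
  shows "((\<lambda>t. bracket k (W t) a b) \<longlongrightarrow> bracket k W0 a b) F"
proof -
  have d: "bracket k W a b = (\<Sum>p | p permutes {0..<k+2}. signof p *
      (\<Prod>i = 0..<k+2. if i < k then W i (p i) else if i = k then a (p i) else b (p i)))" for W
    unfolding bracket_def
    by (subst det_def'[of _ "k+2"])
       (auto intro!: sum.cong prod.cong arg_cong2[of _ _ _ _ "(*)"] simp: permutes_in_image
             simp del: prod.op_ivl_Suc)
  show ?thesis unfolding d
    by (intro tendsto_sum tendsto_mult tendsto_const tendsto_prod)
       (use assms in \<open>auto simp: permutes_in_image\<close>)
qed

section \<open>The signs of the brackets of a point of the amplituhedron\<close>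

lemma prod_neg_cong_sgn:
  assumes "sgn x = sgn x'" "sgn y = sgn y'"
  shows "x * y < 0 \<longleftrightarrow> x' * y' < (0::real)"
proof -
  have "x * y < 0 \<longleftrightarrow> sgn x * sgn y < 0" for x y :: real
    by (simp flip: sgn_mult)
  thus ?thesis using assms by metis
qed

lemma changes_cong_sgn:
  assumes "\<And>j. j \<le> i \<Longrightarrow> sgn (v j) = sgn (v' j)"
  shows "changes v i = changes v' i"
  unfolding changes_def
  by (rule arg_cong[of _ _ card], intro Collect_cong conj_cong refl prod_neg_cong_sgn)
     (use assms in auto)

text \<open>The brackets of the rows \<open>i\<close> and \<open>j\<close> of \<open>Z\<close>, for the point \<open>CZ\<close>; the matrix \<open>A\<close> is the transpose of \<open>Z\<close>.\<close>
definition coords :: "nat \<Rightarrow> nat \<Rightarrow> (nat \<Rightarrow> nat \<Rightarrow> real) \<Rightarrow> (nat \<Rightarrow> nat \<Rightarrow> real) \<Rightarrow> nat \<Rightarrow> nat \<Rightarrow> real" where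
  "coords k n A C i j = bracket k (\<lambda>r c. \<Sum>h<n. C r h * A c h) (\<lambda>c. A c i) (\<lambda>c. A c j)"

text \<open>The vector \<open>v\<close> is a combination of the rows of \<open>A\<close> and, since the bracket vanishes on the point \<open>CZ\<close>
  itself, it is annihilated by \<open>C\<close>.\<close>
lemma changes_bracket_row:
  assumes k: "1 \<le> k" "k + 2 \<le> n"
    and A: "\<And>f. f \<in> selections (k + 2) n \<Longrightarrow> max_minor (k + 2) A f > 0"
    and C: "\<And>f. f \<in> selections k n \<Longrightarrow> max_minor k C f > 0"
    and v: "\<And>j. v j = bracket k (\<lambda>r c. \<Sum>h<n. C r h * A c h) u (\<lambda>c. A c j)"
    and nz: "\<And>j. j < n \<Longrightarrow> v j \<noteq> 0"
  shows "changes v (n - 1) \<in> {k, k + 1}"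
proof -
  let ?W = "\<lambda>r c. \<Sum>h<n. C r h * A c h"
  obtain l where l: "\<And>b. bracket k ?W u b = (\<Sum>c<k+2. l c * b c)" using bracket_functional by blast
  have "changes v (n - 1) < k + 2"
  proof (rule changes_lincomb_less[where A = A and l = l and n = n])
    show "v j = (\<Sum>r<k+2. l r * A r j)" for j unfolding v l ..
  qed (use A k nz in auto)
  moreover have "k \<le> changes v (n - 1)"
  proof (rule changes_kernel_ge[OF C])
    fix r assume r: "r < k"
    have "(\<Sum>j<n. C r j * v j) = (\<Sum>j<n. \<Sum>c<k+2. l c * (C r j * A c j))"
      unfolding v l sum_distrib_left by (intro sum.cong refl) (simp add: mult_ac)
    also have "\<dots> = (\<Sum>c<k+2. l c * ?W r c)"
      unfolding sum_distrib_left by (rule sum.swap)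
    also have "\<dots> = bracket k ?W u (?W r)" unfolding l ..
    also have "\<dots> = 0" by (rule bracket_row[OF r])
    finally show "(\<Sum>j<n. C r j * v j) = 0" .
  qed (use k nz in auto)
  ultimately show ?thesis by auto
qed

text \<open>The row \<open>a\<close> has a zero at \<open>a\<close>. Replacing \<open>Z\<^sub>a\<close> by \<open>Z\<^sub>a + \<delta> Z\<^sub>b\<close> with small \<open>\<delta>\<close> of either sign leaves the other
  signs in the row unchanged and gives the entry \<open>a\<close> any desired sign.\<close>
lemma changes_coords_row:
  assumes k: "1 \<le> k" "k + 2 \<le> n"
    and A: "\<And>f. f \<in> selections (k + 2) n \<Longrightarrow> max_minor (k + 2) A f > 0"
    and C: "\<And>f. f \<in> selections k n \<Longrightarrow> max_minor k C f > 0"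
    and nz: "\<And>i j. i < n \<Longrightarrow> j < n \<Longrightarrow> i \<noteq> j \<Longrightarrow> coords k n A C i j \<noteq> 0"
    and a: "a < n" and s: "s \<noteq> 0"
  shows "changes (\<lambda>j. if j = a then s else coords k n A C a j) (n - 1) \<in> {k, k + 1}"
proof -
  let ?p = "coords k n A C"
  obtain b where b: "b < n" "b \<noteq> a" using k a by (cases "a = 0") (auto intro: that[of 1] that[of 0])
  define e where "e = sgn s * sgn (?p b a)"
  have e: "e \<noteq> 0" using s nz[OF b(1) a b(2)] by (simp add: e_def sgn_zero_iff)
  have "\<forall>\<^sub>F t in at_right 0. sgn (?p a j + (e * t) * ?p b j) = sgn (?p a j)" if "j < n" "j \<noteq> a" for j
  proof -
    have lim: "((\<lambda>t. ?p a j + (e * t) * ?p b j) \<longlongrightarrow> ?p a j + (e * 0) * ?p b j) (at_right 0)"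
      by (intro tendsto_intros)
    have "?p a j \<noteq> 0" using nz[OF a that(1)] that(2) by auto
    then consider "?p a j > 0" | "?p a j < 0" by linarith
    thus ?thesis
    proof cases
      case 1
      thus ?thesis using order_tendstoD(1)[OF lim, of 0] by (auto elim: eventually_mono)
    next
      case 2
      thus ?thesis using order_tendstoD(2)[OF lim, of 0] by (auto elim: eventually_mono)
    qed
  qed
  hence "\<forall>\<^sub>F t in at_right (0::real). t > 0 \<and> (\<forall>j\<in>{..<n}-{a}. sgn (?p a j + (e * t) * ?p b j) = sgn (?p a j))"
    by (intro eventually_conj eventually_at_right_less eventually_ball_finite) auto
  then obtain t :: real where t: "t > 0"
    "\<And>j. j < n \<Longrightarrow> j \<noteq> a \<Longrightarrow> sgn (?p a j + (e * t) * ?p b j) = sgn (?p a j)"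
    using eventually_happens'[OF trivial_limit_at_right_real] by fastforce
  define v where "v j = ?p a j + (e * t) * ?p b j" for j
  have va: "sgn (v a) = sgn s"
  proof -
    have "?p a a = 0" by (simp add: coords_def bracket_self)
    hence "v a = t * sgn s * \<bar>?p b a\<bar>" by (simp add: v_def e_def sgn_mult_abs mult_ac abs_sgn)
    thus ?thesis using t(1) nz[OF b(1) a b(2)] by (simp add: sgn_mult)
  qed
  have sv: "sgn (v j) = sgn (if j = a then s else ?p a j)" if "j < n" for j
    using that va t(2) by (auto simp: v_def)
  have "changes v (n - 1) \<in> {k, k + 1}"
  proof (rule changes_bracket_row[OF k A C])
    show "v j = bracket k (\<lambda>r c. \<Sum>h<n. C r h * A c h) (\<lambda>c. 1 * A c a + (e * t) * A c b) (\<lambda>c. A c j)" for j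
      unfolding bracket_lincomb_left by (simp add: v_def coords_def)
    show "v j \<noteq> 0" if "j < n" for j
    proof
      assume "v j = 0"
      hence "sgn (if j = a then s else ?p a j) = 0" using sv[OF that] by simp
      thus False using s nz[OF a that] by (auto simp: sgn_zero_iff split: if_splits)
    qed
  qed
  also have "changes v (n - 1) = changes (\<lambda>j. if j = a then s else ?p a j) (n - 1)"
    by (rule changes_cong_sgn, rule sv) (use k in auto)
  finally show ?thesis .
qed

text \<open>If the neighbours of the zero in row \<open>a\<close> had the same sign, filling in the two possible signs would give
  numbers of changes that differ by \<open>2\<close>, but both are in \<open>{k, k + 1}\<close>. In row \<open>0\<close> the zero comes first, and
  the two fillings give the number of changes in the rest of the row and one more; so the former is \<open>k\<close>.\<close>
lemma coords_signs_positive: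
  assumes k: "1 \<le> k" "k + 2 \<le> n"
    and A: "\<And>f. f \<in> selections (k + 2) n \<Longrightarrow> max_minor (k + 2) A f > 0"
    and C: "\<And>f. f \<in> selections k n \<Longrightarrow> max_minor k C f > 0"
    and nz: "\<And>i j. i < n \<Longrightarrow> j < n \<Longrightarrow> i \<noteq> j \<Longrightarrow> coords k n A C i j \<noteq> 0"
  shows "0 < a \<Longrightarrow> Suc a < n \<Longrightarrow> coords k n A C a (a - 1) * coords k n A C a (Suc a) < 0"
    and "card {d. 1 \<le> d \<and> Suc d < n \<and> coords k n A C 0 d * coords k n A C 0 (Suc d) < 0} = k"
proof -
  let ?p = "coords k n A C"
  let ?v = "\<lambda>a s j. if j = a then s else ?p a j"
  note row = changes_coords_row[OF k A C nz]
  show "?p a (a - 1) * ?p a (Suc a) < 0" if a: "0 < a" "Suc a < n"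
  proof (rule ccontr)
    assume n0: "\<not> ?p a (a - 1) * ?p a (Suc a) < 0"
    define s where "s = ?p a (a - 1)"
    have s0: "s \<noteq> 0" using nz[of a "a-1"] a by (auto simp: s_def)
    have s1: "s * ?p a (Suc a) > 0"
      using n0 s0 nz[of a "Suc a"] a unfolding s_def by (metis Suc_lessD mult_eq_0_iff n_not_Suc_n not_less_iff_gr_or_eq)
    define S where "S = {d. d < n - 1 \<and> ?v a s d * ?v a s (Suc d) < 0}"
    have f: "finite S" by (simp add: S_def)
    have out: "a - 1 \<notin> S" "a \<notin> S"
      using a s1 s0 by (auto simp: S_def s_def not_less mult_less_0_iff zero_less_mult_iff)
    have "{d. d < n - 1 \<and> ?v a (-s) d * ?v a (-s) (Suc d) < 0} = insert (a - 1) (insert a S)"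
    proof (rule Set.set_eqI)
      fix d
      consider "d = a" | "Suc d = a" | "d \<noteq> a" "Suc d \<noteq> a" by blast
      thus "d \<in> {d. d < n - 1 \<and> ?v a (-s) d * ?v a (-s) (Suc d) < 0} \<longleftrightarrow> d \<in> insert (a - 1) (insert a S)"
      proof cases
        case 1 thus ?thesis using a s1 by auto
      next
        case 2
        hence "?p a d = s" by (auto simp: s_def)
        moreover have "s * s > 0" using s0 by (simp add: zero_less_mult_iff not_less) linarith
        ultimately show ?thesis using a 2 by auto
      next
        case 3 thus ?thesis by (auto simp: S_def)
      qed
    qed
    hence "changes (?v a (-s)) (n - 1) = card (insert (a - 1) (insert a S))" by (simp add: changes_def)
    also have "\<dots> = card S + 2" using out f a by (subst card_insert_disjoint; auto)+
    also have "card S = changes (?v a s) (n - 1)" by (simp add: changes_def S_def)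
    finally show False
      using row[of a s] row[of a "-s"] s0 a by auto
  qed
  define S where "S = {d. 1 \<le> d \<and> Suc d < n \<and> ?p 0 d * ?p 0 (Suc d) < 0}"
  have f: "finite S" by (rule finite_subset[of _ "{..n}"]) (auto simp: S_def)
  have p1: "?p 0 1 \<noteq> 0" using nz[of 0 1] k by auto
  have "{d. d < n - 1 \<and> ?v 0 (?p 0 1) d * ?v 0 (?p 0 1) (Suc d) < 0} = S"
    using p1 by (auto simp: S_def not_less mult_less_0_iff Suc_le_eq intro: ccontr)
  hence 1: "changes (?v 0 (?p 0 1)) (n - 1) = card S" by (simp add: changes_def)
  have "{d. d < n - 1 \<and> ?v 0 (- ?p 0 1) d * ?v 0 (- ?p 0 1) (Suc d) < 0} = insert 0 S"
  proof (rule Set.set_eqI)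
    fix d
    have "0 < ?p 0 (Suc 0) * ?p 0 (Suc 0)" using p1 by (simp add: zero_less_mult_iff) linarith
    thus "d \<in> {d. d < n - 1 \<and> ?v 0 (- ?p 0 1) d * ?v 0 (- ?p 0 1) (Suc d) < 0} \<longleftrightarrow> d \<in> insert 0 S"
      using k by (cases "d = 0") (auto simp: S_def)
  qed
  hence 2: "changes (?v 0 (- ?p 0 1)) (n - 1) = card S + 1"
    using f by (simp add: changes_def S_def)
  show "card {d. 1 \<le> d \<and> Suc d < n \<and> ?p 0 d * ?p 0 (Suc d) < 0} = k"
    using row[of 0 "?p 0 1"] row[of 0 "- ?p 0 1"] p1 k 1 2 by (auto simp: S_def)
qed

lemma coords_signs:
  assumes k: "1 \<le> k" "k + 2 \<le> n"
    and A: "\<And>f. f \<in> selections (k + 2) n \<Longrightarrow> max_minor (k + 2) A f > 0"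
    and C: "\<And>f. f \<in> selections k n \<Longrightarrow> max_minor k C f \<ge> 0"
    and f: "f \<in> selections k n" "max_minor k C f \<noteq> 0"
    and nz: "\<And>i j. i < n \<Longrightarrow> j < n \<Longrightarrow> i \<noteq> j \<Longrightarrow> coords k n A C i j \<noteq> 0"
  shows "0 < a \<Longrightarrow> Suc a < n \<Longrightarrow> coords k n A C a (a - 1) * coords k n A C a (Suc a) < 0"
    and "card {d. 1 \<le> d \<and> Suc d < n \<and> coords k n A C 0 d * coords k n A C 0 (Suc d) < 0} = k"
proof -
  define Q where "Q C' \<longleftrightarrow> (\<forall>i<n. \<forall>j<n. sgn (coords k n A C' i j) = sgn (coords k n A C i j))" for C'
  have "\<exists>C'. Q C' \<and> (\<forall>f \<in> selections k n. max_minor k C' f > 0)"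
  proof (rule perturb_to_positive[of Q n C k f])
    fix C' and i i' :: nat assume Q: "Q C'"
    have "\<forall>\<^sub>F t in at_right 0. sgn (coords k n A (column_add i i' t C') x y) = sgn (coords k n A C x y)"
      if xy: "x < n" "y < n" for x y
    proof (cases "x = y")
      case True thus ?thesis by (simp add: coords_def bracket_self)
    next
      case False
      have "((\<lambda>t. coords k n A (column_add i i' t C') x y) \<longlongrightarrow>
             coords k n A (column_add i i' 0 C') x y) (at_right 0)"
        unfolding coords_def
        by (intro tendsto_bracket tendsto_intros)
           (auto simp: column_add_def intro!: tendsto_eq_intros)
      moreover have "column_add i i' 0 C' = C'" by (auto simp: column_add_def fun_eq_iff)
      ultimately have lim: "((\<lambda>t. coords k n A (column_add i i' t C') x y) \<longlongrightarrow>
             coords k n A C' x y) (at_right 0)" by simp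
      have sg: "sgn (coords k n A C' x y) = sgn (coords k n A C x y)" using Q xy by (simp add: Q_def)
      have "coords k n A C x y \<noteq> 0" using nz[OF xy False] .
      then consider "coords k n A C x y > 0" | "coords k n A C x y < 0" by linarith
      thus ?thesis
      proof cases
        case 1
        hence "coords k n A C' x y > 0" using sg by (metis sgn_1_pos sgn_pos)
        thus ?thesis using order_tendstoD(1)[OF lim, of 0] 1 by (auto elim: eventually_mono)
      next
        case 2
        hence "coords k n A C' x y < 0" using sg by (metis sgn_1_neg sgn_neg)
        thus ?thesis using order_tendstoD(2)[OF lim, of 0] 2 by (auto elim: eventually_mono)
      qed
    qed
    hence "\<forall>\<^sub>F t in at_right 0. \<forall>x\<in>{..<n}. \<forall>y\<in>{..<n}.
       sgn (coords k n A (column_add i i' t C') x y) = sgn (coords k n A C x y)"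
      by (intro eventually_ball_finite ballI) auto
    thus "\<forall>\<^sub>F t in at_right 0. Q (column_add i i' t C')"
      by (rule eventually_mono) (auto simp: Q_def)
  next
    show "max_minor k C f > 0" using f C[OF f(1)] by simp
  qed (use C f in \<open>auto simp: Q_def\<close>)
  then obtain C' where C': "Q C'" "\<And>f. f \<in> selections k n \<Longrightarrow> max_minor k C' f > 0" by auto
  have sg: "sgn (coords k n A C' i j) = sgn (coords k n A C i j)" if "i < n" "j < n" for i j
    using C'(1) that by (simp add: Q_def)
  have nz': "coords k n A C' i j \<noteq> 0" if "i < n" "j < n" "i \<noteq> j" for i j
    using sg[OF that(1,2)] nz[OF that] by (metis sgn_0_0)
  have pos1: "coords k n A C' a (a - 1) * coords k n A C' a (Suc a) < 0" if "0 < a" "Suc a < n" for a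
    by (rule coords_signs_positive(1)[OF k]) (use A C'(2) nz' that in auto)
  have pos2: "card {d. 1 \<le> d \<and> Suc d < n \<and> coords k n A C' 0 d * coords k n A C' 0 (Suc d) < 0} = k"
    by (rule coords_signs_positive(2)[OF k]) (use A C'(2) nz' in auto)
  show "coords k n A C a (a - 1) * coords k n A C a (Suc a) < 0" if a: "0 < a" "Suc a < n"
    using pos1[OF a] prod_neg_cong_sgn[OF sg[of a "a-1"] sg[of a "Suc a"]] a by simp
  have "{d. 1 \<le> d \<and> Suc d < n \<and> coords k n A C 0 d * coords k n A C 0 (Suc d) < 0} =
        {d. 1 \<le> d \<and> Suc d < n \<and> coords k n A C' 0 d * coords k n A C' 0 (Suc d) < 0}"
    by (intro Collect_cong conj_cong refl prod_neg_cong_sgn) (use sg in auto)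
  thus "card {d. 1 \<le> d \<and> Suc d < n \<and> coords k n A C 0 d * coords k n A C 0 (Suc d) < 0} = k"
    using pos2 by simp
qed

section \<open>Words and the signs that they encode\<close>

definition place :: "nat list \<Rightarrow> nat \<Rightarrow> nat" where
  "place w x = length (takeWhile (\<lambda>y. y \<noteq> x) w)"

lemma place_less: "x \<in> set w \<Longrightarrow> place w x < length w"
  unfolding place_def by (induction w) auto

lemma nth_place: "x \<in> set w \<Longrightarrow> w ! place w x = x"
  unfolding place_def by (induction w) auto

lemma place_nth:
  assumes "distinct w" "p < length w" shows "place w (w ! p) = p"
  using nth_place[of "w ! p" w] place_less[of "w ! p" w] assms
  by (metis nth_eq_iff_index_eq nth_mem)

lemma place_append:
  "place (u @ v) x = (if x \<in> set u then place u x else length u + place v x)"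
proof (cases "x \<in> set u")
  case True thus ?thesis by (auto simp: place_def takeWhile_append1)
next
  case False
  hence "takeWhile (\<lambda>y. y \<noteq> x) (u @ v) = u @ takeWhile (\<lambda>y. y \<noteq> x) v"
    by (intro takeWhile_append2) auto
  thus ?thesis using False by (simp add: place_def)
qed

lemma place_inj:
  "x \<in> set w \<Longrightarrow> y \<in> set w \<Longrightarrow> place w x = place w y \<longleftrightarrow> x = y"
  by (metis nth_place)

lemma left_of_iff_place:
  assumes "distinct w" "x \<in> set w" "y \<in> set w"
  shows "left_of w x y \<longleftrightarrow> place w x < place w y"
proof
  assume "left_of w x y"
  then obtain p q where "p < q" "q < length w" "w ! p = x" "w ! q = y" by (auto simp: left_of_def)
  thus "place w x < place w y" using place_nth[OF assms(1), of p] place_nth[OF assms(1), of q] by auto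
next
  assume "place w x < place w y"
  thus "left_of w x y" unfolding left_of_def
    using assms nth_place[of x w] nth_place[of y w] place_less[of y w] by blast
qed

text \<open>If \<open>w = u @ a # v\<close>, the rotation is \<open>v @ u @ [a]\<close>: the order is kept within each part and reversed
  between them.\<close>
lemma left_of_rot_end:
  assumes w: "distinct w" "a \<in> set w" "x \<in> set w" "y \<in> set w" and xy: "x \<noteq> y"
  defines "c \<equiv> place w a"
  shows "left_of (rot_end w a) x y \<longleftrightarrow>
    x \<noteq> a \<and> (y = a \<or> place w x < place w y \<and> (c < place w x \<or> place w y < c)
              \<or> place w y < c \<and> c < place w x)"
proof -
  obtain u v where uv: "w = u @ a # v" "a \<notin> set u"
    using split_list_first[OF w(2)] by blast
  have tw: "takeWhile (\<lambda>x. x \<noteq> a) w = u" unfolding uv(1)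
    by (subst takeWhile_append2) (use uv in auto)
  have dw: "dropWhile (\<lambda>x. x \<noteq> a) w = a # v" unfolding uv(1)
    by (subst dropWhile_append2) (use uv in auto)
  have r: "rot_end w a = v @ u @ [a]" unfolding rot_end_def tw dw by simp
  have dr: "distinct (rot_end w a)" and sr: "set (rot_end w a) = set w"
    unfolding r using w(1) uv(1) by auto
  have av: "a \<notin> set v" using w(1) unfolding uv(1) by simp
  have disj: "set u \<inter> set v = {}" using w(1) unfolding uv(1) by auto
  have pa: "c = length u" unfolding c_def place_def tw ..
  have pw: "place w z = (if z \<in> set u then place u z else if z = a then length u
      else length u + 1 + place v z)" for z
    unfolding uv(1) place_append by (auto simp: place_def)
  have pr: "place (rot_end w a) z = (if z \<in> set v then place v z else if z \<in> set u then length v + place u z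
      else length v + length u + place [a] z)" for z
    unfolding r place_append by auto
  have lu: "place u z < length u" if "z \<in> set u" for z using place_less that .
  have lv: "place v z < length v" if "z \<in> set v" for z using place_less that .
  have pa': "place [a] a = 0" by (simp add: place_def)
  have iff: "left_of (rot_end w a) x y \<longleftrightarrow> place (rot_end w a) x < place (rot_end w a) y"
    by (rule left_of_iff_place[OF dr]) (simp_all add: sr w)
  have pu: "place w z = place u z" "place (rot_end w a) z = length v + place u z" "place u z < length u"
    if "z \<in> set u" for z
  proof -
    have "z \<notin> set v" using that disj by auto
    thus "place w z = place u z" "place (rot_end w a) z = length v + place u z" "place u z < length u"
      using that lu by (simp_all add: pw pr)
  qed
  have pv: "place w z = length u + 1 + place v z" "place (rot_end w a) z = place v z" "place v z < length v"
    if "z \<in> set v" for z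
  proof -
    have "z \<notin> set u" "z \<noteq> a" using that disj av by auto
    thus "place w z = length u + 1 + place v z" "place (rot_end w a) z = place v z" "place v z < length v"
      using that lv by (simp_all add: pw pr)
  qed
  have pa2: "place (rot_end w a) a = length v + length u" using uv(2) av pa' by (simp add: pr)
  have mem: "z \<in> set u \<or> z \<in> set v" if "z \<in> set w" "z \<noteq> a" for z
    using that unfolding uv(1) by auto
  show ?thesis
  proof (cases "x = a")
    case True
    have "\<not> place (rot_end w a) x < place (rot_end w a) y"
      using mem[OF w(4)] pu(2,3)[of y] pv(2,3)[of y] True xy pa2 by force
    thus ?thesis unfolding iff using True by simp
  next
    case xa: False
    show ?thesis
    proof (cases "y = a")
      case True
      have "place (rot_end w a) x < place (rot_end w a) y"
        using mem[OF w(3) xa] pu(2,3)[of x] pv(2,3)[of x] True pa2 by force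
      thus ?thesis unfolding iff using True xa by simp
    next
      case ya: False
      from mem[OF w(3) xa] mem[OF w(4) ya] show ?thesis
      proof (elim disjE)
        assume "x \<in> set u" "y \<in> set u"
        from pu[OF this(1)] pu[OF this(2)] show ?thesis unfolding iff pa using xa ya by simp
      next
        assume "x \<in> set u" "y \<in> set v"
        from pu[OF this(1)] pv[OF this(2)] show ?thesis unfolding iff pa using xa ya by simp
      next
        assume "x \<in> set v" "y \<in> set u"
        from pv[OF this(1)] pu[OF this(2)] show ?thesis unfolding iff pa using xa ya by simp
      next
        assume "x \<in> set v" "y \<in> set v"
        from pv[OF this(1)] pv[OF this(2)] show ?thesis unfolding iff pa using xa ya by simp
      qed
    qed
  qed
qed

text \<open>The letter that stands for the line of \<open>z\<^sub>j\<close>. With this shift, the cyclic successor \<open>j'\<close> of \<open>j\<close> satisfies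
  \<open>letter n j' = j\<close>, so that \<open>j\<close> is a cyclic left descent iff the line with the index \<open>j'\<close> comes before the one
  with the index \<open>j\<close>.\<close>
definition letter :: "nat \<Rightarrow> nat \<Rightarrow> nat" where
  "letter n j = (if j = 1 then n else j - 1)"

abbreviation slot :: "nat \<Rightarrow> nat list \<Rightarrow> nat \<Rightarrow> nat" where
  "slot n w j \<equiv> place w (letter n j)"

text \<open>How often a vector that turns from \<open>z\<^sub>1\<close> to \<open>z\<^sub>j\<close> leaves or crosses the line of \<open>z\<^sub>1\<close>, where the word ends.\<close>
definition half_turns :: "nat \<Rightarrow> nat list \<Rightarrow> nat \<Rightarrow> nat" where
  "half_turns n w j = card (cDes_L n w \<inter> {1..<j})"

text \<open>Up to a common factor, \<open>z\<^sub>j\<close> is \<open>(-1)\<close> to the power \<open>half_turns n w j\<close> times a vector of the upper half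
  plane, and those vectors are ordered by angle as their letters are in the word. Hence this is the
  sign of \<open>det (z\<^sub>i, z\<^sub>j)\<close>.\<close>
definition word_sign :: "nat \<Rightarrow> nat list \<Rightarrow> nat \<Rightarrow> nat \<Rightarrow> real" where
  "word_sign n w i j =
     (-1) ^ half_turns n w i * (-1) ^ half_turns n w j * sgn (real (slot n w j) - real (slot n w i))"

lemma word_sign_antisym: "word_sign n w j i = - word_sign n w i j"
  by (auto simp: word_sign_def sgn_if)

lemma letter_in: "n \<ge> 1 \<Longrightarrow> j \<in> {1..n} \<Longrightarrow> letter n j \<in> {1..n}"
  by (auto simp: letter_def)

lemma letter_inj: "j \<in> {1..n} \<Longrightarrow> i \<in> {1..n} \<Longrightarrow> letter n j = letter n i \<longleftrightarrow> j = i"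
  by (auto simp: letter_def)

context
  fixes n :: nat and w :: "nat list"
  assumes n: "n \<ge> 3" and w: "distinct w" "set w = {1..n}" "last w = n"
begin

lemma length_word: "length w = n"
  using w distinct_card[of w] by simp

lemma slot_less: "j \<in> {1..n} \<Longrightarrow> slot n w j < n"
  using place_less[of "letter n j" w] letter_in[of n j] w length_word by auto

lemma slot_inj: "i \<in> {1..n} \<Longrightarrow> j \<in> {1..n} \<Longrightarrow> slot n w i = slot n w j \<longleftrightarrow> i = j"
  using place_inj[of "letter n i" w "letter n j"] letter_in[of n] letter_inj[of i n j] w n by auto

lemma slot_1: "slot n w 1 = n - 1"
proof -
  have "w ! (n - 1) = n" using w(3) length_word n by (metis last_conv_nth length_0_conv not_numeral_le_zero)
  thus ?thesis using place_nth[OF w(1), of "n-1"] length_word n by (simp add: letter_def)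
qed

text \<open>The case distinction in the definition of cyclic descents disappears once letters are replaced by the
  vectors that they stand for; \<open>n\<close> is not a descent, being the last letter.\<close>
lemma cDes_L_iff_slot:
  assumes "j \<in> {1..n}"
  shows "j \<in> cDes_L n w \<longleftrightarrow> j < n \<and> slot n w (Suc j) < slot n w j"
proof -
  have "j \<in> cDes_L n w \<longleftrightarrow> left_of w j (letter n j)"
    using assms by (auto simp: cDes_L_def letter_def)
  also have "\<dots> \<longleftrightarrow> place w j < slot n w j"
    using assms letter_in[of n j] w n by (intro left_of_iff_place) auto
  also have "\<dots> \<longleftrightarrow> j < n \<and> slot n w (Suc j) < slot n w j"
  proof (cases "j < n")
    case True thus ?thesis using assms by (simp add: letter_def)
  next
    case False
    hence "place w j = n - 1" using assms slot_1 by (simp add: letter_def)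
    thus ?thesis using False slot_less[OF assms] by auto
  qed
  finally show ?thesis .
qed

lemma half_turns_1 [simp]: "half_turns n w 1 = 0" "half_turns n w (Suc 0) = 0"
  by (auto simp: half_turns_def)

lemma half_turns_Suc:
  assumes "1 \<le> j" "j < n"
  shows "half_turns n w (Suc j) = half_turns n w j + (if slot n w (Suc j) < slot n w j then 1 else 0)"
proof -
  have "cDes_L n w \<inter> {1..<Suc j} =
     (if slot n w (Suc j) < slot n w j then insert j (cDes_L n w \<inter> {1..<j}) else cDes_L n w \<inter> {1..<j})"
    using cDes_L_iff_slot[of j] assms by (auto simp: less_Suc_eq)
  thus ?thesis by (simp add: half_turns_def)
qed

lemma half_turns_n: "half_turns n w n = card (cDes_L n w)"
proof -
  have "cDes_L n w \<inter> {1..<n} = cDes_L n w"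
  proof -
    have "1 \<le> d \<and> d < n" if "d \<in> cDes_L n w" for d
    proof -
      have "d \<in> {1..n}" using that by (auto simp: cDes_L_def)
      thus ?thesis using cDes_L_iff_slot[of d] that by auto
    qed
    thus ?thesis by auto
  qed
  thus ?thesis by (simp add: half_turns_def)
qed

lemma half_turns_2: "half_turns n w 2 = 1"
  using half_turns_Suc[of 1] slot_1 slot_less[of 2] slot_inj[of 1 2] n by (simp add: numeral_2_eq_2)

lemma word_sign_cases:
  assumes "i \<in> {1..n}" "j \<in> {1..n}"
  shows "word_sign n w i j = (if i = j then 0 else if slot n w i < slot n w j
      then (-1) ^ half_turns n w i * (-1) ^ half_turns n w j
      else - ((-1) ^ half_turns n w i * (-1) ^ half_turns n w j))"
  using slot_inj[OF assms] by (auto simp: word_sign_def sgn_if)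

lemma word_sign_values: "i \<in> {1..n} \<Longrightarrow> j \<in> {1..n} \<Longrightarrow> i \<noteq> j \<Longrightarrow> word_sign n w i j \<in> {1, -1}"
  unfolding word_sign_cases power_add[symmetric] by (auto simp: minus_one_power_iff)

lemma word_sign_consecutive:
  assumes "1 \<le> j" "j < n" shows "word_sign n w j (Suc j) = 1"
  using half_turns_Suc[OF assms] slot_inj[of j "Suc j"] assms
  by (subst word_sign_cases) (auto simp flip: power_add simp: not_less)

text \<open>The right-hand side says that the slots of \<open>i'\<close>, \<open>i\<close> and \<open>a\<close> are in this cyclic order, and distinct.\<close>
lemma I_set_iff:
  assumes a: "a \<in> {1..n}" and i: "i \<in> {1..n}" and ia: "i \<noteq> a"
  defines "i' \<equiv> (if i = n then 1 else i + 1)"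
  shows "i \<in> I_set n w a \<longleftrightarrow> i' \<noteq> a \<and>
     (slot n w i' < slot n w i \<and> (slot n w a < slot n w i' \<or> slot n w i < slot n w a)
      \<or> slot n w i < slot n w a \<and> slot n w a < slot n w i')"
proof -
  have i': "i' \<in> {1..n}" "i' \<noteq> i" using i n by (auto simp: i'_def)
  have L: "letter n x \<in> set w" if "x \<in> {1..n}" for x using letter_in[of n x] that w n by auto
  have "I_set n w a = cDes_L n (rot_end w (letter n a))"
    by (simp add: I_set_def letter_def)
  hence "i \<in> I_set n w a \<longleftrightarrow> left_of (rot_end w (letter n a)) (letter n i') (letter n i)"
    using i by (auto simp: cDes_L_def letter_def i'_def)
  also have "\<dots> \<longleftrightarrow> i' \<noteq> a \<and>
     (slot n w i' < slot n w i \<and> (slot n w a < slot n w i' \<or> slot n w i < slot n w a)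
      \<or> slot n w i < slot n w a \<and> slot n w a < slot n w i')"
    using letter_inj[of i' n i] letter_inj[of i' n a] letter_inj[of i n a] i' i a ia
    by (subst left_of_rot_end[OF w(1) L[OF a] L[OF i'(1)] L[OF i]]) auto
  finally show ?thesis .
qed

text \<open>The product of the signs at \<open>i\<close> and at its successor \<open>i'\<close> is the product of the signs of the three
  differences of the slots of \<open>i'\<close>, \<open>i\<close> and \<open>a\<close>, which is negative for one of the two cyclic orders of the
  three. For \<open>i = n\<close> the factor of the hat is needed: it compensates for the \<open>k + 1\<close> half turns
  between \<open>z\<^sub>1\<close> and \<open>z\<^sub>n\<close>.\<close>
lemma Flip_word_sign:
  fixes q :: "nat \<Rightarrow> nat \<Rightarrow> real"
  assumes a: "a \<in> {1..n}" and k: "card (cDes_L n w) = k + 1"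
    and q: "\<And>i j. i \<in> {1..n} \<Longrightarrow> j \<in> {1..n} \<Longrightarrow> sgn (q i j) = \<epsilon> * word_sign n w i j"
    and \<epsilon>: "\<epsilon> \<in> {1, -1 :: real}"
  shows "Flip n (\<lambda>j. if j < a then (-1) ^ (k + 1) * q a j else q a j) = I_set n w a - {a}"
proof (rule Set.set_eqI)
  fix i
  let ?v = "\<lambda>j. if j < a then (-1) ^ (k + 1) * q a j else q a j"
  show "i \<in> Flip n ?v \<longleftrightarrow> i \<in> I_set n w a - {a}"
  proof (cases "i \<in> {1..n} \<and> i \<noteq> a")
    case False
    have "sgn (q a a) = 0" using q[OF a a] a by (simp add: word_sign_cases)
    hence "?v a = 0" by (simp add: sgn_zero_iff)
    thus ?thesis using False by (auto simp: Flip_def Let_def I_set_def cDes_L_def)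
  next
    case True
    hence i: "i \<in> {1..n}" and ia: "i \<noteq> a" by auto
    define i' where "i' = (if i = n then 1 else i + 1)"
    have i': "i' \<in> {1..n}" "i' \<noteq> i" using i n by (auto simp: i'_def)
    have qaa: "q a a = 0" using q[OF a a] a by (simp add: word_sign_cases sgn_zero_iff)
    have qnz: "q a j \<noteq> 0" if "j \<in> {1..n}" "j \<noteq> a" for j
    proof
      assume "q a j = 0"
      hence "\<epsilon> * word_sign n w a j = 0" using q[OF a that(1)] by simp
      thus False using word_sign_values[OF a that(1)] that \<epsilon> by auto
    qed
    show ?thesis
    proof (cases "i' = a")
      case True
      thus ?thesis using I_set_iff[OF a i ia] qaa by (auto simp: Flip_def Let_def i'_def)
    next
      case i'a: False
      let ?x = "slot n w i'" and ?y = "slot n w i" and ?c = "slot n w a"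
      have d: "?x \<noteq> ?y" "?x \<noteq> ?c" "?y \<noteq> ?c" using slot_inj i i' a ia i'a by auto
      have vnz: "?v i \<noteq> 0" "?v i' \<noteq> 0" using qnz i i' ia i'a by auto
      define H :: real where "H = sgn (real ?x - real ?y)"
      have key: "sgn (?v i) * sgn (?v i') = H * sgn (real ?y - real ?c) * sgn (real ?x - real ?c)"
      proof -
        define h :: real where "h = (if i = n then (-1) ^ (k + 1) else 1)"
        define e :: real where "e = (-1) ^ (k + 1)"
        have e: "e * e = 1" "sgn e = e" by (auto simp: e_def minus_one_power_iff)
        have v: "?v j = (if j < a then e * q a j else q a j)" for j by (simp add: e_def)
        have "sgn (?v i) * sgn (?v i') = h * sgn (q a i) * sgn (q a i')"
        proof (cases "i = n")
          case True
          hence "i' < a" "\<not> i < a" using i'a a by (auto simp: i'_def)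
          thus ?thesis unfolding v h_def e_def[symmetric] using True e(2) by (simp add: sgn_mult)
        next
          case False
          hence "i' < a \<longleftrightarrow> i < a" using i'a ia by (auto simp: i'_def)
          hence "sgn (?v i) * sgn (?v i') = (if i < a then e * e else 1) * (sgn (q a i) * sgn (q a i'))"
            unfolding v using e(2) by (simp add: sgn_mult)
          thus ?thesis using False e(1) by (simp add: h_def)
        qed
        also have "\<dots> = h * ((-1) ^ half_turns n w i * (-1) ^ half_turns n w i') *
              sgn (real ?y - real ?c) * sgn (real ?x - real ?c)"
        proof -
          have "\<epsilon> * \<epsilon> = 1" using \<epsilon> by auto
          moreover have "(-1) ^ half_turns n w a * (-1) ^ half_turns n w a = (1::real)"
            by (simp flip: power_add)
          ultimately have one: "(\<epsilon> * \<epsilon>) * ((-1) ^ half_turns n w a * (-1) ^ half_turns n w a) = (1::real)" by simp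
          have "h * sgn (q a i) * sgn (q a i') = ((\<epsilon> * \<epsilon>) * ((-1) ^ half_turns n w a * (-1) ^ half_turns n w a)) *
             (h * ((-1) ^ half_turns n w i * (-1) ^ half_turns n w i') *
              sgn (real ?y - real ?c) * sgn (real ?x - real ?c))"
            unfolding q[OF a i] q[OF a i'(1)] word_sign_def by (simp only: mult_ac)
          thus ?thesis unfolding one by simp
        qed
        also have "h * ((-1) ^ half_turns n w i * (-1) ^ half_turns n w i') = H"
        proof (cases "i = n")
          case True
          hence "?x = n - 1" using slot_1 by (simp add: i'_def)
          hence "?y < ?x" using slot_less[OF i] d by simp
          thus ?thesis using True half_turns_n k
            by (simp add: h_def H_def i'_def flip: power_add)
        next
          case False
          hence "1 \<le> i" "i < n" "i' = Suc i" using i by (auto simp: i'_def)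
          thus ?thesis using half_turns_Suc[of i] d False
            by (auto simp: h_def H_def simp flip: power_add)
        qed
        finally show ?thesis .
      qed
      have "i \<in> Flip n ?v \<longleftrightarrow> sgn (?v i) \<noteq> sgn (?v i')"
        using i vnz unfolding Flip_def Let_def i'_def by blast
      also have "\<dots> \<longleftrightarrow> sgn (?v i) * sgn (?v i') < 0"
        using vnz by (auto simp: sgn_if mult_less_0_iff)
      also have "\<dots> \<longleftrightarrow> ?x < ?y \<and> (?c < ?x \<or> ?y < ?c) \<or> ?y < ?c \<and> ?c < ?x"
        unfolding key H_def using d by (auto simp: sgn_if)
      also have "\<dots> \<longleftrightarrow> i \<in> I_set n w a - {a}"
        using I_set_iff[OF a i ia] i'a ia by (auto simp: i'_def)
      finally show ?thesis .
    qed
  qed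
qed

end

lemma D_iff:
  "w \<in> D r n \<longleftrightarrow> distinct w \<and> set w = {1..n} \<and> last w = n \<and> card (cDes_L n w) = r"
  by (auto simp: D_def permutations_of_set_def)

text \<open>By the Pluecker relation the brackets are those of the vectors \<open>z\<^sub>j = (q 1 j, q 2 j)\<close> up to a factor.
  Sorting the lines by their slopes \<open>\<psi>\<close> gives the word; the line of \<open>z\<^sub>1\<close> is vertical and comes last.\<close>
lemma word_from_signs:
  assumes n: "n \<ge> 3"
    and anti: "\<And>i j. q j i = - q i j"
    and nz: "\<And>i j. i \<in> {1..n} \<Longrightarrow> j \<in> {1..n} \<Longrightarrow> i \<noteq> j \<Longrightarrow> q i j \<noteq> (0::real)"
    and pl: "\<And>i j. i \<in> {1..n} \<Longrightarrow> j \<in> {1..n} \<Longrightarrow> q 1 2 * q i j = q 1 i * q 2 j - q 1 j * q 2 i"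
    and pos: "\<And>i. 1 \<le> i \<Longrightarrow> i < n \<Longrightarrow> q i (Suc i) > 0"
    and k: "card {d. 2 \<le> d \<and> d < n \<and> q 1 d * q 1 (Suc d) < 0} = k"
  obtains w where "w \<in> D (k + 1) n"
    "\<And>i j. i \<in> {1..n} \<Longrightarrow> j \<in> {1..n} \<Longrightarrow> sgn (q i j) = word_sign n w i j"
proof -
  define \<psi> where "\<psi> j = q 2 j / q 1 j" for j
  define xs where "xs = sort_key \<psi> [2..<n+1]"
  define w where "w = map (\<lambda>j. j - 1) xs @ [n]"
  have xs: "distinct xs" "set xs = {2..n}" "sorted (map \<psi> xs)" by (auto simp: xs_def)
  have "inj_on (\<lambda>j. j - 1) {2..n}" by (auto simp: inj_on_def)
  moreover have "(\<lambda>j. j - 1) ` {2..n} = {1..n-1}"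
    by (auto simp: image_iff) (metis Suc_diff_1 Suc_le_eq Suc_le_mono Suc_pred atLeastAtMost_iff diff_Suc_1 le_simps(3) n not_numeral_le_zero numeral_2_eq_2 zero_less_Suc gr0I)
  ultimately have w: "distinct w" "set w = {1..n}" "last w = n"
    using xs n by (auto simp: w_def distinct_map)
  note W = n w
  have slot: "slot n w j < length xs \<and> xs ! slot n w j = j" if "j \<in> {2..n}" for j
  proof -
    have l: "letter n j = j - 1" "j - 1 \<in> set (map (\<lambda>j. j - 1) xs)" using that xs(2) by (auto simp: letter_def)
    hence s: "slot n w j = place (map (\<lambda>j. j - 1) xs) (j - 1)"
      unfolding w_def place_append by auto
    have lt: "slot n w j < length xs" unfolding s using place_less[OF l(2)] by simp
    have "xs ! slot n w j - 1 = j - 1"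
      using nth_place[OF l(2)] lt unfolding s by simp
    moreover have "xs ! slot n w j \<in> {2..n}" using lt xs(2) nth_mem by metis
    ultimately show ?thesis using lt that by auto
  qed
  have q12: "q 1 2 > 0" using pos[of 1] n by (simp add: numeral_2_eq_2)
  have q1: "q 1 j \<noteq> 0" if "j \<in> {2..n}" for j using nz[of 1 j] that n by auto
  have diff: "\<psi> j - \<psi> i = q 1 2 * q i j / (q 1 i * q 1 j)" if "i \<in> {2..n}" "j \<in> {2..n}" for i j
    using q1[OF that(1)] q1[OF that(2)] pl[of i j] that by (simp add: \<psi>_def field_simps)
  have \<psi>_inj: "\<psi> j \<noteq> \<psi> i" if "i \<in> {2..n}" "j \<in> {2..n}" "i \<noteq> j" for i j
    using diff[OF that(1,2)] q1[OF that(1)] q1[OF that(2)] q12 nz[of i j] that by auto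
  have ord: "slot n w i < slot n w j \<longleftrightarrow> \<psi> i < \<psi> j" if ij: "i \<in> {2..n}" "j \<in> {2..n}" for i j
  proof -
    have le: "\<psi> i \<le> \<psi> j" if "slot n w i < slot n w j" "i \<in> {2..n}" "j \<in> {2..n}" for i j
      using sorted_nth_mono[OF xs(3), of "slot n w i" "slot n w j"] slot that by auto
    show ?thesis
    proof (cases "i = j")
      case False
      have "slot n w i \<noteq> slot n w j" using slot ij False by metis
      thus ?thesis using le[of i j] le[of j i] ij \<psi>_inj[OF ij False] by force
    qed simp
  qed
  have sgnq: "sgn (q i j) = sgn (q 1 i) * sgn (q 1 j) * sgn (\<psi> j - \<psi> i)" if "i \<in> {2..n}" "j \<in> {2..n}" for i j
  proof -
    have "sgn (\<psi> j - \<psi> i) = sgn (q i j) / (sgn (q 1 i) * sgn (q 1 j))"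
      unfolding diff[OF that] using q12 by (simp add: sgn_mult sgn_divide)
    moreover have "sgn (q 1 i) \<noteq> 0" "sgn (q 1 j) \<noteq> 0"
      using q1[OF that(1)] q1[OF that(2)] by (simp_all add: sgn_zero_iff)
    ultimately show ?thesis by (simp add: field_simps)
  qed
  have lt_iff: "slot n w (Suc d) < slot n w d \<longleftrightarrow> q 1 d * q 1 (Suc d) < 0" if "2 \<le> d" "d < n" for d
  proof -
    have "slot n w (Suc d) < slot n w d \<longleftrightarrow> \<psi> (Suc d) - \<psi> d < 0" using ord[of "Suc d" d] that by auto
    also have "\<dots> \<longleftrightarrow> q 1 d * q 1 (Suc d) < 0"
      using diff[of d "Suc d"] q12 pos[of d] that by (simp add: divide_less_0_iff mult_less_0_iff zero_less_mult_iff)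
    finally show ?thesis .
  qed
  have slot1: "slot n w 1 = n - 1" by (rule slot_1[OF W])
  have "cDes_L n w = insert 1 {d. 2 \<le> d \<and> d < n \<and> q 1 d * q 1 (Suc d) < 0}"
  proof (rule Set.set_eqI)
    fix d
    show "d \<in> cDes_L n w \<longleftrightarrow> d \<in> insert 1 {d. 2 \<le> d \<and> d < n \<and> q 1 d * q 1 (Suc d) < 0}"
    proof (cases "d \<in> {1..n}")
      case False thus ?thesis using n by (auto simp: cDes_L_def)
    next
      case True
      have "slot n w 2 < slot n w 1"
        using slot_less[OF W, of 2] slot_inj[OF W, of 1 2] slot1 n by auto
      hence "1 \<in> cDes_L n w" using cDes_L_iff_slot[OF W, of 1] n by (simp add: numeral_2_eq_2)
      thus ?thesis using cDes_L_iff_slot[OF W True] lt_iff[of d] True by (cases "d = 1") auto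
    qed
  qed
  moreover have "finite {d. 2 \<le> d \<and> d < n \<and> q 1 d * q 1 (Suc d) < 0}"
    by (rule finite_subset[of _ "{..n}"]) auto
  ultimately have card: "card (cDes_L n w) = k + 1" using k by simp
  have s: "sgn (q 1 j) = - ((-1) ^ half_turns n w j)" if "2 \<le> j" "j \<le> n" for j
    using that
  proof (induction j rule: dec_induct)
    case base
    thus ?case using q12 half_turns_2[OF W] by simp
  next
    case (step j)
    hence IH: "sgn (q 1 j) = - ((-1) ^ half_turns n w j)" by simp
    have "half_turns n w (Suc j) = half_turns n w j + (if q 1 j * q 1 (Suc j) < 0 then 1 else 0)"
      using half_turns_Suc[OF W, of j] lt_iff[of j] step by auto
    moreover have "sgn (q 1 (Suc j)) = (if q 1 j * q 1 (Suc j) < 0 then - sgn (q 1 j) else sgn (q 1 j))"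
      using q1[of j] q1[of "Suc j"] step by (auto simp: sgn_if mult_less_0_iff)
    ultimately show ?case using IH by simp
  qed
  have s1: "sgn (q 1 j) = word_sign n w 1 j" if "j \<in> {1..n}" for j
  proof (cases "j = 1")
    case True
    thus ?thesis using anti[of 1 1] by (simp add: word_sign_def)
  next
    case False
    have "slot n w j < slot n w 1"
      using False slot1 slot_less[OF W that] slot_inj[OF W that, of 1] that by auto
    thus ?thesis using s[of j] half_turns_1[OF W] False that by (simp add: word_sign_def)
  qed
  have "sgn (q i j) = word_sign n w i j" if ij: "i \<in> {1..n}" "j \<in> {1..n}" for i j
  proof -
    consider "i = 1" | "j = 1" | "i = j" | "i \<in> {2..n}" "j \<in> {2..n}" "i \<noteq> j" using ij by force
    thus ?thesis
    proof cases
      case 1 thus ?thesis using s1 ij by simp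
    next
      case 2 thus ?thesis using s1[of i] anti[of 1 i] word_sign_antisym[of n w 1 i] ij by (simp add: sgn_minus)
    next
      case 3 thus ?thesis using anti[of i i] by (simp add: word_sign_def)
    next
      case 4
      hence "sgn (\<psi> j - \<psi> i) = sgn (real (slot n w j) - real (slot n w i))"
        using ord[of i j] ord[of j i] \<psi>_inj[of i j] by (auto simp: sgn_if)
      thus ?thesis using sgnq[OF 4(1,2)] s[of i] s[of j] 4 by (simp add: word_sign_def)
    qed
  qed
  thus ?thesis using that[of w] w card by (simp add: D_iff)
qed

section \<open>Chambers and words\<close>

lemma row_span_image:
  assumes "M \<in> carrier_mat k m"
  shows "row_span m M = (\<lambda>x. M\<^sup>T *\<^sub>v x) ` carrier_vec k"
proof -
  interpret V: vec_space "TYPE(real)" m .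
  have dims: "dim_row M = k" "dim_col M = m" using assms by auto
  show ?thesis unfolding V.row_space_eq[OF assms] dims using assms by (auto simp: image_iff)
qed

lemma index_transpose_mult_vec:
  assumes "M \<in> carrier_mat k m" "x \<in> carrier_vec k" "c < m"
  shows "(M\<^sup>T *\<^sub>v x) $ c = (\<Sum>s<k. M $$ (s, c) * x $ s)"
  using assms by (simp add: scalar_prod_def lessThan_atLeast0)

lemma row_in_row_span:
  assumes "M \<in> carrier_mat k m" "r < k"
  shows "row M r \<in> row_span m M"
proof -
  have "M\<^sup>T *\<^sub>v unit_vec k r = row M r"
    using assms by (intro eq_vecI) (auto simp: scalar_prod_right_unit)
  thus ?thesis unfolding row_span_image[OF assms(1)] using assms
    by (metis image_eqI unit_vec_carrier)
qed

lemma twistor_eq_bracket: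
  assumes "y \<in> carrier_mat k (k + 2)" "Z \<in> carrier_mat n (k + 2)" "i \<in> {1..n}" "j \<in> {1..n}"
  shows "twistor Z y i j = bracket k (\<lambda>r c. y $$ (r, c)) (\<lambda>c. Z $$ (i - 1, c)) (\<lambda>c. Z $$ (j - 1, c))"
proof -
  have "mat_of_rows (dim_col Z) (rows y @ [row Z (i - 1), row Z (j - 1)]) =
    mat (k + 2) (k + 2) (\<lambda>(r, c). if r < k then y $$ (r, c) else if r = k then Z $$ (i - 1, c) else Z $$ (j - 1, c))"
  proof (rule eq_matI)
    fix r c
    assume "r < dim_row (mat (k + 2) (k + 2) (\<lambda>(r, c). if r < k then y $$ (r, c) else if r = k then Z $$ (i - 1, c) else Z $$ (j - 1, c)))"
       "c < dim_col (mat (k + 2) (k + 2) (\<lambda>(r, c). if r < k then y $$ (r, c) else if r = k then Z $$ (i - 1, c) else Z $$ (j - 1, c)))"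
    hence r: "r < k + 2" "c < k + 2" by auto
    hence "r < k \<or> r = k \<or> r = k + 1" by auto
    thus "mat_of_rows (dim_col Z) (rows y @ [row Z (i - 1), row Z (j - 1)]) $$ (r, c) =
      mat (k + 2) (k + 2) (\<lambda>(r, c). if r < k then y $$ (r, c) else if r = k then Z $$ (i - 1, c) else Z $$ (j - 1, c)) $$ (r, c)"
      using r assms by (auto simp: mat_of_rows_def nth_append)
  qed (use assms in auto)
  thus ?thesis by (simp only: twistor_def bracket_def)
qed

text \<open>Any two representatives of a point differ by an invertible matrix, which multiplies all brackets by
  its determinant; so the given one can be exchanged for \<open>CZ\<close>.\<close>
lemma amplituhedron_coords:
  assumes Y: "Y \<in> amplituhedron n k Z" "represents k (k + 2) y Y" and Z: "Z \<in> carrier_mat n (k + 2)"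
  obtains C f c where "\<And>g. g \<in> selections k n \<Longrightarrow> max_minor k C g \<ge> 0"
    "f \<in> selections k n" "max_minor k C f \<noteq> 0"
    "\<And>i j. i \<in> {1..n} \<Longrightarrow> j \<in> {1..n} \<Longrightarrow>
       twistor Z y i j = c * coords k n (\<lambda>r c. Z $$ (c, r)) C (i - 1) (j - 1)"
proof -
  have y: "y \<in> carrier_mat k (k + 2)" "row_span (k + 2) y = Y"
    using Y(2) by (auto simp: represents_def full_row_rank_def)
  obtain V where V: "V \<in> Gr_nonneg k n" "Y = Z_map Z V" using Y(1) by (auto simp: amplituhedron_def)
  then obtain C where C: "full_row_rank k n C" "row_span n C = V"
    "\<forall>J. J \<subseteq> {..<n} \<and> card J = k \<longrightarrow> det (submatrix C UNIV J) \<ge> 0"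
    by (auto simp: Gr_nonneg_def represents_def)
  have Cc: "C \<in> carrier_mat k n" using C(1) by (simp add: full_row_rank_def)
  have CZ: "C * Z \<in> carrier_mat k (k + 2)" using Cc Z by simp
  have "Y = row_span (k + 2) (C * Z)" using V(2) C(2) Z_map_row_span[OF Cc Z] by simp
  hence "\<exists>x. x \<in> carrier_vec k \<and> row y r = (C * Z)\<^sup>T *\<^sub>v x" if "r < k" for r
    using row_in_row_span[OF y(1) that] y(2) unfolding row_span_image[OF CZ] by auto
  then obtain x where x: "\<And>r. r < k \<Longrightarrow> x r \<in> carrier_vec k \<and> row y r = (C * Z)\<^sup>T *\<^sub>v x r" by metis
  have entry: "y $$ (r, c) = (\<Sum>s<k. x r $ s * (\<Sum>h<n. C $$ (s, h) * Z $$ (h, c)))"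
    if "r < k" "c < k + 2" for r c
  proof -
    have "y $$ (r, c) = row y r $ c" using y(1) that by simp
    also have "\<dots> = ((C * Z)\<^sup>T *\<^sub>v x r) $ c" using x[OF that(1)] by simp
    also have "\<dots> = (\<Sum>s<k. (C * Z) $$ (s, c) * x r $ s)"
      by (rule index_transpose_mult_vec[OF CZ]) (use that x in auto)
    also have "\<dots> = (\<Sum>s<k. x r $ s * (\<Sum>h<n. C $$ (s, h) * Z $$ (h, c)))"
      using that Cc Z by (intro sum.cong refl) (simp add: scalar_prod_def lessThan_atLeast0)
    finally show ?thesis .
  qed
  obtain f where f: "f \<in> selections k n" "max_minor k (\<lambda>r c. C $$ (r, c)) f \<noteq> 0"
    using full_row_rank_nonzero_minor[OF C(1)] .
  show ?thesis
  proof (rule that[of "\<lambda>r c. C $$ (r, c)" f "det (mat k k (\<lambda>(r, s). x r $ s))"])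
    show "max_minor k (\<lambda>r c. C $$ (r, c)) g \<ge> 0" if "g \<in> selections k n" for g
      using nonneg_minors_iff[OF Cc] C(3) that by auto
    show "twistor Z y i j = det (mat k k (\<lambda>(r, s). x r $ s)) *
       coords k n (\<lambda>r c. Z $$ (c, r)) (\<lambda>r c. C $$ (r, c)) (i - 1) (j - 1)"
      if "i \<in> {1..n}" "j \<in> {1..n}" for i j
      unfolding twistor_eq_bracket[OF y(1) Z that] coords_def
      by (rule bracket_change_basis, rule entry)
  qed (use f in auto)
qed

lemma twistor_antisym:
  assumes "y \<in> carrier_mat k (k + 2)" "Z \<in> carrier_mat n (k + 2)" "i \<in> {1..n}" "j \<in> {1..n}"
  shows "twistor Z y j i = - twistor Z y i j"
  unfolding twistor_eq_bracket[OF assms] twistor_eq_bracket[OF assms(1,2,4,3)] by (rule bracket_swap)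

text \<open>In each row the signs next to the diagonal are opposite, so by antisymmetry \<open>\<langle>Y i-1 i\<rangle>\<close> and \<open>\<langle>Y i i+1\<rangle>\<close>
  have the same sign.\<close>
lemma amplituhedron_twistor_signs:
  assumes k: "1 \<le> k" "k + 2 \<le> n"
    and Z: "Z \<in> Mat_pos n (k + 2)"
    and Y: "Y \<in> amplituhedron n k Z" "represents k (k + 2) y Y"
    and nz: "\<And>i j. i \<in> {1..n} \<Longrightarrow> j \<in> {1..n} \<Longrightarrow> i \<noteq> j \<Longrightarrow> twistor Z y i j \<noteq> 0"
  shows "\<And>i. 1 \<le> i \<Longrightarrow> i < n \<Longrightarrow> sgn (twistor Z y i (Suc i)) = sgn (twistor Z y 1 2)"
    and "card {d. 2 \<le> d \<and> d < n \<and> twistor Z y 1 d * twistor Z y 1 (Suc d) < 0} = k"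
proof -
  have Zc: "Z \<in> carrier_mat n (k + 2)" using Z by (simp add: Mat_pos_def)
  have yc: "y \<in> carrier_mat k (k + 2)" using Y(2) by (auto simp: represents_def full_row_rank_def)
  let ?A = "\<lambda>r c. Z $$ (c, r)"
  have A: "max_minor (k + 2) ?A f > 0" if "f \<in> selections (k + 2) n" for f
    using Mat_pos_iff[OF Zc] Z that by auto
  obtain C f c where C: "\<And>g. g \<in> selections k n \<Longrightarrow> max_minor k C g \<ge> 0"
    "f \<in> selections k n" "max_minor k C f \<noteq> 0"
    and tw: "\<And>i j. i \<in> {1..n} \<Longrightarrow> j \<in> {1..n} \<Longrightarrow> twistor Z y i j = c * coords k n ?A C (i - 1) (j - 1)"
    using amplituhedron_coords[OF Y Zc] by metis
  have c: "c \<noteq> 0" using nz[of 1 2] tw[of 1 2] k by auto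
  have cnz: "coords k n ?A C i j \<noteq> 0" if "i < n" "j < n" "i \<noteq> j" for i j
    using nz[of "Suc i" "Suc j"] tw[of "Suc i" "Suc j"] that by auto
  have prod: "twistor Z y i j * twistor Z y i' j' < 0 \<longleftrightarrow>
     coords k n ?A C (i - 1) (j - 1) * coords k n ?A C (i' - 1) (j' - 1) < 0"
    if "i \<in> {1..n}" "j \<in> {1..n}" "i' \<in> {1..n}" "j' \<in> {1..n}" for i j i' j'
  proof -
    have "twistor Z y i j * twistor Z y i' j' =
      (c * c) * (coords k n ?A C (i - 1) (j - 1) * coords k n ?A C (i' - 1) (j' - 1))"
      unfolding tw[OF that(1,2)] tw[OF that(3,4)] by simp
    moreover have "c * c > 0" using c by (simp add: zero_less_mult_iff) linarith
    ultimately show ?thesis by (simp add: mult_less_0_iff)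
  qed
  have step: "sgn (twistor Z y (Suc i) (Suc (Suc i))) = sgn (twistor Z y i (Suc i))"
    if "1 \<le> i" "Suc i < n" for i
  proof -
    have "coords k n ?A C i (i - 1) * coords k n ?A C i (Suc i) < 0"
      by (rule coords_signs(1)[OF k]) (use A C cnz that in auto)
    hence "twistor Z y (Suc i) i * twistor Z y (Suc i) (Suc (Suc i)) < 0"
      using prod[of "Suc i" i "Suc i" "Suc (Suc i)"] that by simp
    thus ?thesis using twistor_antisym[OF yc Zc, of i "Suc i"] that
      by (auto simp: sgn_if mult_less_0_iff zero_less_mult_iff)
  qed
  show "sgn (twistor Z y i (Suc i)) = sgn (twistor Z y 1 2)" if "1 \<le> i" "i < n" for i
    using that
  proof (induction i rule: dec_induct)
    case base show ?case by (simp add: numeral_2_eq_2)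
  next
    case (step i) thus ?case using \<open>\<And>i. 1 \<le> i \<Longrightarrow> Suc i < n \<Longrightarrow> _ i\<close>[of i] by simp
  qed
  have "card {d. 1 \<le> d \<and> Suc d < n \<and> coords k n ?A C 0 d * coords k n ?A C 0 (Suc d) < 0} = k"
    by (rule coords_signs(2)[OF k]) (use A C cnz in auto)
  moreover have "{d. 2 \<le> d \<and> d < n \<and> twistor Z y 1 d * twistor Z y 1 (Suc d) < 0} =
     Suc ` {d. 1 \<le> d \<and> Suc d < n \<and> coords k n ?A C 0 d * coords k n ?A C 0 (Suc d) < 0}"
  proof (rule Set.set_eqI)
    fix d
    show "d \<in> {d. 2 \<le> d \<and> d < n \<and> twistor Z y 1 d * twistor Z y 1 (Suc d) < 0} \<longleftrightarrow>
      d \<in> Suc ` {d. 1 \<le> d \<and> Suc d < n \<and> coords k n ?A C 0 d * coords k n ?A C 0 (Suc d) < 0}"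
      using prod[of 1 d 1 "Suc d"] by (cases d) auto
  qed
  ultimately show "card {d. 2 \<le> d \<and> d < n \<and> twistor Z y 1 d * twistor Z y 1 (Suc d) < 0} = k"
    by (simp add: card_image)
qed

lemma twistor_Pluecker:
  assumes "y \<in> carrier_mat k (k + 2)" "Z \<in> carrier_mat n (k + 2)"
    and "2 \<le> n" "twistor Z y 1 2 \<noteq> 0" "i \<in> {1..n}" "j \<in> {1..n}"
  shows "twistor Z y 1 2 * twistor Z y i j = twistor Z y 1 i * twistor Z y 2 j - twistor Z y 1 j * twistor Z y 2 i"
proof -
  let ?b = "\<lambda>i j. bracket k (\<lambda>r c. y $$ (r, c)) (\<lambda>c. Z $$ (i - 1, c)) (\<lambda>c. Z $$ (j - 1, c))"
  have tw: "twistor Z y i j = ?b i j" if "i \<in> {1..n}" "j \<in> {1..n}" for i j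
    using twistor_eq_bracket[OF assms(1,2) that] .
  have "?b 1 2 \<noteq> 0" using assms tw[of 1 2] by auto
  from bracket_Pluecker[OF this, of "\<lambda>c. Z $$ (i - 1, c)" "\<lambda>c. Z $$ (j - 1, c)"]
  have "?b 1 2 * ?b i j = ?b 1 j * ?b i 2 - ?b 2 j * ?b i 1" by simp
  also have "?b i 2 = - ?b 2 i" by (rule bracket_swap)
  also have "?b i 1 = - ?b 1 i" by (rule bracket_swap)
  finally show ?thesis using assms by (simp add: tw algebra_simps)
qed

lemma full_row_rankI:
  assumes M: "M \<in> carrier_mat k n" and f: "f \<in> selections k n"
    and nz: "max_minor k (\<lambda>r c. M $$ (r, c)) f \<noteq> 0"
  shows "full_row_rank k n M"
proof -
  interpret V: vec_space "TYPE(real)" k .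
  define B where "B = mat k k (\<lambda>(r, c). M $$ (r, f c))"
  have B: "B \<in> carrier_mat k k" and dB: "det B \<noteq> 0" using nz by (auto simp: B_def max_minor_def)
  have colB: "col B c = col M (f c)" if "c < k" for c
    using that selectionsD(1)[OF f that] M by (intro eq_vecI) (auto simp: B_def)
  have rB: "V.rank B = k" using V.det_rank_iff[OF B] dB by simp
  have dist: "distinct (cols B)"
    using V.non_distinct_low_rank[OF B] rB by auto
  have li: "V.lin_indpt (set (cols B))" by (rule V.full_rank_lin_indpt[OF B rB dist])
  have card: "card (set (cols B)) = k" using distinct_card[OF dist] B by simp
  have "set (cols B) \<subseteq> set (cols M)"
    using colB selectionsD(1)[OF f] M B by (auto simp: cols_def)
  hence "k \<le> V.rank M" using V.rank_ge_card_indpt[OF M _ li] card by simp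
  moreover have "V.rank M \<le> k"
  proof -
    obtain U where U: "maximal U (\<lambda>T. T \<subseteq> set (cols M) \<and> V.lin_indpt T)"
      using maximal_exists_superset[of "set (cols M)" "\<lambda>T. T \<subseteq> set (cols M) \<and> V.lin_indpt T" "{}"]
      by (auto simp: V.finite_lin_indpt2)
    hence U': "U \<subseteq> carrier_vec k" "V.lin_indpt U"
      using cols_dim[of M] M by (auto simp: maximal_def)
    show ?thesis using V.rank_card_indpt[OF M U] V.li_le_dim(2)[OF V.fin_dim U'] V.dim_is_n by simp
  qed
  ultimately show ?thesis using M by (simp add: full_row_rank_def)
qed

lemma represents_row_change:
  assumes y: "represents k m y Y" and E: "E \<in> carrier_mat k k" "det E \<noteq> 0"
  shows "represents k m (E * y) Y"
proof -
  have yc: "y \<in> carrier_mat k m" and rs: "row_span m y = Y"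
    using y by (auto simp: represents_def full_row_rank_def)
  have Ey: "E * y \<in> carrier_mat k m" using E yc by simp
  obtain f where f: "f \<in> selections k m" "max_minor k (\<lambda>r c. y $$ (r, c)) f \<noteq> 0"
    using full_row_rank_nonzero_minor y unfolding represents_def by metis
  have "mat k k (\<lambda>(r, c). (E * y) $$ (r, f c)) = E * mat k k (\<lambda>(r, c). y $$ (r, f c))"
    using E yc selectionsD(1)[OF f(1)] by (intro eq_matI) (auto simp: scalar_prod_def)
  hence "max_minor k (\<lambda>r c. (E * y) $$ (r, c)) f = det E * max_minor k (\<lambda>r c. y $$ (r, c)) f"
    using det_mult[OF E(1)] by (simp add: max_minor_def)
  hence fr: "full_row_rank k m (E * y)" using f E by (intro full_row_rankI[OF Ey f(1)]) simp
  have *: "(E * y)\<^sup>T *\<^sub>v x = y\<^sup>T *\<^sub>v (E\<^sup>T *\<^sub>v x)" if "x \<in> carrier_vec k" for x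
    unfolding transpose_mult[OF E(1) yc]
    by (rule assoc_mult_mat_vec[of _ m k _ k]) (use E yc that in auto)
  obtain G where G: "G \<in> carrier_mat k k" "E\<^sup>T * G = 1\<^sub>m k"
  proof -
    have "det E\<^sup>T \<noteq> 0" using E det_transpose[OF E(1)] by simp
    from det_non_zero_imp_unit[OF _ this, of k "()"] E
    show ?thesis using that by (auto simp: Units_def ring_mat_def)
  qed
  have surj: "(\<lambda>x. E\<^sup>T *\<^sub>v x) ` carrier_vec k = carrier_vec k"
  proof
    show "carrier_vec k \<subseteq> (\<lambda>x. E\<^sup>T *\<^sub>v x) ` carrier_vec k"
    proof
      fix b :: "real vec" assume b: "b \<in> carrier_vec k"
      have "E\<^sup>T *\<^sub>v (G *\<^sub>v b) = (E\<^sup>T * G) *\<^sub>v b"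
        by (rule assoc_mult_mat_vec[symmetric, of _ k k _ k]) (use E G b in auto)
      hence "b = E\<^sup>T *\<^sub>v (G *\<^sub>v b)" using G b by simp
      moreover have "G *\<^sub>v b \<in> carrier_vec k" using G b by simp
      ultimately show "b \<in> (\<lambda>x. E\<^sup>T *\<^sub>v x) ` carrier_vec k" by blast
    qed
  qed (use E in auto)
  have "row_span m (E * y) = (\<lambda>z. y\<^sup>T *\<^sub>v z) ` ((\<lambda>x. E\<^sup>T *\<^sub>v x) ` carrier_vec k)"
    unfolding row_span_image[OF Ey] image_image by (intro image_cong refl *)
  thus ?thesis using fr rs unfolding surj represents_def row_span_image[OF yc] by simp
qed

lemma represents_negate:
  assumes y: "represents k (k + 2) y Y" and k: "1 \<le> k" and Z: "Z \<in> carrier_mat n (k + 2)"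
  obtains y' where "represents k (k + 2) y' Y"
    "\<And>i j. i \<in> {1..n} \<Longrightarrow> j \<in> {1..n} \<Longrightarrow> twistor Z y' i j = - twistor Z y i j"
proof -
  define E :: "real mat" where "E = mat k k (\<lambda>(r, c). if r = c then if r = 0 then -1 else 1 else 0)"
  have E: "E \<in> carrier_mat k k" by (simp add: E_def)
  have "upper_triangular E" by (auto simp: E_def)
  hence "det E = prod_list (diag_mat E)" by (rule det_upper_triangular[OF _ E])
  also have "\<dots> = (\<Prod>i=0..<k. if i = 0 then -1 else 1)"
    unfolding prod_list_diag_prod using E by (intro prod.cong) (auto simp: E_def)
  also have "\<dots> = -1" using k by (simp add: prod.atLeast_Suc_lessThan)
  finally have dE: "det E = -1" .
  have yc: "y \<in> carrier_mat k (k + 2)" using y by (auto simp: represents_def full_row_rank_def)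
  have rep: "represents k (k + 2) (E * y) Y" by (rule represents_row_change[OF y E]) (simp add: dE)
  have Ey: "E * y \<in> carrier_mat k (k + 2)" using E yc by simp
  have "twistor Z (E * y) i j = - twistor Z y i j" if "i \<in> {1..n}" "j \<in> {1..n}" for i j
  proof -
    have "twistor Z (E * y) i j = det (mat k k (\<lambda>(r, s). E $$ (r, s))) * twistor Z y i j"
      unfolding twistor_eq_bracket[OF Ey Z that] twistor_eq_bracket[OF yc Z that]
      by (rule bracket_change_basis) (use E yc in \<open>simp add: scalar_prod_def lessThan_atLeast0\<close>)
    also have "mat k k (\<lambda>(r, s). E $$ (r, s)) = E" using E by (intro eq_matI) auto
    finally show ?thesis using dE by simp
  qed
  thus ?thesis using that rep by blast
qed

text \<open>Signs determine flips by \<open>Flip_word_sign\<close>. Conversely, the flips determine the signs in each row above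
  the diagonal from the entry next to the diagonal, and those entries agree up to a global sign for
  every point of the amplituhedron. The global sign can be changed by negating a row of the representative.\<close>
lemma chamber_eq_w_chamber:
  assumes k: "1 \<le> k" "k + 2 \<le> n" and w: "w \<in> D (k + 1) n" and \<epsilon>: "\<epsilon> \<in> {1, -1}"
    and \<sigma>: "\<And>i j. 1 \<le> i \<Longrightarrow> i < j \<Longrightarrow> j \<le> n \<Longrightarrow> \<sigma> i j = \<epsilon> * word_sign n w i j"
    and Z: "Z \<in> Mat_pos n (k + 2)"
  shows "chamber n k \<sigma> Z = w_chamber n k w Z"
proof -
  have n: "n \<ge> 3" using k by simp
  have w': "distinct w" "set w = {1..n}" "last w = n" "card (cDes_L n w) = k + 1"
    using w by (auto simp: D_iff)
  note W = n w'(1-3)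
  have Zc: "Z \<in> carrier_mat n (k + 2)" using Z by (simp add: Mat_pos_def)
  show ?thesis
  proof
    show "chamber n k \<sigma> Z \<subseteq> w_chamber n k w Z"
    proof
      fix Y assume "Y \<in> chamber n k \<sigma> Z"
      then obtain y where Y: "Y \<in> amplituhedron n k Z" "represents k (k + 2) y Y"
        and s: "\<And>i j. 1 \<le> i \<Longrightarrow> i < j \<Longrightarrow> j \<le> n \<Longrightarrow> sgn (twistor Z y i j) = \<sigma> i j"
        by (auto simp: chamber_def)
      have yc: "y \<in> carrier_mat k (k + 2)" using Y(2) by (auto simp: represents_def full_row_rank_def)
      have q: "sgn (twistor Z y i j) = \<epsilon> * word_sign n w i j" if ij: "i \<in> {1..n}" "j \<in> {1..n}" for i j
      proof -
        consider "i < j" | "i = j" | "j < i" by linarith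
        thus ?thesis
        proof cases
          case 1 thus ?thesis using s \<sigma> ij by simp
        next
          case 2
          have "twistor Z y i i = 0" using twistor_antisym[OF yc Zc ij(1) ij(1)] by simp
          thus ?thesis using 2 by (simp add: word_sign_def)
        next
          case 3
          thus ?thesis using s[of j i] \<sigma>[of j i] ij twistor_antisym[OF yc Zc ij(2,1)]
            word_sign_antisym[of n w j i] by (simp add: sgn_minus)
        qed
      qed
      have nz: "twistor Z y i j \<noteq> 0" if "i \<in> {1..n}" "j \<in> {1..n}" "i \<noteq> j" for i j
      proof
        assume "twistor Z y i j = 0"
        hence "\<epsilon> * word_sign n w i j = 0" using q[OF that(1,2)] by simp
        thus False using \<epsilon> word_sign_values[OF W that] by auto
      qed
      have "Flip n (\<lambda>j. if j < a then twistor_hat k Z y a j else twistor Z y a j) = I_set n w a - {a}"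
        if "a \<in> {1..n}" for a
        unfolding twistor_hat_def by (rule Flip_word_sign[OF W that w'(4) q \<epsilon>])
      thus "Y \<in> w_chamber n k w Z" unfolding w_chamber_def using Y nz by blast
    qed
  next
    show "w_chamber n k w Z \<subseteq> chamber n k \<sigma> Z"
    proof
      fix Y assume "Y \<in> w_chamber n k w Z"
      then obtain y0 where Y: "Y \<in> amplituhedron n k Z" and y0: "represents k (k + 2) y0 Y"
        and nz0: "\<And>i j. i \<in> {1..n} \<Longrightarrow> j \<in> {1..n} \<Longrightarrow> i \<noteq> j \<Longrightarrow> twistor Z y0 i j \<noteq> 0"
        and fl0: "\<And>a. a \<in> {1..n} \<Longrightarrow> Flip n (\<lambda>j. if j < a then twistor_hat k Z y0 a j else twistor Z y0 a j)
          = I_set n w a - {a}"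
        by (auto simp: w_chamber_def)
      obtain y where y: "represents k (k + 2) y Y"
        and same: "\<And>a i j. a \<in> {1..n} \<Longrightarrow> i \<in> {1..n} \<Longrightarrow> j \<in> {1..n} \<Longrightarrow>
           sgn (twistor Z y a i) = sgn (twistor Z y a j) \<longleftrightarrow> sgn (twistor Z y0 a i) = sgn (twistor Z y0 a j)"
        and nz: "\<And>i j. i \<in> {1..n} \<Longrightarrow> j \<in> {1..n} \<Longrightarrow> i \<noteq> j \<Longrightarrow> twistor Z y i j \<noteq> 0"
        and first: "sgn (twistor Z y 1 2) = \<epsilon>"
      proof (cases "sgn (twistor Z y0 1 2) = \<epsilon>")
        case True thus ?thesis using that[of y0] y0 nz0 by simp
      next
        case False
        have "twistor Z y0 1 2 \<noteq> 0" using nz0[of 1 2] n by simp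
        hence "sgn (twistor Z y0 1 2) = - \<epsilon>" using False \<epsilon> by (auto simp: sgn_if split: if_splits)
        moreover obtain y where "represents k (k + 2) y Y"
          "\<And>i j. i \<in> {1..n} \<Longrightarrow> j \<in> {1..n} \<Longrightarrow> twistor Z y i j = - twistor Z y0 i j"
          using represents_negate[OF y0 k(1) Zc] by metis
        ultimately show ?thesis using that[of y] nz0 n by (simp add: sgn_minus)
      qed
      have "sgn (twistor Z y a j) = \<epsilon> * word_sign n w a j" if aj: "1 \<le> a" "a < j" "j \<le> n" for a j
        using \<open>a < j\<close>[unfolded Suc_le_eq[symmetric]] \<open>j \<le> n\<close>
      proof (induction j rule: dec_induct)
        case base
        have "sgn (twistor Z y a (Suc a)) = sgn (twistor Z y 1 2)"
          by (rule amplituhedron_twistor_signs(1)[OF k Z Y y nz]) (use aj in auto)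
        thus ?case using first word_sign_consecutive[OF W, of a] aj by simp
      next
        case (step j)
        hence IH: "sgn (twistor Z y a j) = \<epsilon> * word_sign n w a j" by simp
        have a: "a \<in> {1..n}" and j: "j \<in> {1..n}" "Suc j \<in> {1..n}" "\<not> j < a" "j \<noteq> n" "j \<noteq> a" "Suc j \<noteq> a"
          using aj step by auto
        have "j \<in> Flip n (\<lambda>j. if j < a then twistor_hat k Z y0 a j else twistor Z y0 a j) \<longleftrightarrow>
          sgn (twistor Z y a j) \<noteq> sgn (twistor Z y a (Suc j))"
          using nz0[of a j] nz0[of a "Suc j"] a j same[OF a j(1,2)] by (auto simp: Flip_def Let_def)
        moreover have "j \<in> Flip n (\<lambda>j. if j < a then (-1) ^ (k + 1) * word_sign n w a j else word_sign n w a j) \<longleftrightarrow>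
          word_sign n w a j \<noteq> word_sign n w a (Suc j)"
          using word_sign_values[OF W a j(1)] word_sign_values[OF W a j(2)] j
          by (auto simp: Flip_def Let_def)
        moreover have "Flip n (\<lambda>j. if j < a then (-1) ^ (k + 1) * word_sign n w a j else word_sign n w a j)
          = I_set n w a - {a}"
        proof (rule Flip_word_sign[OF W a w'(4), where \<epsilon> = 1])
          show "sgn (word_sign n w i j) = 1 * word_sign n w i j" if "i \<in> {1..n}" "j \<in> {1..n}" for i j
            using word_sign_values[OF W that] by (cases "i = j") (auto simp: word_sign_def)
        qed simp
        ultimately have iff: "sgn (twistor Z y a j) \<noteq> sgn (twistor Z y a (Suc j)) \<longleftrightarrow>
          word_sign n w a j \<noteq> word_sign n w a (Suc j)" using fl0[OF a] by simp
        have pm: "sgn (twistor Z y a (Suc j)) \<in> {1, -1}"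
          using nz[of a "Suc j"] a j by (auto simp: sgn_if)
        show ?case
          using iff pm word_sign_values[OF W a j(1)] word_sign_values[OF W a j(2)] IH \<epsilon> j by auto
      qed
      hence "\<forall>i j. 1 \<le> i \<and> i < j \<and> j \<le> n \<longrightarrow> sgn (twistor Z y i j) = \<sigma> i j" using \<sigma> by auto
      thus "Y \<in> chamber n k \<sigma> Z" unfolding chamber_def using Y y by blast
    qed
  qed
qed

lemma realizable_word:
  assumes k: "1 \<le> k" "k + 2 \<le> n" and \<sigma>: "sign_vector n \<sigma>" "realizable n k \<sigma>"
  obtains w \<epsilon> where "w \<in> D (k + 1) n" "\<epsilon> \<in> {1, -1}"
    "\<And>i j. 1 \<le> i \<Longrightarrow> i < j \<Longrightarrow> j \<le> n \<Longrightarrow> \<sigma> i j = \<epsilon> * word_sign n w i j"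
proof -
  obtain Z Y y where Z: "Z \<in> Mat_pos n (k + 2)" and Y: "Y \<in> amplituhedron n k Z" "represents k (k + 2) y Y"
    and s: "\<And>i j. 1 \<le> i \<Longrightarrow> i < j \<Longrightarrow> j \<le> n \<Longrightarrow> sgn (twistor Z y i j) = \<sigma> i j"
    using \<sigma>(2) unfolding realizable_def chamber_def by blast
  have Zc: "Z \<in> carrier_mat n (k + 2)" using Z by (simp add: Mat_pos_def)
  have yc: "y \<in> carrier_mat k (k + 2)" using Y(2) by (auto simp: represents_def full_row_rank_def)
  let ?t = "twistor Z y"
  have nz: "?t i j \<noteq> 0" if "i \<in> {1..n}" "j \<in> {1..n}" "i \<noteq> j" for i j
  proof -
    have *: "?t i j \<noteq> 0" if "1 \<le> i" "i < j" "j \<le> n" for i j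
      using s[OF that] \<sigma>(1) that unfolding sign_vector_def by (metis insert_iff sgn_0 empty_iff zero_neq_neg_one zero_neq_one)
    show ?thesis using *[of i j] *[of j i] that twistor_antisym[OF yc Zc that(1,2)] by (cases "i < j") auto
  qed
  define \<epsilon> where "\<epsilon> = sgn (?t 1 2)"
  have \<epsilon>: "\<epsilon> \<in> {1, -1}" "\<epsilon> * \<epsilon> = 1" using nz[of 1 2] k by (auto simp: \<epsilon>_def sgn_if)
  define q where "q i j = (if i \<in> {1..n} \<and> j \<in> {1..n} then \<epsilon> * ?t i j else 0)" for i j
  obtain w where w: "w \<in> D (k + 1) n"
    "\<And>i j. i \<in> {1..n} \<Longrightarrow> j \<in> {1..n} \<Longrightarrow> sgn (q i j) = word_sign n w i j"
  proof (rule word_from_signs[of n q k])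
    show "n \<ge> 3" using k by simp
    show "q j i = - q i j" for i j using twistor_antisym[OF yc Zc, of i j] by (auto simp: q_def)
    show "q i j \<noteq> 0" if "i \<in> {1..n}" "j \<in> {1..n}" "i \<noteq> j" for i j
      using nz[OF that] \<epsilon> that by (auto simp: q_def)
    show "q 1 2 * q i j = q 1 i * q 2 j - q 1 j * q 2 i" if "i \<in> {1..n}" "j \<in> {1..n}" for i j
    proof -
      have "q 1 2 * q i j = (\<epsilon> * \<epsilon>) * (?t 1 2 * ?t i j)" using k that by (simp add: q_def)
      also have "?t 1 2 * ?t i j = ?t 1 i * ?t 2 j - ?t 1 j * ?t 2 i"
        by (rule twistor_Pluecker[OF yc Zc]) (use k nz[of 1 2] that in auto)
      finally show ?thesis using k that by (simp add: q_def algebra_simps)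
    qed
    show "q i (Suc i) > 0" if "1 \<le> i" "i < n" for i
    proof -
      have "sgn (?t i (Suc i)) = \<epsilon>" unfolding \<epsilon>_def
        by (rule amplituhedron_twistor_signs(1)[OF k Z Y nz]) (use that in auto)
      hence "sgn (q i (Suc i)) = 1" using that \<epsilon> by (auto simp: q_def sgn_mult)
      thus ?thesis by (simp add: sgn_1_pos)
    qed
    have "card {d. 2 \<le> d \<and> d < n \<and> ?t 1 d * ?t 1 (Suc d) < 0} = k"
      by (rule amplituhedron_twistor_signs(2)[OF k Z Y nz]) auto
    moreover have "q 1 d * q 1 (Suc d) = ?t 1 d * ?t 1 (Suc d)" if "2 \<le> d" "d < n" for d
    proof -
      have "q 1 d * q 1 (Suc d) = (\<epsilon> * \<epsilon>) * (?t 1 d * ?t 1 (Suc d))" using that by (simp add: q_def)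
      thus ?thesis using \<epsilon>(2) by simp
    qed
    ultimately show "card {d. 2 \<le> d \<and> d < n \<and> q 1 d * q 1 (Suc d) < 0} = k"
      by (metis (no_types, lifting) Collect_cong)
    fix w assume "w \<in> D (k + 1) n"
      "\<And>i j. i \<in> {1..n} \<Longrightarrow> j \<in> {1..n} \<Longrightarrow> sgn (q i j) = word_sign n w i j"
    thus thesis by (rule that)
  qed
  show ?thesis
  proof (rule that[OF w(1) \<epsilon>(1)])
    fix i j assume ij: "1 \<le> i" "i < j" "j \<le> n"
    have "sgn (q i j) = \<epsilon> * sgn (?t i j)" using ij \<epsilon> by (auto simp: q_def sgn_mult)
    hence "\<epsilon> * word_sign n w i j = (\<epsilon> * \<epsilon>) * sgn (?t i j)" using w(2)[of i j] ij by simp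
    thus "\<sigma> i j = \<epsilon> * word_sign n w i j" using s[OF ij] \<epsilon>(2) by simp
  qed
qed

section \<open>Determinants of polynomial values and of staircase matrices\<close>

lemma degree_ge_increasing_roots:
  fixes q :: "real poly"
  assumes "q \<noteq> 0" and "\<And>l. l < m \<Longrightarrow> poly q (\<rho> l) = 0"
    and "\<And>l l'. l < l' \<Longrightarrow> l' < m \<Longrightarrow> \<rho> l < \<rho> l'"
  shows "m \<le> degree q"
proof -
  have "inj_on \<rho> {..<m}"
    using assms(3) by (intro linorder_inj_onI) (auto simp: less_imp_neq)
  hence "m = card (\<rho> ` {..<m})" by (simp add: card_image)
  also have "\<dots> \<le> card {x. poly q x = 0}"
    using assms(1,2) by (intro card_mono poly_roots_finite) auto
  also have "\<dots> \<le> degree q" by (rule card_poly_roots_bound[OF assms(1)])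
  finally show ?thesis .
qed

text \<open>Generalized Vandermonde determinants. As a function of the last point, the determinant is a polynomial
  of degree \<open>m - 1\<close> that vanishes at the other \<open>m - 1\<close> points, and its leading coefficient is positive by
  induction. So it cannot be zero or negative to the right of them.\<close>
lemma det_graded_polys_pos:
  fixes B :: "nat \<Rightarrow> real poly" and t :: "nat \<Rightarrow> real"
  assumes "\<And>r. r < m \<Longrightarrow> degree (B r) = r \<and> lead_coeff (B r) > 0"
    and "\<And>c d. c < d \<Longrightarrow> d < m \<Longrightarrow> t c < t d"
  shows "det (mat m m (\<lambda>(r, c). poly (B r) (t c))) > 0"
  using assms
proof (induction m)
  case (Suc m)
  have IH: "det (mat m m (\<lambda>(r, c). poly (B r) (t c))) > 0"
  proof (rule Suc.IH)
    show "degree (B r) = r \<and> lead_coeff (B r) > 0" if "r < m" for r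
      by (rule Suc.prems(1)) (use that in simp)
  qed (use Suc.prems(2) in auto)
  define M where "M = mat (Suc m) (Suc m) (\<lambda>(r, c). poly (B r) (t c))"
  define q where "q = (\<Sum>r<Suc m. Polynomial.smult (cofactor M r m) (B r))"
  have eval: "det (mat (Suc m) (Suc m) (\<lambda>(r, c). poly (B r) (if c = m then s else t c))) = poly q s"
    (is "det ?N = _") for s
  proof -
    have "mat_delete ?N r m = mat_delete M r m" if "r < Suc m" for r
      using that by (intro eq_matI) (auto simp: mat_delete_def M_def)
    hence cof: "cofactor ?N r m = cofactor M r m" if "r < Suc m" for r
      using that by (simp add: cofactor_def)
    have "det ?N = (\<Sum>r<Suc m. ?N $$ (r, m) * cofactor ?N r m)"
      by (rule laplace_expansion_column) auto
    also have "\<dots> = (\<Sum>r<Suc m. poly (Polynomial.smult (cofactor M r m) (B r)) s)"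
      by (intro sum.cong refl) (simp add: cof[simplified])
    finally show ?thesis unfolding q_def poly_sum .
  qed
  have "mat (Suc m) (Suc m) (\<lambda>(r, c). poly (B r) (if c = m then t m else t c)) = M"
    unfolding M_def by (intro eq_matI) auto
  hence detM: "det M = poly q (t m)" using eval[of "t m"] by simp
  have roots: "poly q (t c) = 0" if "c < m" for c
    unfolding eval[symmetric]
    by (rule det_identical_columns[of _ "Suc m" c m]) (use that in \<open>auto intro!: eq_vecI\<close>)
  have dq: "degree q \<le> m" unfolding q_def
    by (intro degree_sum_le) (use Suc.prems(1) in \<open>auto intro: order_trans[OF degree_smult_le]\<close>)
  have "mat_delete M m m = mat m m (\<lambda>(r, c). poly (B r) (t c))"
    by (intro eq_matI) (auto simp: mat_delete_def M_def)
  hence cof: "cofactor M m m > 0" using IH by (simp add: cofactor_def)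
  have "coeff q m = (\<Sum>r<m. cofactor M r m * coeff (B r) m) + cofactor M m m * coeff (B m) m"
    unfolding q_def coeff_sum by simp
  also have "(\<Sum>r<m. cofactor M r m * coeff (B r) m) = 0"
    using Suc.prems(1) by (intro sum.neutral) (auto simp: coeff_eq_0)
  finally have "coeff q m = cofactor M m m * coeff (B m) m" by simp
  moreover have "coeff (B m) m > 0" using Suc.prems(1) by (metis lessI)
  ultimately have cq: "coeff q m > 0" using cof by simp
  hence q: "q \<noteq> 0" "degree q = m" using dq le_degree[of q m] by auto
  have "poly q (t m) > 0"
  proof (rule ccontr)
    assume n: "\<not> poly q (t m) > 0"
    obtain s where s: "s \<ge> t m" "poly q s = 0"
    proof (cases "poly q (t m) = 0")
      case True thus ?thesis using that[of "t m"] by simp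
    next
      case False
      obtain N where N: "\<And>x. x \<ge> N \<Longrightarrow> lead_coeff q \<le> poly q x"
        using poly_pinfty_gt_lc[of q] cq q by auto
      define z where "z = max N (t m + 1)"
      have "poly q z > 0" using N[of z] cq q by (simp add: z_def)
      moreover have "t m < z" by (simp add: z_def)
      ultimately obtain s where "t m < s" "poly q s = 0"
        using poly_IVT_pos[of "t m" z q] n False by force
      thus ?thesis using that[of s] by simp
    qed
    have "Suc m \<le> degree q"
    proof (rule degree_ge_increasing_roots[OF q(1)])
      fix l assume "l < Suc m"
      thus "poly q (if l = m then s else t l) = 0" using s roots by auto
    next
      fix l l' assume "l < l'" "l' < Suc m"
      thus "(if l = m then s else t l) < (if l' = m then s else t l')"
        using s(1) Suc.prems(2)[of l l'] by auto
    qed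
    thus False using q by simp
  qed
  thus ?case using detM by (simp add: M_def)
qed simp

lemma selection_id_unique:
  assumes "f \<in> selections m m" "c < m" shows "f c = c"
proof -
  have "f ` {..<m} \<subseteq> {..<m}" "card (f ` {..<m}) = card {..<m}"
    using selection_image[OF assms(1)] by auto
  hence "f ` {..<m} = {..<m}" by (intro card_subset_eq) auto
  moreover have "id \<in> selections m m" by (intro selectionsI) auto
  ultimately show ?thesis
    using pick_selection[OF assms] pick_selection[of id m m c] assms(2) by simp
qed

text \<open>In the expansion over permutations \<open>\<pi>\<close>, a nonzero term forces \<open>\<pi>\<close> to be increasing, hence trivial.\<close>
lemma det_monotone_support:
  fixes A :: "real mat"
  assumes A: "A \<in> carrier_mat m m"
    and mono: "\<And>l l' p p'. l < l' \<Longrightarrow> l' < m \<Longrightarrow> p < m \<Longrightarrow> p' < m \<Longrightarrow>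
      A $$ (l, p) \<noteq> 0 \<Longrightarrow> A $$ (l', p') \<noteq> 0 \<Longrightarrow> p \<le> p'"
  shows "det A = (\<Prod>l<m. A $$ (l, l))"
proof -
  have zero: "(\<Prod>l=0..<m. A $$ (l, \<pi> l)) = 0" if \<pi>: "\<pi> permutes {0..<m}" "\<pi> \<noteq> id" for \<pi>
  proof (rule ccontr)
    assume nz: "(\<Prod>l=0..<m. A $$ (l, \<pi> l)) \<noteq> 0"
    have lt: "\<pi> l < m" if "l < m" for l using permutes_in_image[OF \<pi>(1), of l] that by simp
    have "\<pi> \<in> selections m m"
    proof (rule selectionsI[OF lt])
      fix c d assume cd: "c < d" "d < m"
      have "A $$ (c, \<pi> c) \<noteq> 0" "A $$ (d, \<pi> d) \<noteq> 0" using nz cd by auto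
      hence "\<pi> c \<le> \<pi> d" using mono[OF cd lt lt] cd by simp
      moreover have "\<pi> c \<noteq> \<pi> d" using permutes_inj[OF \<pi>(1)] cd by (metis injD less_irrefl)
      ultimately show "\<pi> c < \<pi> d" by simp
    qed
    hence "\<pi> c = c" for c
      using selection_id_unique[of \<pi> m c] permutes_not_in[OF \<pi>(1), of c] by (cases "c < m") auto
    thus False using \<pi>(2) by auto
  qed
  have "det A = (\<Sum>\<pi>\<in>{\<pi>. \<pi> permutes {0..<m}}. signof \<pi> * (\<Prod>l=0..<m. A $$ (l, \<pi> l)))"
    by (rule det_def'[OF A])
  also have "\<dots> = (\<Sum>\<pi>\<in>{id}. signof \<pi> * (\<Prod>l=0..<m. A $$ (l, \<pi> l)))"
    by (intro sum.mono_neutral_right) (auto simp: finite_permutations permutes_id zero)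
  finally show ?thesis by (simp add: lessThan_atLeast0 sign_id)
qed

lemma det_2x2:
  fixes A :: "real mat"
  assumes A: "A \<in> carrier_mat 2 2"
  shows "det A = A $$ (0, 0) * A $$ (1, 1) - A $$ (0, 1) * A $$ (1, 0)"
proof -
  have "det A = (\<Sum>j<2. A $$ (0, j) * cofactor A 0 j)" by (rule laplace_expansion_row[OF A]) simp
  also have "\<dots> = A $$ (0, 0) * cofactor A 0 0 + A $$ (0, 1) * cofactor A 0 1"
    by (simp add: numeral_2_eq_2)
  also have "cofactor A 0 0 = A $$ (1, 1)"
    unfolding cofactor_def by (subst det_single) (use A in \<open>auto simp: mat_delete_def\<close>)
  also have "cofactor A 0 1 = - A $$ (1, 0)"
    unfolding cofactor_def by (subst det_single) (use A in \<open>auto simp: mat_delete_def\<close>)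
  finally show ?thesis by simp
qed

lemma bracket_unit_rows:
  "bracket k (\<lambda>r c. if r = c then 1 else 0) a b = a k * b (k + 1) - a (k + 1) * b k"
proof -
  let ?M = "mat (k + 2) (k + 2) (\<lambda>(r, c). if r < k then if r = c then 1 else 0 else if r = k then a c else b c)"
  let ?L = "mat 2 k (\<lambda>(r, c). if r = 0 then a c else b c)"
  let ?R = "mat 2 2 (\<lambda>(r, c). if r = 0 then a (k + c) else b (k + c))"
  have "?M = four_block_mat (1\<^sub>m k) (0\<^sub>m k 2) ?L ?R"
    by (rule eq_matI) auto
  hence "det ?M = det ?R"
    using det_four_block_mat_upper_right_zero[of "1\<^sub>m k" k "0\<^sub>m k 2" 2 ?L ?R] by simp
  also have "\<dots> = a k * b (k + 1) - a (k + 1) * b k"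
    by (subst det_2x2) auto
  finally show ?thesis by (simp add: bracket_def)
qed

text \<open>Real and imaginary part of \<open>(X + i)\<^sup>m\<close>, as real polynomials.\<close>
primrec powers_of_X_plus_i :: "nat \<Rightarrow> real poly \<times> real poly" where
  "powers_of_X_plus_i 0 = (1, 0)"
| "powers_of_X_plus_i (Suc m) =
     (pCons 0 (fst (powers_of_X_plus_i m)) - snd (powers_of_X_plus_i m),
      fst (powers_of_X_plus_i m) + pCons 0 (snd (powers_of_X_plus_i m)))"

lemma powers_of_X_plus_i_coeffs:
  "(\<forall>i>m. coeff (fst (powers_of_X_plus_i m)) i = 0) \<and> coeff (fst (powers_of_X_plus_i m)) m = 1 \<and>
   (\<forall>i\<ge>m. coeff (snd (powers_of_X_plus_i m)) i = 0) \<and>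
   (m \<ge> 1 \<longrightarrow> coeff (snd (powers_of_X_plus_i m)) (m - 1) = real m)"
proof (induction m)
  case (Suc m)
  show ?case
  proof (intro conjI allI impI)
    show "coeff (snd (powers_of_X_plus_i (Suc m))) (Suc m - 1) = real (Suc m)"
      using Suc.IH by (cases m) (auto simp: coeff_pCons split: nat.splits)
  qed (use Suc.IH in \<open>auto simp: coeff_pCons split: nat.splits\<close>)
qed (auto simp: coeff_1)

lemma powers_of_X_plus_i_degree:
  "degree (fst (powers_of_X_plus_i m)) = m" "lead_coeff (fst (powers_of_X_plus_i m)) = 1"
  "degree (snd (powers_of_X_plus_i (Suc m))) = m" "lead_coeff (snd (powers_of_X_plus_i (Suc m))) = real (Suc m)"
proof -
  note c = powers_of_X_plus_i_coeffs
  have "degree (fst (powers_of_X_plus_i m)) \<le> m" using c[of m] by (intro degree_le) auto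
  moreover have "m \<le> degree (fst (powers_of_X_plus_i m))" using c[of m] by (intro le_degree) auto
  ultimately show 1: "degree (fst (powers_of_X_plus_i m)) = m" by simp
  thus "lead_coeff (fst (powers_of_X_plus_i m)) = 1" using c[of m] by simp
  have "degree (snd (powers_of_X_plus_i (Suc m))) \<le> m" using c[of "Suc m"] by (intro degree_le) auto
  moreover have "m \<le> degree (snd (powers_of_X_plus_i (Suc m)))"
    using c[of "Suc m"] by (intro le_degree) auto
  ultimately show 2: "degree (snd (powers_of_X_plus_i (Suc m))) = m" by simp
  thus "lead_coeff (snd (powers_of_X_plus_i (Suc m))) = real (Suc m)" using c[of "Suc m"] by simp
qed

text \<open>De Moivre's formula, since \<open>sin a (cot a + i) = cos a + i sin a\<close>.\<close>
lemma powers_of_X_plus_i_cot: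
  assumes "sin a \<noteq> 0"
  shows "sin a ^ m * poly (fst (powers_of_X_plus_i m)) (cot a) = cos (real m * a)"
    and "sin a ^ m * poly (snd (powers_of_X_plus_i m)) (cot a) = sin (real m * a)"
proof (induction m)
  case (Suc m)
  let ?F = "poly (fst (powers_of_X_plus_i m)) (cot a)" and ?G = "poly (snd (powers_of_X_plus_i m)) (cot a)"
  have sc: "sin a * cot a = cos a" using assms by (simp add: cot_def)
  have "sin a ^ Suc m * poly (fst (powers_of_X_plus_i (Suc m))) (cot a) =
    (sin a * cot a) * (sin a ^ m * ?F) - sin a * (sin a ^ m * ?G)" by (simp add: algebra_simps)
  also have "\<dots> = cos (real (Suc m) * a)"
    unfolding sc Suc.IH by (simp add: cos_add algebra_simps)
  finally show "sin a ^ Suc m * poly (fst (powers_of_X_plus_i (Suc m))) (cot a) = cos (real (Suc m) * a)" .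
  have "sin a ^ Suc m * poly (snd (powers_of_X_plus_i (Suc m))) (cot a) =
    sin a * (sin a ^ m * ?F) + (sin a * cot a) * (sin a ^ m * ?G)" by (simp add: algebra_simps)
  also have "\<dots> = sin (real (Suc m) * a)"
    unfolding sc Suc.IH by (simp add: sin_add algebra_simps)
  finally show "sin a ^ Suc m * poly (snd (powers_of_X_plus_i (Suc m))) (cot a) = sin (real (Suc m) * a)" .
qed simp_all

section \<open>A point of the amplituhedron for every word\<close>

text \<open>Each relation yields a root of \<open>q\<close>. If \<open>q (x 0) = 0\<close>, the polynomial vanishes somewhere in the half-open
  interval from \<open>x (\<iota> l)\<close> to \<open>x (\<iota> l + 1)\<close>, and these intervals are disjoint. Otherwise one of these two
  points has a value of sign opposite to \<open>(-1)\<^sup>l q (x 0)\<close>; with \<open>x 0\<close>, this gives \<open>k + 1\<close> points of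
  alternating sign.\<close>
lemma alternating_relations_force_degree:
  fixes q :: "real poly" and x :: "nat \<Rightarrow> real" and \<iota> :: "nat \<Rightarrow> nat"
  assumes x: "\<And>i j. i < j \<Longrightarrow> j < n \<Longrightarrow> x i < x j"
    and \<iota>: "\<And>l. l < k \<Longrightarrow> 1 \<le> \<iota> l \<and> Suc (\<iota> l) < n" "\<And>l l'. l < l' \<Longrightarrow> l' < k \<Longrightarrow> \<iota> l < \<iota> l'"
    and abc: "\<And>l. l < k \<Longrightarrow> a l > 0 \<and> b l > 0 \<and> c l > 0"
    and rel: "\<And>l. l < k \<Longrightarrow>
      (-1) ^ l * a l * poly q (x 0) + b l * poly q (x (\<iota> l)) + c l * poly q (x (Suc (\<iota> l))) = 0"
    and q: "q \<noteq> 0"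
  shows "k \<le> degree q"
proof -
  have gap: "x (Suc (\<iota> l)) \<le> x (\<iota> l')" if "l < l'" "l' < k" for l l'
    using x[of "Suc (\<iota> l)" "\<iota> l'"] \<iota>(2)[OF that] \<iota>(1)[of l'] that by (cases "Suc (\<iota> l) = \<iota> l'") auto
  have wide: "x (\<iota> l) < x (Suc (\<iota> l))" "x 0 < x (\<iota> l)" if "l < k" for l
    using x[of "\<iota> l" "Suc (\<iota> l)"] x[of 0 "\<iota> l"] \<iota>(1)[OF that] by auto
  show ?thesis
  proof (cases "poly q (x 0) = 0")
    case True
    have "\<exists>r. x (\<iota> l) < r \<and> r \<le> x (Suc (\<iota> l)) \<and> poly q r = 0" if l: "l < k" for l
    proof (cases "poly q (x (\<iota> l)) = 0")
      case True
      hence "poly q (x (Suc (\<iota> l))) = 0" using rel[OF l] \<open>poly q (x 0) = 0\<close> abc[OF l] by simp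
      thus ?thesis using wide[OF l] by auto
    next
      case False
      have e: "poly q (x (Suc (\<iota> l))) = - (b l / c l) * poly q (x (\<iota> l))"
        using rel[OF l] True abc[OF l] by (simp add: field_simps)
      have "poly q (x (\<iota> l)) * poly q (x (Suc (\<iota> l))) = - ((b l / c l) * (poly q (x (\<iota> l)))\<^sup>2)"
        unfolding e by (simp add: power2_eq_square)
      also have "\<dots> < 0" using False abc[OF l] by simp
      finally obtain r where "r > x (\<iota> l)" "r < x (Suc (\<iota> l))" "poly q r = 0"
        using poly_IVT[OF wide(1)[OF l], of q] by auto
      thus ?thesis by (auto intro!: exI[of _ r])
    qed
    then obtain \<rho> where \<rho>: "\<And>l. l < k \<Longrightarrow> x (\<iota> l) < \<rho> l \<and> \<rho> l \<le> x (Suc (\<iota> l)) \<and> poly q (\<rho> l) = 0"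
      by metis
    show ?thesis
    proof (rule degree_ge_increasing_roots[OF q])
      fix l l' assume "l < l'" "l' < k"
      thus "\<rho> l < \<rho> l'" using gap[of l l'] \<rho>[of l] \<rho>[of l'] by auto
    qed (use \<rho> in auto)
  next
    case q0: False
    define q0 where "q0 = poly q (x 0)"
    have q0nz: "q0 \<noteq> 0" using q0 by (simp add: q0_def)
    have "\<exists>z. (z = x (\<iota> l) \<or> z = x (Suc (\<iota> l))) \<and> (-1) ^ l * q0 * poly q z < 0" if l: "l < k" for l
    proof (rule ccontr)
      assume "\<not> ?thesis"
      hence nn: "(-1) ^ l * q0 * poly q (x (\<iota> l)) \<ge> 0" "(-1) ^ l * q0 * poly q (x (Suc (\<iota> l))) \<ge> 0"
        by (auto simp: not_less)
      have "0 = (-1) ^ l * q0 * ((-1) ^ l * a l * q0 + b l * poly q (x (\<iota> l)) + c l * poly q (x (Suc (\<iota> l))))"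
        using rel[OF l] by (simp add: q0_def)
      also have "\<dots> = ((-1) ^ l * (-1) ^ l) * a l * q0\<^sup>2 + b l * ((-1) ^ l * q0 * poly q (x (\<iota> l)))
         + c l * ((-1) ^ l * q0 * poly q (x (Suc (\<iota> l))))"
        by (simp only: algebra_simps power2_eq_square)
      also have "((-1) ^ l * (-1) ^ l :: real) = 1" by (simp flip: power_add)
      finally have "0 = a l * q0\<^sup>2 + b l * ((-1) ^ l * q0 * poly q (x (\<iota> l)))
         + c l * ((-1) ^ l * q0 * poly q (x (Suc (\<iota> l))))" by simp
      moreover have "a l * q0\<^sup>2 > 0" using abc[OF l] q0nz by simp
      moreover have "b l * ((-1) ^ l * q0 * poly q (x (\<iota> l))) \<ge> 0"
        "c l * ((-1) ^ l * q0 * poly q (x (Suc (\<iota> l)))) \<ge> 0"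
        using abc[OF l] nn by (auto intro!: mult_nonneg_nonneg simp del: mult_nonneg_nonneg)
      ultimately show False by linarith
    qed
    then obtain y where y: "\<And>l. l < k \<Longrightarrow> y l = x (\<iota> l) \<or> y l = x (Suc (\<iota> l))"
      "\<And>l. l < k \<Longrightarrow> (-1) ^ l * q0 * poly q (y l) < 0" by metis
    have ymono: "y l \<le> y l'" if "l \<le> l'" "l' < k" for l l'
    proof (cases "l = l'")
      case False
      thus ?thesis using y(1)[of l] y(1)[of l'] gap[of l l'] wide(1)[of l] wide(1)[of l'] that by auto
    qed simp
    define prev where "prev l = (if l = 0 then x 0 else y (l - 1))" for l
    have opp: "poly q (prev l) * poly q (y l) < 0" if l: "l < k" for l
    proof (cases l)
      case 0 thus ?thesis using y(2)[OF l] by (simp add: prev_def q0_def)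
    next
      case (Suc l')
      define s :: real where "s = (-1) ^ l' * q0"
      have s: "s * poly q (y l') < 0" "s * poly q (y l) > 0"
        using y(2)[of l'] y(2)[OF l] l by (auto simp: Suc s_def)
      thus ?thesis by (simp add: prev_def Suc mult_less_0_iff zero_less_mult_iff) linarith
    qed
    have "prev l < y l" if l: "l < k" for l
    proof -
      have "prev l \<le> y l"
        using ymono[of "l - 1" l] y(1)[OF l] wide[OF l] l by (auto simp: prev_def)
      moreover have "prev l \<noteq> y l" using opp[OF l] by (auto simp: mult_less_0_iff)
      ultimately show ?thesis by simp
    qed
    hence "\<exists>r. prev l < r \<and> r < y l \<and> poly q r = 0" if "l < k" for l
      using poly_IVT[of "prev l" "y l" q] opp that by auto
    then obtain \<rho> where \<rho>: "\<And>l. l < k \<Longrightarrow> prev l < \<rho> l \<and> \<rho> l < y l \<and> poly q (\<rho> l) = 0" by metis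
    show ?thesis
    proof (rule degree_ge_increasing_roots[OF q])
      fix l l' assume ll: "l < l'" "l' < k"
      have "\<rho> l < y l" using \<rho> ll by auto
      also have "y l \<le> y (l' - 1)" using ll by (intro ymono) auto
      also have "y (l' - 1) = prev l'" using ll by (simp add: prev_def)
      also have "prev l' < \<rho> l'" using \<rho> ll by auto
      finally show "\<rho> l < \<rho> l'" .
    qed (use \<rho> in auto)
  qed
qed

text \<open>Without the column \<open>0\<close>, the support of the rows moves to the right and all minors are products of
  diagonal entries. If the column \<open>0\<close> is selected, the Laplace expansion along it has nonnegative terms
  because of the alternating signs.\<close>
lemma staircase_minors_nonneg:
  fixes K :: "nat \<Rightarrow> nat \<Rightarrow> real"
  assumes \<iota>: "\<And>l l'. l < l' \<Longrightarrow> l' < k \<Longrightarrow> \<iota> l < \<iota> l'"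
    and supp: "\<And>l j. l < k \<Longrightarrow> j \<noteq> 0 \<Longrightarrow> K l j \<noteq> 0 \<Longrightarrow> j = \<iota> l \<or> j = Suc (\<iota> l)"
    and pos: "\<And>l j. l < k \<Longrightarrow> j \<noteq> 0 \<Longrightarrow> K l j \<ge> 0"
    and first: "\<And>l. l < k \<Longrightarrow> (-1) ^ l * K l 0 \<ge> 0"
    and f: "f \<in> selections k n"
  shows "max_minor k K f \<ge> 0"
proof (cases "k = 0 \<or> f 0 \<noteq> 0")
  case True
  have f0: "f c \<noteq> 0" if "c < k" for c
    using selectionsD(2)[OF f, of 0 c] that True by (cases "c = 0") auto
  have "max_minor k K f = (\<Prod>l<k. mat k k (\<lambda>(r, c). K r (f c)) $$ (l, l))"
    unfolding max_minor_def
  proof (rule det_monotone_support)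
    fix l l' p p'
    assume l: "l < l'" "l' < k" and p: "p < k" "p' < k"
      and nz: "mat k k (\<lambda>(r, c). K r (f c)) $$ (l, p) \<noteq> 0" "mat k k (\<lambda>(r, c). K r (f c)) $$ (l', p') \<noteq> 0"
    have "f p = \<iota> l \<or> f p = Suc (\<iota> l)" using supp[of l "f p"] f0 nz l p by auto
    moreover have "f p' = \<iota> l' \<or> f p' = Suc (\<iota> l')" using supp[of l' "f p'"] f0 nz l p by auto
    ultimately have "f p \<le> f p'" using \<iota>[OF l] by auto
    thus "p \<le> p'" using selectionsD(2)[OF f, of p' p] p by (meson leD not_le)
  qed simp
  also have "\<dots> \<ge> 0" using pos f0 by (intro prod_nonneg) auto
  finally show ?thesis .
next
  case False
  then obtain m where k: "k = Suc m" and f00: "f 0 = 0" by (cases k) auto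
  let ?M = "mat k k (\<lambda>(r, c). K r (f c))"
  have f0: "f (Suc c) \<noteq> 0" if "Suc c < k" for c
    using selectionsD(2)[OF f, of 0 "Suc c"] that by auto
  have "max_minor k K f = (\<Sum>l<k. ?M $$ (l, 0) * cofactor ?M l 0)"
    unfolding max_minor_def by (rule laplace_expansion_column) (use k in auto)
  also have "\<dots> \<ge> 0"
  proof (intro sum_nonneg)
    fix l assume "l \<in> {..<k}"
    hence l: "l < k" by simp
    let ?D = "mat_delete ?M l 0"
    define r where "r i = (if i < l then i else Suc i)" for i
    have D: "?D = mat m m (\<lambda>(i, c). K (r i) (f (Suc c)))"
      using l by (intro eq_matI) (auto simp: mat_delete_def r_def k)
    have De: "?D $$ (i, p) = K (r i) (f (Suc p))" if "i < m" "p < m" for i p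
      unfolding D using that by simp
    have rk: "r i < k" if "i < m" for i using that by (auto simp: r_def k)
    have rmono: "r i < r i'" if "i < i'" for i i' using that by (auto simp: r_def)
    have "det ?D = (\<Prod>i<m. ?D $$ (i, i))"
    proof (rule det_monotone_support)
      show "?D \<in> carrier_mat m m" unfolding D by simp
      fix i i' p p'
      assume i: "i < i'" "i' < m" and p: "p < m" "p' < m" and nz: "?D $$ (i, p) \<noteq> 0" "?D $$ (i', p') \<noteq> 0"
      have "f (Suc p) = \<iota> (r i) \<or> f (Suc p) = Suc (\<iota> (r i))"
        using supp[OF rk, of i "f (Suc p)"] f0[of p] nz(1) De[of i p] i p k by auto
      moreover have "f (Suc p') = \<iota> (r i') \<or> f (Suc p') = Suc (\<iota> (r i'))"
        using supp[OF rk, of i' "f (Suc p')"] f0[of p'] nz(2) De[of i' p'] i p k by auto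
      ultimately have "f (Suc p) \<le> f (Suc p')" using \<iota>[OF rmono[OF i(1)] rk[OF i(2)]] by auto
      thus "p \<le> p'" using selectionsD(2)[OF f, of "Suc p'" "Suc p"] p k by (meson Suc_less_eq leD not_le)
    qed
    also have "\<dots> \<ge> 0" unfolding D using pos f0 rk k by (intro prod_nonneg) auto
    finally have "det ?D \<ge> 0" .
    hence "((-1) ^ l * K l 0) * det ?D \<ge> 0" using first[OF l] by (rule mult_nonneg_nonneg[rotated])
    thus "?M $$ (l, 0) * cofactor ?M l 0 \<ge> 0" using l f00 k by (simp add: cofactor_def mult_ac)
  qed
  finally show ?thesis .
qed

text \<open>The point is the span of the first \<open>k\<close> unit vectors, so that its brackets are the \<open>2 \<times> 2\<close>
  determinants formed from the last two columns of \<open>Z\<close>. It remains to write it as \<open>CZ\<close>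
  where \<open>C\<close> has nonnegative maximal minors.\<close>
lemma polynomial_configuration_in_amplituhedron:
  fixes F G :: "real poly" and x :: "nat \<Rightarrow> real"
  assumes k: "1 \<le> k" "k + 2 \<le> n"
    and F: "degree F = k + 1" "lead_coeff F > 0" and G: "degree G = k" "lead_coeff G > 0"
    and x: "\<And>i j. i < j \<Longrightarrow> j < n \<Longrightarrow> x i < x j"
  defines "p i j \<equiv> poly G (x i) * poly F (x j) - poly G (x j) * poly F (x i)"
  assumes pos: "\<And>i. Suc i < n \<Longrightarrow> p i (Suc i) > 0"
    and nz: "\<And>j. 1 \<le> j \<Longrightarrow> j < n \<Longrightarrow> p 0 j \<noteq> 0"
    and flips: "card {d. 1 \<le> d \<and> Suc d < n \<and> p 0 d * p 0 (Suc d) < 0} = k"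
  shows "\<exists>Z Y y. Z \<in> Mat_pos n (k + 2) \<and> Y \<in> amplituhedron n k Z \<and> represents k (k + 2) y Y \<and>
     (\<forall>i\<in>{1..n}. \<forall>j\<in>{1..n}. twistor Z y i j = p (i - 1) (j - 1))"
proof -
  define B where "B c = (if c < k then monom 1 c else if c = k then G else F)" for c
  have B: "degree (B r) = r \<and> lead_coeff (B r) > 0" if "r < k + 2" for r
  proof -
    consider "r < k" | "r = k" | "r = k + 1" using \<open>r < k + 2\<close> by linarith
    thus ?thesis using F G by cases (auto simp: B_def degree_monom_eq)
  qed
  define Z where "Z = mat n (k + 2) (\<lambda>(j, c). poly (B c) (x j))"
  have Zc: "Z \<in> carrier_mat n (k + 2)" by (simp add: Z_def)
  have Z: "Z \<in> Mat_pos n (k + 2)"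
    unfolding Mat_pos_iff[OF Zc]
  proof
    fix f assume f: "f \<in> selections (k + 2) n"
    have "mat (k + 2) (k + 2) (\<lambda>(r, c). Z $$ (f c, r)) = mat (k + 2) (k + 2) (\<lambda>(r, c). poly (B r) (x (f c)))"
      by (rule eq_matI) (use selectionsD(1)[OF f] in \<open>auto simp: Z_def\<close>)
    thus "max_minor (k + 2) (\<lambda>r c. Z $$ (c, r)) f > 0"
      unfolding max_minor_def
      using det_graded_polys_pos[of "k + 2" B "\<lambda>c. x (f c)", OF B] x selectionsD[OF f] by simp
  qed
  define y :: "real mat" where "y = mat k (k + 2) (\<lambda>(r, c). if r = c then 1 else 0)"
  define Y where "Y = row_span (k + 2) y"
  have yc: "y \<in> carrier_mat k (k + 2)" by (simp add: y_def)
  have y: "represents k (k + 2) y Y"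
  proof -
    have "mat k k (\<lambda>(r, c). y $$ (r, id c)) = 1\<^sub>m k" by (rule eq_matI) (auto simp: y_def)
    hence "max_minor k (\<lambda>r c. y $$ (r, c)) id \<noteq> 0" by (simp add: max_minor_def)
    moreover have "id \<in> selections k (k + 2)" by (rule selectionsI) auto
    ultimately show ?thesis using full_row_rankI[OF yc] by (simp add: represents_def Y_def)
  qed
  have tw: "twistor Z y i j = p (i - 1) (j - 1)" if "i \<in> {1..n}" "j \<in> {1..n}" for i j
  proof -
    have "twistor Z y i j = bracket k (\<lambda>r c. if r = c then 1 else 0) (\<lambda>c. Z $$ (i - 1, c)) (\<lambda>c. Z $$ (j - 1, c))"
      unfolding twistor_eq_bracket[OF yc Zc that] bracket_def
      by (intro arg_cong[of _ _ det] eq_matI) (auto simp: y_def)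
    also have "\<dots> = p (i - 1) (j - 1)"
      unfolding bracket_unit_rows using that by (auto simp: Z_def B_def p_def)
    finally show ?thesis .
  qed
  define S where "S = {d. 1 \<le> d \<and> Suc d < n \<and> p 0 d * p 0 (Suc d) < 0}"
  define \<iota> where "\<iota> = pick S"
  have \<iota>S: "\<iota> l \<in> S" if "l < k" for l using pick_in_set_le[of l S] flips that by (simp add: S_def \<iota>_def)
  have \<iota>mono: "\<iota> l < \<iota> l'" if "l < l'" "l' < k" for l l'
    using pick_mono_le[of l' S l] flips that by (simp add: S_def \<iota>_def)
  have \<iota>: "1 \<le> \<iota> l" "Suc (\<iota> l) < n" "p 0 (\<iota> l) * p 0 (Suc (\<iota> l)) < 0" if "l < k" for l
    using \<iota>S[OF that] by (auto simp: S_def)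
  have sgnp: "(-1) ^ l * p 0 (\<iota> l) > 0" if l: "l < k" for l
  proof -
    define v where "v d = p 0 (Suc d)" for d
    have "{d. d < \<iota> l - 1 \<and> v d * v (Suc d) < 0} = (\<lambda>d. d - 1) ` {a \<in> S. a < \<iota> l}"
    proof (rule Set.set_eqI)
      fix d
      have "d \<in> (\<lambda>d. d - 1) ` {a \<in> S. a < \<iota> l} \<longleftrightarrow> Suc d \<in> {a \<in> S. a < \<iota> l}"
      proof
        assume "d \<in> (\<lambda>d. d - 1) ` {a \<in> S. a < \<iota> l}"
        then obtain a where "a \<in> S" "a < \<iota> l" "d = a - 1" by auto
        thus "Suc d \<in> {a \<in> S. a < \<iota> l}" by (auto simp: S_def)
      qed (force simp: image_iff)
      also have "\<dots> \<longleftrightarrow> d < \<iota> l - 1 \<and> v d * v (Suc d) < 0"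
        using \<iota>[OF l] by (auto simp: S_def v_def)
      finally show "d \<in> {d. d < \<iota> l - 1 \<and> v d * v (Suc d) < 0} \<longleftrightarrow> d \<in> (\<lambda>d. d - 1) ` {a \<in> S. a < \<iota> l}" by simp
    qed
    hence "changes v (\<iota> l - 1) = card ((\<lambda>d. d - 1) ` {a \<in> S. a < \<iota> l})" by (simp add: changes_def)
    also have "\<dots> = card {a \<in> S. a < \<iota> l}" by (intro card_image) (auto simp: inj_on_def S_def)
    also have "\<dots> = l" unfolding \<iota>_def using card_pick_le[of l S] flips l by (simp add: S_def)
    finally have "sgn (v (\<iota> l - 1)) = (-1) ^ l * sgn (v 0)"
      using sgn_eq_changes[of "\<iota> l - 1" v] nz \<iota>[OF l] by (simp add: v_def)
    moreover have "v (\<iota> l - 1) = p 0 (\<iota> l)" using \<iota>[OF l] by (simp add: v_def)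
    moreover have "sgn (v 0) = 1" using pos[of 0] k by (simp add: v_def)
    ultimately have "sgn (p 0 (\<iota> l)) = (-1) ^ l" by simp
    hence "p 0 (\<iota> l) = (-1) ^ l * \<bar>p 0 (\<iota> l)\<bar>" by (metis sgn_mult_abs)
    hence "(-1) ^ l * p 0 (\<iota> l) = ((-1) ^ l * (-1) ^ l) * \<bar>p 0 (\<iota> l)\<bar>" by simp
    also have "((-1) ^ l * (-1) ^ l :: real) = 1" by (simp flip: power_add)
    finally show ?thesis using \<iota>(3)[OF l] by auto
  qed
  have sgnp': "(-1) ^ l * p 0 (Suc (\<iota> l)) < 0" if l: "l < k" for l
  proof -
    have "((-1) ^ l * p 0 (\<iota> l)) * ((-1) ^ l * p 0 (Suc (\<iota> l))) =
      ((-1) ^ l * (-1) ^ l) * (p 0 (\<iota> l) * p 0 (Suc (\<iota> l)))" by (simp only: mult_ac)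
    also have "((-1) ^ l * (-1) ^ l :: real) = 1" by (simp flip: power_add)
    finally show ?thesis using sgnp[OF l] \<iota>(3)[OF l] by (simp add: mult_less_0_iff zero_less_mult_iff) linarith
  qed
  \<comment> \<open>The row \<open>l\<close> is the linear relation among the plane vectors with the indices \<open>0\<close>, \<open>\<iota> l\<close> and \<open>\<iota> l + 1\<close>, with
    the sign that makes the last two entries positive; the first one then has the sign \<open>(-1)\<^sup>l\<close>.\<close>
  define K where "K l j = (-1) ^ l * (if j = 0 then p (\<iota> l) (Suc (\<iota> l)) else if j = \<iota> l then - p 0 (Suc (\<iota> l))
      else if j = Suc (\<iota> l) then p 0 (\<iota> l) else 0)" for l j
  have Ksum: "(\<Sum>j<n. K l j * g j) = (-1) ^ l * (p (\<iota> l) (Suc (\<iota> l)) * g 0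
      - p 0 (Suc (\<iota> l)) * g (\<iota> l) + p 0 (\<iota> l) * g (Suc (\<iota> l)))" if l: "l < k" for l g
  proof -
    have "(\<Sum>j<n. K l j * g j) = (\<Sum>j\<in>{0, \<iota> l, Suc (\<iota> l)}. K l j * g j)"
      using \<iota>[OF l] by (intro sum.mono_neutral_right) (auto simp: K_def)
    also have "\<dots> = K l 0 * g 0 + K l (\<iota> l) * g (\<iota> l) + K l (Suc (\<iota> l)) * g (Suc (\<iota> l))"
      using \<iota>[OF l] by simp
    finally show ?thesis using \<iota>[OF l] by (simp add: K_def algebra_simps)
  qed
  have Kpos: "K l j \<ge> 0" if "l < k" "j \<noteq> 0" for l j
    using sgnp[OF that(1)] sgnp'[OF that(1)] that(2) by (auto simp: K_def)
  define C where "C = mat k n (\<lambda>(l, j). K l j)"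
  have Cc: "C \<in> carrier_mat k n" by (simp add: C_def)
  have minorC: "max_minor k (\<lambda>r c. C $$ (r, c)) f = max_minor k K f" if "f \<in> selections k n" for f
    by (rule max_minor_cong) (use selectionsD(1)[OF that] in \<open>auto simp: C_def\<close>)
  have Cnn: "max_minor k (\<lambda>r c. C $$ (r, c)) f \<ge> 0" if f: "f \<in> selections k n" for f
    unfolding minorC[OF f]
  proof (rule staircase_minors_nonneg[where \<iota> = \<iota> and n = n])
    show "j = \<iota> l \<or> j = Suc (\<iota> l)" if "l < k" "j \<noteq> 0" "K l j \<noteq> 0" for l j
      using that by (auto simp: K_def split: if_splits)
    show "(-1) ^ l * K l 0 \<ge> 0" if "l < k" for l
    proof -
      have "(-1) ^ l * K l 0 = ((-1) ^ l * (-1) ^ l) * p (\<iota> l) (Suc (\<iota> l))" by (simp add: K_def)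
      also have "((-1) ^ l * (-1) ^ l :: real) = 1" by (simp flip: power_add)
      finally show ?thesis using pos[OF \<iota>(2)[OF that]] by simp
    qed
  qed (use \<iota>mono Kpos f in auto)
  have \<iota>sel: "\<iota> \<in> selections k n"
    by (rule selectionsI) (use \<iota> \<iota>mono in \<open>auto intro: Suc_lessD\<close>)
  have "max_minor k K \<iota> = (\<Prod>l<k. mat k k (\<lambda>(r, c). K r (\<iota> c)) $$ (l, l))"
    unfolding max_minor_def
  proof (rule det_monotone_support)
    fix l l' q q'
    assume l: "l < l'" "l' < k" and q: "q < k" "q' < k"
      and nz: "mat k k (\<lambda>(r, c). K r (\<iota> c)) $$ (l, q) \<noteq> 0" "mat k k (\<lambda>(r, c). K r (\<iota> c)) $$ (l', q') \<noteq> 0"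
    have "\<iota> q = \<iota> l \<or> \<iota> q = Suc (\<iota> l)" "\<iota> q' = \<iota> l' \<or> \<iota> q' = Suc (\<iota> l')"
      using nz l q \<iota>[OF q(1)] \<iota>[OF q(2)] by (auto simp: K_def split: if_splits)
    hence "\<iota> q \<le> \<iota> q'" using \<iota>mono[OF l] by auto
    thus "q \<le> q'" using \<iota>mono[of q' q] q by (meson leD not_le)
  qed simp
  also have "\<dots> > 0"
  proof (intro prod_pos)
    fix l assume "l \<in> {..<k}"
    hence l: "l < k" by simp
    have "mat k k (\<lambda>(r, c). K r (\<iota> c)) $$ (l, l) = - ((-1) ^ l * p 0 (Suc (\<iota> l)))"
      using l \<iota>(1)[OF l] by (simp add: K_def)
    thus "0 < mat k k (\<lambda>(r, c). K r (\<iota> c)) $$ (l, l)" using sgnp'[OF l] by simp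
  qed
  finally have fullC: "full_row_rank k n C"
    using full_row_rankI[OF Cc \<iota>sel] minorC[OF \<iota>sel] by simp
  \<comment> \<open>By choice of the relations, the last two columns of \<open>CZ\<close> vanish. The rest \<open>E\<close> is invertible, since a
    kernel vector would be a polynomial of degree less than \<open>k\<close> that satisfies all \<open>k\<close> relations.\<close>
  define E where "E = mat k k (\<lambda>(l, c). \<Sum>j<n. K l j * x j ^ c)"
  have Ec: "E \<in> carrier_mat k k" by (simp add: E_def)
  have CZ: "C * Z = E * y"
  proof (rule eq_matI)
    fix l c assume "l < dim_row (E * y)" "c < dim_col (E * y)"
    hence l: "l < k" and c: "c < k + 2" using Ec yc by auto
    have "(C * Z) $$ (l, c) = (\<Sum>j<n. K l j * poly (B c) (x j))"
      using l c by (simp add: C_def Z_def scalar_prod_def lessThan_atLeast0)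
    also have "\<dots> = (if c < k then E $$ (l, c) else 0)"
    proof -
      consider "c < k" | "c = k" | "c = k + 1" using c by linarith
      thus ?thesis
      proof cases
        case 1 thus ?thesis using l by (simp add: E_def B_def poly_monom)
      next
        case 2 thus ?thesis unfolding Ksum[OF l] by (simp add: B_def p_def algebra_simps)
      next
        case 3 thus ?thesis unfolding Ksum[OF l] by (simp add: B_def p_def algebra_simps)
      qed
    qed
    also have "\<dots> = (\<Sum>s<k. E $$ (l, s) * y $$ (s, c))"
      using c by (simp add: y_def if_distrib cong: if_cong)
    also have "\<dots> = (E * y) $$ (l, c)"
      using l c Ec yc by (simp add: scalar_prod_def lessThan_atLeast0)
    finally show "(C * Z) $$ (l, c) = (E * y) $$ (l, c)" .
  qed (use Cc Zc Ec yc in auto)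
  have "det E \<noteq> 0"
  proof
    assume "det E = 0"
    then obtain v where v: "v \<in> carrier_vec k" "v \<noteq> 0\<^sub>v k" "E *\<^sub>v v = 0\<^sub>v k"
      using det_0_iff_vec_prod_zero[OF Ec] by auto
    define q where "q = (\<Sum>c<k. monom (v $ c) c)"
    have cq: "coeff q i = (if i < k then v $ i else 0)" for i
      unfolding q_def coeff_sum by (simp add: sum.delta)
    have q0: "q \<noteq> 0"
    proof
      assume "q = 0"
      hence "v $ i = 0" if "i < k" for i using cq[of i] that by simp
      thus False using v(1,2) by (auto intro!: eq_vecI)
    qed
    have "degree q < k" using k cq by (intro degree_lessI) auto
    moreover have "k \<le> degree q"
    proof (rule alternating_relations_force_degree[OF x, where \<iota> = \<iota> and
          a = "\<lambda>l. p (\<iota> l) (Suc (\<iota> l))" and b = "\<lambda>l. (-1) ^ l * - p 0 (Suc (\<iota> l))" and c = "\<lambda>l. (-1) ^ l * p 0 (\<iota> l)"])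
      fix l assume l: "l < k"
      have "0 = (E *\<^sub>v v) $ l" using v(3) l by simp
      also have "\<dots> = (\<Sum>c<k. (\<Sum>j<n. K l j * x j ^ c) * v $ c)"
        using l v(1) by (simp add: E_def scalar_prod_def lessThan_atLeast0)
      also have "\<dots> = (\<Sum>j<n. \<Sum>c<k. K l j * (v $ c * x j ^ c))"
        unfolding sum_distrib_right by (subst sum.swap) (simp add: mult_ac)
      also have "\<dots> = (\<Sum>j<n. K l j * poly q (x j))"
        unfolding q_def poly_sum poly_monom sum_distrib_left ..
      finally show "(-1) ^ l * p (\<iota> l) (Suc (\<iota> l)) * poly q (x 0) + (-1) ^ l * - p 0 (Suc (\<iota> l)) * poly q (x (\<iota> l)) +
         (-1) ^ l * p 0 (\<iota> l) * poly q (x (Suc (\<iota> l))) = 0"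
        unfolding Ksum[OF l] by (simp add: algebra_simps)
    next
      fix l assume "l < k"
      thus "0 < p (\<iota> l) (Suc (\<iota> l)) \<and> 0 < (-1) ^ l * - p 0 (Suc (\<iota> l)) \<and> 0 < (-1) ^ l * p 0 (\<iota> l)"
        using pos[OF \<iota>(2)] sgnp sgnp' by auto
    qed (use \<iota> \<iota>mono q0 in auto)
    ultimately show False by simp
  qed
  hence "represents k (k + 2) (C * Z) Y" unfolding CZ by (rule represents_row_change[OF y Ec])
  hence "Z_map Z (row_span n C) = Y"
    using Z_map_row_span[OF Cc Zc] by (simp add: represents_def)
  moreover have "row_span n C \<in> Gr_nonneg k n"
    unfolding Gr_nonneg_def Gr_def represents_def
    using fullC Cnn nonneg_minors_iff[OF Cc] by blast
  ultimately have "Y \<in> amplituhedron n k Z" by (auto simp: amplituhedron_def)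
  thus ?thesis using Z y tw by blast
qed

text \<open>Lift the positions in the word to angles \<open>\<theta>\<close> that increase by less than \<open>\<pi>\<close> in each step and stay strictly
  between \<open>0\<close> and \<open>(k + 1) \<pi>\<close>, and find \<open>x\<close> such that \<open>(x + i)\<^sup>k\<^sup>+\<^sup>1\<close> has the argument \<open>(k + 1) \<pi> - \<theta>\<close>.\<close>
lemma word_realizable:
  assumes k: "1 \<le> k" "k + 2 \<le> n" and w: "w \<in> D (k + 1) n"
  obtains Z Y y where "Z \<in> Mat_pos n (k + 2)" "Y \<in> amplituhedron n k Z" "represents k (k + 2) y Y"
    "\<And>i j. i \<in> {1..n} \<Longrightarrow> j \<in> {1..n} \<Longrightarrow> sgn (twistor Z y i j) = word_sign n w i j"
proof -
  have n: "n \<ge> 3" using k by simp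
  have w': "distinct w" "set w = {1..n}" "last w = n" "card (cDes_L n w) = k + 1"
    using w by (auto simp: D_iff)
  note W = n w'(1-3)
  let ?h = "\<lambda>j. real (half_turns n w (Suc j))" and ?s = "\<lambda>j. real (slot n w (Suc j))"
  \<comment> \<open>The offset \<open>3/2\<close> makes the first angle \<open>\<pi> / (2 n)\<close>, as the slot of \<open>z\<^sub>1\<close> is \<open>n - 1\<close>; the last
    angle stays below \<open>(k + 1) \<pi>\<close> because \<open>z\<^sub>n\<close> is in an earlier slot.\<close>
  define \<theta> where "\<theta> j = pi * (?h j - 1) + pi * (?s j + 3/2) / real n" for j
  have npos: "real n > 0" using n by simp
  have slt: "?s j + 1 \<le> real n" if "j < n" for j
    using slot_less[OF W, of "Suc j"] that by auto
  have sneq: "?s i \<noteq> ?s j" if "i < n" "j < n" "i \<noteq> j" for i j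
    using slot_inj[OF W, of "Suc i" "Suc j"] that by auto
  have diff: "\<theta> j - \<theta> i = pi * (?h j - ?h i) + pi * ((?s j - ?s i) / real n)" for i j
    using npos by (simp add: \<theta>_def field_simps)
  have bound: "\<bar>(?s j - ?s i) / real n\<bar> < 1" if "i < n" "j < n" for i j
    using slt[OF that(1)] slt[OF that(2)] npos by (simp add: abs_less_iff field_simps)
  have step: "0 < \<theta> (Suc i) - \<theta> i" if "Suc i < n" for i
  proof -
    have h: "?h (Suc i) = ?h i + (if ?s (Suc i) < ?s i then 1 else 0)"
      using half_turns_Suc[OF W, of "Suc i"] that by simp
    have b: "\<bar>(?s (Suc i) - ?s i) / real n\<bar> < 1" using bound[of i "Suc i"] that by simp
    have "?h (Suc i) - ?h i + (?s (Suc i) - ?s i) / real n > 0"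
      using h b sneq[of i "Suc i"] that npos by (auto simp: field_simps)
    hence "0 < pi * (?h (Suc i) - ?h i + (?s (Suc i) - ?s i) / real n)" by simp
    thus ?thesis unfolding diff by (simp add: algebra_simps)
  qed
  have inc: "\<theta> i < \<theta> j" if "i < j" "j < n" for i j
    using that
  proof (induction j)
    case (Suc j) thus ?case using step[of j] by (cases "i = j") auto
  qed simp
  have \<theta>0: "\<theta> 0 > 0"
  proof -
    have s0: "?s 0 = real n - 1" using slot_1[OF W] n by simp
    have "\<theta> 0 = pi * (1 / (2 * real n))"
      using npos half_turns_1[OF W] unfolding \<theta>_def s0 by (simp add: field_simps)
    thus ?thesis using npos by simp
  qed
  have \<theta>n: "\<theta> (n - 1) < (real k + 1) * pi"
  proof -
    have "?h (n - 1) = real k + 1" using half_turns_n[OF W] w'(4) n by simp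
    moreover have "?s (n - 1) + 3/2 < real n"
    proof -
      have "slot n w n \<noteq> slot n w 1" using slot_inj[OF W, of n 1] n by auto
      hence "slot n w n + 2 \<le> n" using slot_less[OF W, of n] slot_1[OF W] n by simp
      thus ?thesis using n by simp
    qed
    hence "(?s (n - 1) + 3/2) / real n < 1" using npos by simp
    ultimately have "(?h (n - 1) - 1) + (?s (n - 1) + 3/2) / real n < real k + 1" by simp
    hence "pi * ((?h (n - 1) - 1) + (?s (n - 1) + 3/2) / real n) < pi * (real k + 1)" by simp
    thus ?thesis unfolding \<theta>_def by (simp add: algebra_simps)
  qed
  \<comment> \<open>The cotangent decreases, so \<open>\<theta>\<close> is reflected to make \<open>x\<close> increase.\<close>
  define \<alpha> where "\<alpha> j = pi - \<theta> j / (real k + 1)" for j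
  have \<theta>range: "0 < \<theta> j" "\<theta> j < (real k + 1) * pi" if "j < n" for j
  proof -
    show "0 < \<theta> j"
    proof (cases "j = 0")
      case False
      hence "\<theta> 0 < \<theta> j" by (intro inc that) simp
      thus ?thesis using \<theta>0 by linarith
    qed (use \<theta>0 in simp)
    show "\<theta> j < (real k + 1) * pi"
    proof (cases "j = n - 1")
      case False
      hence "\<theta> j < \<theta> (n - 1)" using that by (intro inc) auto
      thus ?thesis using \<theta>n by linarith
    qed (use \<theta>n in simp)
  qed
  have \<alpha>range: "0 < \<alpha> j" "\<alpha> j < pi" if "j < n" for j
    using \<theta>range[OF that] by (simp_all add: \<alpha>_def field_simps)
  have \<alpha>dec: "\<alpha> j < \<alpha> i" if "i < j" "j < n" for i j
    using inc[OF that] by (simp add: \<alpha>_def divide_strict_right_mono)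
  have sinpos: "sin (\<alpha> j) > 0" if "j < n" for j using \<alpha>range[OF that] by (rule sin_gt_zero)
  define x where "x j = cot (\<alpha> j)" for j
  define F where "F = fst (powers_of_X_plus_i (k + 1))"
  define G where "G = snd (powers_of_X_plus_i (k + 1))"
  have x: "x i < x j" if "i < j" "j < n" for i j
  proof -
    have s: "sin (\<alpha> i) > 0" "sin (\<alpha> j) > 0" using sinpos that by auto
    have "0 < sin (\<alpha> i - \<alpha> j)"
      using \<alpha>dec[OF that] \<alpha>range[of i] \<alpha>range[of j] that by (intro sin_gt_zero) auto
    hence "cos (\<alpha> i) * sin (\<alpha> j) < cos (\<alpha> j) * sin (\<alpha> i)" by (simp add: sin_diff mult_ac)
    thus ?thesis using s by (simp add: x_def cot_def field_simps)
  qed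
  define p where "p i j = poly G (x i) * poly F (x j) - poly G (x j) * poly F (x i)" for i j
  have psin: "sgn (p i j) = sgn (sin (\<theta> j - \<theta> i))" if ij: "i < n" "j < n" for i j
  proof -
    define r where "r j = sin (\<alpha> j) ^ (k + 1)" for j
    have r: "r i > 0" "r j > 0" using sinpos ij by (auto simp: r_def)
    have ang: "real (k + 1) * \<alpha> j = (real k + 1) * pi - \<theta> j" for j
      by (simp add: \<alpha>_def field_simps)
    have F': "r j * poly F (x j) = cos ((real k + 1) * pi - \<theta> j)"
      and G': "r j * poly G (x j) = sin ((real k + 1) * pi - \<theta> j)" if "j < n" for j
      using powers_of_X_plus_i_cot[of "\<alpha> j" "k + 1"] sinpos[OF that]
      unfolding ang r_def x_def F_def G_def by auto
    have "r i * r j * p i j = (r i * poly G (x i)) * (r j * poly F (x j)) - (r j * poly G (x j)) * (r i * poly F (x i))"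
      by (simp add: p_def algebra_simps)
    also have "\<dots> = sin (((real k + 1) * pi - \<theta> i) - ((real k + 1) * pi - \<theta> j))"
      unfolding F'[OF ij(1)] F'[OF ij(2)] G'[OF ij(1)] G'[OF ij(2)] by (subst sin_diff) (simp add: mult_ac)
    finally have "r i * r j * p i j = sin (\<theta> j - \<theta> i)" by simp
    moreover have "sgn (r i * r j * p i j) = sgn (p i j)" using r by (simp add: sgn_mult)
    ultimately show ?thesis by simp
  qed
  have psgn: "sgn (p i j) = word_sign n w (Suc i) (Suc j)" if ij: "i < n" "j < n" for i j
  proof -
    define u where "u = (?s j - ?s i) / real n"
    define a b where "a = half_turns n w (Suc i)" and "b = half_turns n w (Suc j)"
    have "sin (\<theta> j - \<theta> i) = sin (pi * u + (real b * pi - real a * pi))"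
      unfolding diff u_def a_def b_def by (simp add: algebra_simps)
    also have "\<dots> = sin (pi * u) * ((-1) ^ b * (-1) ^ a)"
      by (simp add: sin_add cos_diff sin_diff mult.commute[of _ pi])
    finally have s: "sgn (sin (\<theta> j - \<theta> i)) = sgn (sin (pi * u)) * ((-1) ^ b * (-1) ^ a)"
      by (simp add: sgn_mult power_sgn)
    have u: "\<bar>u\<bar> < 1" using bound[OF ij] by (simp add: u_def)
    have sin_pos: "0 < sin (pi * t)" if "0 < t" "t < 1" for t :: real
    proof (rule sin_gt_zero)
      show "0 < pi * t" using that by simp
      show "pi * t < pi" using mult_strict_left_mono[OF that(2) pi_gt_zero] by simp
    qed
    have "sgn (sin (pi * u)) = sgn u"
    proof (cases u "0 :: real" rule: linorder_cases)
      case less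
      hence "0 < sin (pi * (-u))" using u by (intro sin_pos) auto
      thus ?thesis using less by simp
    next
      case greater
      hence "0 < sin (pi * u)" using u by (intro sin_pos) auto
      thus ?thesis using greater by simp
    qed simp
    moreover have "sgn u = sgn (?s j - ?s i)" using npos by (simp add: u_def sgn_divide)
    ultimately show ?thesis unfolding psin[OF ij] s by (simp add: word_sign_def a_def b_def mult_ac)
  qed
  have pos: "p i (Suc i) > 0" if "Suc i < n" for i
    using psgn[of i "Suc i"] word_sign_consecutive[OF W, of "Suc i"] that by (simp add: sgn_1_pos)
  have nz: "p i j \<noteq> 0" if "i < n" "j < n" "i \<noteq> j" for i j
    using psgn[OF that(1,2)] word_sign_values[OF W, of "Suc i" "Suc j"] that by auto
  have flips: "card {d. 1 \<le> d \<and> Suc d < n \<and> p 0 d * p 0 (Suc d) < 0} = k"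
  proof -
    have ws: "word_sign n w 1 j = - ((-1) ^ half_turns n w j)" if "2 \<le> j" "j \<le> n" for j
    proof -
      have "slot n w j < slot n w 1"
        using slot_1[OF W] slot_less[OF W, of j] slot_inj[OF W, of 1 j] that by auto
      thus ?thesis using half_turns_1[OF W] by (simp add: word_sign_def)
    qed
    have iff: "p 0 d * p 0 (Suc d) < 0 \<longleftrightarrow> Suc d \<in> cDes_L n w" if d: "1 \<le> d" "Suc d < n" for d
    proof -
      have "p 0 d * p 0 (Suc d) < 0 \<longleftrightarrow> word_sign n w 1 (Suc d) * word_sign n w 1 (Suc (Suc d)) < 0"
      proof (rule prod_neg_cong_sgn)
        have "word_sign n w 1 (Suc d) = sgn (p 0 d)" "word_sign n w 1 (Suc (Suc d)) = sgn (p 0 (Suc d))"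
          using psgn[of 0 d] psgn[of 0 "Suc d"] d by simp_all
        thus "sgn (p 0 d) = sgn (word_sign n w 1 (Suc d))"
          "sgn (p 0 (Suc d)) = sgn (word_sign n w 1 (Suc (Suc d)))" by simp_all
      qed
      also have "\<dots> \<longleftrightarrow> slot n w (Suc (Suc d)) < slot n w (Suc d)"
        using ws[of "Suc d"] ws[of "Suc (Suc d)"] d half_turns_Suc[OF W, of "Suc d"]
        by (auto simp: minus_one_power_iff)
      also have "\<dots> \<longleftrightarrow> Suc d \<in> cDes_L n w" using cDes_L_iff_slot[OF W, of "Suc d"] d by simp
      finally show ?thesis .
    qed
    have "slot n w 2 < slot n w 1"
      using slot_less[OF W, of 2] slot_inj[OF W, of 1 2] slot_1[OF W] n by auto
    hence one: "1 \<in> cDes_L n w" using cDes_L_iff_slot[OF W, of 1] n by (simp add: numeral_2_eq_2)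
    have range: "1 \<le> c \<and> c < n" if "c \<in> cDes_L n w" for c
    proof -
      have "c \<in> {1..n}" using that by (auto simp: cDes_L_def)
      thus ?thesis using cDes_L_iff_slot[OF W, of c] that by auto
    qed
    have "Suc ` {d. 1 \<le> d \<and> Suc d < n \<and> p 0 d * p 0 (Suc d) < 0} = cDes_L n w - {1}"
    proof (rule Set.set_eqI)
      fix c
      show "c \<in> Suc ` {d. 1 \<le> d \<and> Suc d < n \<and> p 0 d * p 0 (Suc d) < 0} \<longleftrightarrow> c \<in> cDes_L n w - {1}"
        using iff[of "c - 1"] range[of c] by (cases c) (auto simp: image_iff)
    qed
    hence "card (Suc ` {d. 1 \<le> d \<and> Suc d < n \<and> p 0 d * p 0 (Suc d) < 0}) = card (cDes_L n w - {1})"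
      by (rule arg_cong)
    hence "card {d. 1 \<le> d \<and> Suc d < n \<and> p 0 d * p 0 (Suc d) < 0} = card (cDes_L n w - {1})"
      by (subst (asm) card_image) simp_all
    also have "\<dots> = k" using one w'(4) by simp
    finally show ?thesis .
  qed
  have FG: "degree F = k + 1" "lead_coeff F > 0" "degree G = k" "lead_coeff G > 0"
    using powers_of_X_plus_i_degree(1,2)[of "k + 1"] powers_of_X_plus_i_degree(3,4)[of k]
    by (simp_all add: F_def G_def)
  have "\<exists>Z Y y. Z \<in> Mat_pos n (k + 2) \<and> Y \<in> amplituhedron n k Z \<and> represents k (k + 2) y Y \<and>
     (\<forall>i\<in>{1..n}. \<forall>j\<in>{1..n}. twistor Z y i j = p (i - 1) (j - 1))"
    unfolding p_def
  proof (rule polynomial_configuration_in_amplituhedron[OF k FG])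
    show "x i < x j" if "i < j" "j < n" for i j by (rule x[OF that])
    show "0 < poly G (x i) * poly F (x (Suc i)) - poly G (x (Suc i)) * poly F (x i)" if "Suc i < n" for i
      by (rule pos[OF that, unfolded p_def])
    show "poly G (x 0) * poly F (x j) - poly G (x j) * poly F (x 0) \<noteq> 0" if "1 \<le> j" "j < n" for j
      by (rule nz[unfolded p_def]) (use that in auto)
  qed (rule flips[unfolded p_def])
  then obtain Z Y y where "Z \<in> Mat_pos n (k + 2)" "Y \<in> amplituhedron n k Z" "represents k (k + 2) y Y"
    "\<forall>i\<in>{1..n}. \<forall>j\<in>{1..n}. twistor Z y i j = p (i - 1) (j - 1)" by blast
  moreover have "sgn (p (i - 1) (j - 1)) = word_sign n w i j" if "i \<in> {1..n}" "j \<in> {1..n}" for i j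
    using psgn[of "i - 1" "j - 1"] that by auto
  ultimately show ?thesis using that[of Z Y y] by simp
qed

section \<open>Realizable chambers are the chambers of words\<close>

theorem corollary11p20:
  fixes k n :: nat
  assumes "k \<ge> 1" and "n \<ge> 1" and "k + 2 \<le> n"
  shows "(\<forall>\<sigma>. sign_vector n \<sigma> \<and> realizable n k \<sigma> \<longrightarrow>
            (\<exists>w \<in> D (k + 1) n. \<forall>Z \<in> Mat_pos n (k + 2). chamber n k \<sigma> Z = w_chamber n k w Z))
       \<and> (\<forall>w \<in> D (k + 1) n.
            \<exists>\<sigma>. sign_vector n \<sigma> \<and> realizable n k \<sigma> \<and>
              (\<forall>Z \<in> Mat_pos n (k + 2). w_chamber n k w Z = chamber n k \<sigma> Z))"
proof (intro conjI allI impI ballI)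
  fix \<sigma> assume "sign_vector n \<sigma> \<and> realizable n k \<sigma>"
  then obtain w \<epsilon> where w: "w \<in> D (k + 1) n" "\<epsilon> \<in> {1, -1}"
    "\<And>i j. 1 \<le> i \<Longrightarrow> i < j \<Longrightarrow> j \<le> n \<Longrightarrow> \<sigma> i j = \<epsilon> * word_sign n w i j"
    using realizable_word[OF assms(1,3)] by metis
  thus "\<exists>w \<in> D (k + 1) n. \<forall>Z \<in> Mat_pos n (k + 2). chamber n k \<sigma> Z = w_chamber n k w Z"
    using chamber_eq_w_chamber[OF assms(1,3) w(1,2), of \<sigma>] by blast
next
  fix w assume w: "w \<in> D (k + 1) n"
  have W: "n \<ge> 3" "distinct w" "set w = {1..n}" "last w = n"
    using w assms by (auto simp: D_iff)
  obtain Z Y y where Z: "Z \<in> Mat_pos n (k + 2)" and Y: "Y \<in> amplituhedron n k Z" "represents k (k + 2) y Y"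
    "\<And>i j. i \<in> {1..n} \<Longrightarrow> j \<in> {1..n} \<Longrightarrow> sgn (twistor Z y i j) = word_sign n w i j"
    using word_realizable[OF assms(1,3) w] by metis
  hence "Y \<in> chamber n k (word_sign n w) Z" by (auto simp: chamber_def)
  hence "realizable n k (word_sign n w)" using Z by (auto simp: realizable_def)
  moreover have "sign_vector n (word_sign n w)"
    unfolding sign_vector_def using word_sign_values[OF W] by auto
  moreover have "w_chamber n k w Z = chamber n k (word_sign n w) Z" if "Z \<in> Mat_pos n (k + 2)" for Z
    using chamber_eq_w_chamber[OF assms(1,3) w, of 1 "word_sign n w" Z] that by simp
  ultimately show "\<exists>\<sigma>. sign_vector n \<sigma> \<and> realizable n k \<sigma> \<and>
      (\<forall>Z \<in> Mat_pos n (k + 2). w_chamber n k w Z = chamber n k \<sigma> Z)"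
    by blast
qed

end
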